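(* Let the potentials $\{\overline{A}',V'\}$ be given as the retarded potentials $$V'(\overline{r},t)=\frac{1}{4\pi\epsilon_{0}}\int\frac{\rho(\overline{r}',t_{r})}{\mathfrak{r}}\,d\tau',\qquad \overline{A}'(\overline{r},t)=\frac{\mu_{0}}{4\pi}\int\frac{\overline{J}(\overline{r}',t_{r})}{\mathfrak{r}}\,d\tau'.$$ Then, assuming $\{\rho,\overline{J}\}$ satisfy the continuity equation $\frac{\partial\rho}{\partial t}+\nabla\cdot\overline{J}=0$ and $\overline{J}$ vanishes at infinity, these potentials satisfy the Lorentz gauge condition $$\nabla\cdot\overline{A}'+\mu_{0}\epsilon_{0}\frac{\partial V'}{\partial t}=0$$ and the equations $$\nabla^{2}V'-\mu_{0}\epsilon_{0}\frac{\partial^{2}V'}{\partial t^{2}}=-\frac{\rho}{\epsilon_{0}},\qquad \nabla^{2}\overline{A}'-\mu_{0}\epsilon_{0}\frac{\partial^{2}\overline{A}'}{\partial t^{2}}=-\mu_{0}\overline{J}.$$ In particular, the corresponding fields $\overline{E}'=-\nabla V'-\frac{\partial\overline{A}'}{\partial t}$, $\overline{B}'=\nabla\times\overline{A}'$, which are given by Jefimenko's equations $$\overline{E}'(\overline{r},t)=\frac{1}{4\pi\epsilon_{0}}\int\left[\frac{\rho(\overline{r}',t_{r})}{\mathfrak{r}^{2}}\hat{\overline{\mathfrak{r}}}+\frac{\dot{\rho}(\overline{r}',t_{r})}{c\,\mathfrak{r}}\hat{\overline{\mathfrak{r}}}-\frac{\dot{\overline{J}}(\overline{r}',t_{r})}{c^{2}\mathfrak{r}}\right]d\tau',$$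 $$\overline{B}'(\overline{r},t)=\frac{\mu_{0}}{4\pi}\int\left[\frac{\overline{J}(\overline{r}',t_{r})}{\mathfrak{r}^{2}}+\frac{\dot{\overline{J}}(\overline{r}',t_{r})}{c\,\mathfrak{r}}\right]\times\hat{\overline{\mathfrak{r}}}\,d\tau',$$ satisfy Maxwell's equations for $\{\rho,\overline{J}\}$.
   Context: $\rho$ (scalar valued) and $\overline{J}$ (vector valued) are smooth functions on $\mathbb{R}^{3}\times\mathbb{R}$. $\epsilon_{0},\mu_{0}>0$ are constants and $c=1/\sqrt{\mu_{0}\epsilon_{0}}$. The integrals are over $\overline{r}'\in\mathbb{R}^{3}$ with volume element $d\tau'$; $\overline{\mathfrak{r}}=\overline{r}-\overline{r}'$, $\mathfrak{r}=|\overline{\mathfrak{r}}|$, $\hat{\overline{\mathfrak{r}}}=\overline{\mathfrak{r}}/\mathfrak{r}$, and $t_{r}=t-\mathfrak{r}/c$ is the retarded time. A dot denotes the partial derivative in time. Maxwell's equations for $(\rho,\overline{J},\overline{E},\overline{B})$ are: $\nabla\cdot\overline{E}=\rho/\epsilon_{0}$, $\nabla\cdot\overline{B}=0$, $\nabla\times\overline{E}=-\frac{\partial\overline{B}}{\partial t}$, $\nabla\times\overline{B}=\mu_{0}\overline{J}+\mu_{0}\epsilon_{0}\frac{\partial\overline{E}}{\partial t}$.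
   Formalization: It is additionally assumed that the retarded integrals of ρ, J and their first two time derivatives, divided by the distance, converge absolutely and locally uniformly in (r,t); without this the potentials may be undefined (ρ = 1, J = 0). *)

theory Defs
  imports "HOL-Analysis.Analysis"
begin

text \<open>
  Fields are curried functions of position and time, \<open>real^3 \<Rightarrow> real \<Rightarrow> 'b\<close>; their regularity
  is that of the uncurried map on the normed space \<open>(real^3) \<times> real\<close>.
\<close>

fun Ck :: "nat \<Rightarrow> ('a::real_normed_vector \<Rightarrow> 'b::real_normed_vector) \<Rightarrow> bool" where
  "Ck 0 f \<longleftrightarrow> continuous_on UNIV f"
| "Ck (Suc k) f \<longleftrightarrow>
     (\<forall>x. f differentiable (at x)) \<and> (\<forall>v. Ck k (\<lambda>x. frechet_derivative f (at x) v))"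

definition smooth :: "('a::real_normed_vector \<Rightarrow> 'b::real_normed_vector) \<Rightarrow> bool" where
  "smooth f \<longleftrightarrow> (\<forall>k. Ck k f)"

definition partial :: "3 \<Rightarrow> (real^3 \<Rightarrow> 'b::real_normed_vector) \<Rightarrow> real^3 \<Rightarrow> 'b" where
  "partial i f r = vector_derivative (\<lambda>h. f (r + h *\<^sub>R axis i 1)) (at 0)"

definition time_deriv ::
    "(real^3 \<Rightarrow> real \<Rightarrow> 'b::real_normed_vector) \<Rightarrow> real^3 \<Rightarrow> real \<Rightarrow> 'b" where
  "time_deriv f r t = vector_derivative (\<lambda>s. f r s) (at t)"

definition grad :: "(real^3 \<Rightarrow> real) \<Rightarrow> real^3 \<Rightarrow> real^3" where
  "grad f r = (\<chi> i. partial i f r)"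

definition divergence :: "(real^3 \<Rightarrow> real^3) \<Rightarrow> real^3 \<Rightarrow> real" where
  "divergence F r = (\<Sum>i\<in>UNIV. partial i (\<lambda>x. F x $ i) r)"

definition curl :: "(real^3 \<Rightarrow> real^3) \<Rightarrow> real^3 \<Rightarrow> real^3" where
  "curl F r = vector
     [partial 2 (\<lambda>x. F x $ 3) r - partial 3 (\<lambda>x. F x $ 2) r,
      partial 3 (\<lambda>x. F x $ 1) r - partial 1 (\<lambda>x. F x $ 3) r,
      partial 1 (\<lambda>x. F x $ 2) r - partial 2 (\<lambda>x. F x $ 1) r]"

text \<open>The codomain is kept general: on vector fields this is the componentwise Laplacian.\<close>

definition laplacian :: "(real^3 \<Rightarrow> 'b::real_normed_vector) \<Rightarrow> real^3 \<Rightarrow> 'b" where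
  "laplacian f r = (\<Sum>i\<in>UNIV. partial i (partial i f) r)"

definition maxwell_equations ::
    "real \<Rightarrow> real \<Rightarrow> (real^3 \<Rightarrow> real \<Rightarrow> real) \<Rightarrow> (real^3 \<Rightarrow> real \<Rightarrow> real^3) \<Rightarrow>
     (real^3 \<Rightarrow> real \<Rightarrow> real^3) \<Rightarrow> (real^3 \<Rightarrow> real \<Rightarrow> real^3) \<Rightarrow> bool" where
  "maxwell_equations \<epsilon>\<^sub>0 \<mu>\<^sub>0 \<rho> J E B \<longleftrightarrow> (\<forall>r t.
     divergence (\<lambda>x. E x t) r = \<rho> r t / \<epsilon>\<^sub>0 \<and>
     divergence (\<lambda>x. B x t) r = 0 \<and>
     curl (\<lambda>x. E x t) r = - time_deriv B r t \<and>
     curl (\<lambda>x. B x t) r = \<mu>\<^sub>0 *\<^sub>R J r t + (\<mu>\<^sub>0 * \<epsilon>\<^sub>0) *\<^sub>R time_deriv E r t)"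

text \<open>
  Below, \<open>sgn (r - r')\<close> is the unit vector pointing from \<open>r'\<close> to \<open>r\<close>.
\<close>

definition jefimenko_E_integrand ::
    "real \<Rightarrow> (real^3 \<Rightarrow> real \<Rightarrow> real) \<Rightarrow> (real^3 \<Rightarrow> real \<Rightarrow> real^3) \<Rightarrow>
     real^3 \<Rightarrow> real \<Rightarrow> real^3 \<Rightarrow> real^3" where
  "jefimenko_E_integrand c \<rho> J r t r' =
     (let s = norm (r - r'); n = sgn (r - r'); tr = t - s / c in
        (\<rho> r' tr / s\<^sup>2) *\<^sub>R n + (time_deriv \<rho> r' tr / (c * s)) *\<^sub>R n
        - time_deriv J r' tr /\<^sub>R (c\<^sup>2 * s))"

definition jefimenko_B_integrand ::
    "real \<Rightarrow> (real^3 \<Rightarrow> real \<Rightarrow> real^3) \<Rightarrow> real^3 \<Rightarrow> real \<Rightarrow> real^3 \<Rightarrow> real^3" where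
  "jefimenko_B_integrand c J r t r' =
     (let s = norm (r - r'); n = sgn (r - r'); tr = t - s / c in
        cross3 (J r' tr /\<^sub>R s\<^sup>2 + time_deriv J r' tr /\<^sub>R (c * s)) n)"

text \<open>
  The integral of \<open>f(r', t - |r - r'|/c) / |r - r'|\<close> over \<open>r'\<close> converges absolutely, and
  uniformly for \<open>(r, t)\<close> in compact sets.  For continuous \<open>f\<close> only the tail at infinity
  matters, since \<open>1/|r - r'|\<close> is locally integrable.  Smoothness of \<open>f\<close> alone does not make
  the integral exist (\<open>f = 1\<close> is a counterexample), and even pointwise absolute convergence
  does not make it continuous in \<open>(r, t)\<close>.
\<close>

definition retarded_integral_converges ::
    "real \<Rightarrow> (real^3 \<Rightarrow> real \<Rightarrow> 'b::real_normed_vector) \<Rightarrow> bool" where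
  "retarded_integral_converges c f \<longleftrightarrow> (\<forall>K e. compact K \<longrightarrow> e > 0 \<longrightarrow>
     (\<exists>R. \<forall>(r, t) \<in> K.
        (\<integral>\<^sup>+ r' \<in> {r'. norm r' > R}.
           ennreal (norm (f r' (t - norm (r - r') / c)) / norm (r - r')) \<partial>lborel) \<le> ennreal e))"

text \<open>
  The integrals above converge for \<open>f\<close> and its first two time derivatives.  These are the
  integrals produced by differentiating \<open>f(r', t - |r - r'|/c) / |r - r'|\<close> at most twice in
  \<open>(r, t)\<close>: for \<open>r'\<close> fixed, every such derivative involves only time derivatives of \<open>f\<close>.
\<close>

definition retarded_potential_exists ::
    "real \<Rightarrow> (real^3 \<Rightarrow> real \<Rightarrow> 'b::real_normed_vector) \<Rightarrow> bool" where
  "retarded_potential_exists c f \<longleftrightarrow>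
     retarded_integral_converges c f \<and>
     retarded_integral_converges c (time_deriv f) \<and>
     retarded_integral_converges c (time_deriv (time_deriv f))"

end

theory Submission
  imports Defs
begin

text \<open>
  The argument works on space-time.  Writing \<open>u = r' - r\<close>, a retarded integral is an integral over the
  past light cone, \<open>\<integral> k(u) F(r + u, t - \<bar>u\<bar>/c) du\<close>, with \<open>k(u) = 1/\<bar>u\<bar>\<close> for the potentials.  The event
  \<open>(r, t)\<close> now sits only in the argument of \<open>F\<close>, so a source \<open>F\<close> that is supported in a bounded region of
  space can be differentiated under the integral sign as often as it is smooth
  (\<open>cone_integral_has_derivative\<close>).

  Spatial derivatives of \<open>F\<close> are moved onto the kernel by integration by parts
  (\<open>cone_integral_by_parts\<close>), which costs a term with \<open>\<partial>\<^sub>tF\<close> because the retarded time depends on \<open>u\<close>.  It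
  needs no divergence theorem: the integral of \<open>g(u + hv)\<close> does not depend on \<open>h\<close>, so the integral of a
  directional derivative of a compactly supported Lipschitz function vanishes
  (\<open>integral_directional_derivative_eq_0\<close>).  Kernels that are singular at \<open>0\<close> are first truncated at a
  small distance.  Moving one derivative gives the Jefimenko form of the gradient
  (\<open>cone_integral_inverse_norm_gradient\<close>); moving one of the two derivatives of the Laplacian gives the wave
  equation (\<open>cone_integral_wave_equation\<close>), whose source term is the flux \<open>4\<pi>\<close> of \<open>u/\<bar>u\<bar>\<^sup>3\<close>.

  A general source \<open>f\<close> is the limit of the sources \<open>\<psi>\<^sub>n f\<close> for cutoffs \<open>\<psi>\<^sub>n\<close> that equal \<open>1\<close> on growing balls.
  Only the tails of the retarded integrals of \<open>f\<close>, \<open>\<partial>\<^sub>tf\<close> and \<open>\<partial>\<^sub>t\<^sup>2f\<close> are controlled; nothing is assumed on the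
  growth of its spatial derivatives.  Near a given event the difference \<open>(\<psi>\<^sub>m - \<psi>\<^sub>n) f\<close>
  vanishes, so both spatial derivatives can be moved onto the kernel, away from its singularity; what
  remains is bounded by these tails (\<open>far_first_derivative_bound\<close>, \<open>far_second_derivative_bound\<close>).  Hence the
  potentials of \<open>\<psi>\<^sub>n f\<close> converge locally uniformly together with their derivatives up to order two, and the limit
  is \<open>C\<^sup>2\<close> and inherits the wave equation (\<open>Ck2_potential\<close>, \<open>potential_wave_equation\<close>).  The Lorenz condition
  holds for the cut off sources up to the potential of \<open>\<nabla>\<psi>\<^sub>n \<bullet> J\<close>, which tends to \<open>0\<close> with the tails of \<open>J\<close>
  (\<open>potential_lorenz_gauge\<close>).  Maxwell's equations then follow by vector calculus from the Lorenz condition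
  and the two wave equations (\<open>potentials_solve_maxwell\<close>).
\<close>



section \<open>Directional derivatives and \<open>C\<^sup>k\<close> maps\<close>

declare Ck.simps(2) [simp del]

text \<open>The recursion that defines \<open>C\<^sup>k\<close> runs through exactly these maps, so that higher derivatives are handled
  one direction at a time, without spaces of multilinear maps.\<close>

definition dir_deriv ::
    "'a::real_normed_vector \<Rightarrow> ('a \<Rightarrow> 'b::real_normed_vector) \<Rightarrow> 'a \<Rightarrow> 'b" where
  "dir_deriv v f x = frechet_derivative f (at x) v"

lemma dir_deriv_eq: "(f has_derivative f') (at x) \<Longrightarrow> dir_deriv v f x = f' v"
  unfolding dir_deriv_def by (metis frechet_derivative_at)

lemma Ck_SucI:
  assumes "\<And>x. (f has_derivative f' x) (at x)" and "\<And>v. Ck k (\<lambda>x. f' x v)"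
  shows "Ck (Suc k) f"
proof -
  have "frechet_derivative f (at x) = f' x" for x
    using assms(1) frechet_derivative_at by metis
  then show ?thesis using assms by (auto simp: Ck.simps(2) differentiable_def)
qed

lemma Ck_has_derivative:
  "Ck (Suc k) f \<Longrightarrow> (f has_derivative (\<lambda>v. dir_deriv v f x)) (at x)"
  unfolding dir_deriv_def by (simp add: Ck.simps(2) frechet_derivative_works[symmetric])

lemma Ck_dir_deriv: "Ck (Suc k) f \<Longrightarrow> Ck k (dir_deriv v f)"
  unfolding dir_deriv_def[abs_def] by (simp add: Ck.simps(2))

lemma Ck_SucD: "Ck (Suc k) f \<Longrightarrow> Ck k f"
proof (induction k arbitrary: f)
  case 0
  then show ?case
    by (auto intro!: differentiable_imp_continuous_on simp: Ck.simps(2) differentiable_on_def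
        intro: differentiable_at_withinI)
next
  case (Suc k)
  from Suc.prems have "Ck (Suc k) (\<lambda>x. frechet_derivative f (at x) v)" for v
    by (simp add: Ck.simps(2))
  then have "Ck k (\<lambda>x. frechet_derivative f (at x) v)" for v by (rule Suc.IH)
  then show ?case using Suc.prems by (simp add: Ck.simps(2))
qed

lemma Ck_mono: "Ck k f \<Longrightarrow> j \<le> k \<Longrightarrow> Ck j f"
proof (induction "k - j" arbitrary: j)
  case (Suc d)
  then have "Ck (Suc j) f" by (metis Suc_diff_Suc Suc_leI diff_Suc_Suc diff_is_0_eq nat.inject
        nat_less_le zero_less_Suc zero_less_diff less_eq_Suc_le)
  then show ?case by (rule Ck_SucD)
qed auto

lemma Ck_continuous: "Ck k f \<Longrightarrow> continuous_on S f"
  using Ck_mono[of k f 0] by (auto intro: continuous_on_subset)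

lemma Ck_const: "Ck k (\<lambda>x. a)"
proof (induction k arbitrary: a)
  case (Suc k)
  then show ?case by (intro Ck_SucI[where f'="\<lambda>x v. 0"]) auto
qed auto

lemma Ck_bounded_linear: "bounded_linear L \<Longrightarrow> Ck k L"
proof (induction k)
  case (Suc k)
  then show ?case
    by (intro Ck_SucI[where f'="\<lambda>x. L"] bounded_linear_imp_has_derivative Ck_const) auto
qed (auto simp: linear_continuous_on)

lemma Ck_bounded_linear_compose:
  assumes L: "bounded_linear L"
  shows "Ck k f \<Longrightarrow> Ck k (\<lambda>x. L (f x))"
proof (induction k arbitrary: f)
  case 0
  then show ?case by (simp add: bounded_linear.continuous_on[OF L])
next
  case (Suc k)
  show ?case
    by (rule Ck_SucI[where f'="\<lambda>x v. L (dir_deriv v f x)"])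
      (use Suc Ck_dir_deriv in \<open>auto intro: bounded_linear.has_derivative[OF L] Ck_has_derivative\<close>)
qed

lemma Ck_add: "Ck k f \<Longrightarrow> Ck k g \<Longrightarrow> Ck k (\<lambda>x. f x + g x)"
proof (induction k arbitrary: f g)
  case 0
  then show ?case by (simp add: continuous_on_add)
next
  case (Suc k)
  show ?case
    by (rule Ck_SucI[where f'="\<lambda>x v. dir_deriv v f x + dir_deriv v g x"])
      (auto intro!: has_derivative_add Ck_has_derivative Suc Ck_dir_deriv)
qed

lemma Ck_diff: "Ck k f \<Longrightarrow> Ck k g \<Longrightarrow> Ck k (\<lambda>x. f x - g x)"
  using Ck_add[of k f "\<lambda>x. - g x"] Ck_bounded_linear_compose[OF bounded_linear_minus[OF bounded_linear_ident], of k g]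
  by simp

lemma (in bounded_bilinear) Ck_bilinear:
  "Ck k f \<Longrightarrow> Ck k g \<Longrightarrow> Ck k (\<lambda>x. prod (f x) (g x))"
proof (induction k arbitrary: f g)
  case 0
  then show ?case by (simp add: continuous_on)
next
  case (Suc k)
  show ?case
  proof (rule Ck_SucI[where f'="\<lambda>x v. prod (f x) (dir_deriv v g x) + prod (dir_deriv v f x) (g x)"])
    show "((\<lambda>x. prod (f x) (g x)) has_derivative
        (\<lambda>v. prod (f x) (dir_deriv v g x) + prod (dir_deriv v f x) (g x))) (at x)" for x
      by (rule FDERIV; rule Ck_has_derivative; rule Suc.prems)
    show "Ck k (\<lambda>x. prod (f x) (dir_deriv v g x) + prod (dir_deriv v f x) (g x))" for v
      by (intro Ck_add Suc.IH Ck_dir_deriv Ck_SucD[OF Suc.prems(1)] Ck_SucD[OF Suc.prems(2)] Suc.prems)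
  qed
qed

lemmas Ck_scaleR = bounded_bilinear.Ck_bilinear[OF bounded_bilinear_scaleR]

lemma Ck_compose_real:
  fixes h :: "real \<Rightarrow> real" and g :: "'a::real_normed_vector \<Rightarrow> real"
  shows "Ck k h \<Longrightarrow> Ck k g \<Longrightarrow> Ck k (\<lambda>x. h (g x))"
proof (induction k arbitrary: h)
  case 0
  then show ?case by (auto intro: continuous_on_compose2)
next
  case (Suc k)
  show ?case
  proof (rule Ck_SucI[where f'="\<lambda>x v. dir_deriv v g x *\<^sub>R dir_deriv 1 h (g x)"])
    fix x
    have lin: "bounded_linear (\<lambda>v. dir_deriv v h (g x))"
      using Ck_has_derivative[OF Suc.prems(1)] has_derivative_bounded_linear by blast
    have *: "dir_deriv s h (g x) = s *\<^sub>R dir_deriv 1 h (g x)" for s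
      using linear_simps(5)[OF lin, of s 1] by simp
    have eq: "(\<lambda>v. dir_deriv (dir_deriv v g x) h (g x)) = (\<lambda>v. dir_deriv v g x *\<^sub>R dir_deriv 1 h (g x))"
      by (rule ext) (rule *)
    have "((\<lambda>x. h (g x)) has_derivative (\<lambda>v. dir_deriv (dir_deriv v g x) h (g x))) (at x)"
      by (rule has_derivative_compose[OF Ck_has_derivative[OF Suc.prems(2)] Ck_has_derivative[OF Suc.prems(1)]])
    then show "((\<lambda>x. h (g x)) has_derivative (\<lambda>v. dir_deriv v g x *\<^sub>R dir_deriv 1 h (g x))) (at x)"
      by (rule has_derivative_eq_rhs[OF _ eq])
  next
    fix v
    show "Ck k (\<lambda>x. dir_deriv v g x *\<^sub>R dir_deriv 1 h (g x))"
      by (rule Ck_scaleR[OF Ck_dir_deriv[OF Suc.prems(2)]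
            Suc.IH[OF Ck_dir_deriv[OF Suc.prems(1)] Ck_SucD[OF Suc.prems(2)]]])
  qed
qed

lemma linear_dir_deriv:
  assumes "Ck (Suc k) f"
  shows "linear (\<lambda>v. dir_deriv v f x)"
  using Ck_has_derivative[OF assms] has_derivative_linear by blast

lemma dir_deriv_bounded_linear:
  assumes "bounded_linear L" "Ck (Suc k) f"
  shows "dir_deriv v (\<lambda>x. L (f x)) x = L (dir_deriv v f x)"
  by (rule dir_deriv_eq) (rule bounded_linear.has_derivative[OF assms(1) Ck_has_derivative[OF assms(2)]])

text \<open>One constant serves all directions, because only the finitely many basis directions have to be
  bounded.\<close>

lemma Ck_derivative_bounded_on_compact:
  fixes f :: "'a::euclidean_space \<Rightarrow> 'b::real_normed_vector"
  assumes "Ck (Suc k) f" "compact S"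
  obtains C where "C > 0" "\<And>x v. x \<in> S \<Longrightarrow> norm (dir_deriv v f x) \<le> C * norm v"
proof -
  have "\<exists>B>0. \<forall>x\<in>S. norm (dir_deriv b f x) \<le> B" for b
  proof -
    have "compact ((\<lambda>x. dir_deriv b f x) ` S)"
      by (rule compact_continuous_image[OF Ck_continuous[OF Ck_dir_deriv[OF assms(1)]] assms(2)])
    then show ?thesis using compact_imp_bounded by (fastforce simp: bounded_pos)
  qed
  then obtain B where B: "\<And>b. B b > 0" "\<And>b x. x \<in> S \<Longrightarrow> norm (dir_deriv b f x) \<le> B b"
    by metis
  show thesis
  proof (rule that[of "1 + (\<Sum>b\<in>Basis. B b)"])
    show "0 < 1 + sum B (Basis::'a set)" using B(1) by (smt (verit) sum_nonneg)
    fix x v assume x: "x \<in> S"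
    have lin: "linear (\<lambda>v. dir_deriv v f x)" by (rule linear_dir_deriv[OF assms(1)])
    have "dir_deriv v f x = dir_deriv (\<Sum>b\<in>Basis. (v \<bullet> b) *\<^sub>R b) f x"
      by (simp add: euclidean_representation)
    also have "\<dots> = (\<Sum>b\<in>Basis. (v \<bullet> b) *\<^sub>R dir_deriv b f x)"
      by (simp add: linear_sum[OF lin] linear_scale[OF lin] del: euclidean_representation)
    finally have "norm (dir_deriv v f x) \<le> (\<Sum>b\<in>Basis. norm ((v \<bullet> b) *\<^sub>R dir_deriv b f x))"
      using norm_sum by metis
    also have "\<dots> \<le> (\<Sum>b\<in>Basis. norm v * B b)"
      by (intro sum_mono) (auto intro!: mult_mono B(2) x simp: Basis_le_norm less_imp_le)
    also have "\<dots> \<le> (1 + sum B (Basis::'a set)) * norm v"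
      by (simp add: sum_distrib_left[symmetric] mult.commute[of _ "norm v"] mult_left_mono)
    finally show "norm (dir_deriv v f x) \<le> (1 + sum B (Basis::'a set)) * norm v" .
  qed
qed

lemma mvt_along_line:
  fixes f :: "'a::real_normed_vector \<Rightarrow> real"
  assumes "\<And>x. (f has_derivative f' x) (at x)" "h > 0"
  obtains s where "0 < s" "s < h" "f (x + h *\<^sub>R v) - f x = h * f' (x + s *\<^sub>R v) v"
proof -
  have der: "((\<lambda>s. f (x + s *\<^sub>R v)) has_real_derivative f' (x + s *\<^sub>R v) v) (at s)" for s
  proof -
    have "((\<lambda>s. f (x + s *\<^sub>R v)) has_derivative (\<lambda>d. f' (x + s *\<^sub>R v) (d *\<^sub>R v))) (at s)"
      by (rule has_derivative_compose[OF _ assms(1)]) (auto intro!: derivative_eq_intros)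
    moreover have "f' (x + s *\<^sub>R v) (d *\<^sub>R v) = d * f' (x + s *\<^sub>R v) v" for d
      using assms(1) has_derivative_linear linear_scale[of "f' (x + s *\<^sub>R v)"] by fastforce
    ultimately show ?thesis by (simp add: has_field_derivative_def mult_commute_abs)
  qed
  then have "\<exists>z. 0 < z \<and> z < h \<and> f (x + h *\<^sub>R v) - f (x + 0 *\<^sub>R v) = (h - 0) * f' (x + z *\<^sub>R v) v"
    using MVT2[OF assms(2), of "\<lambda>s. f (x + s *\<^sub>R v)" "\<lambda>s. f' (x + s *\<^sub>R v) v"] by blast
  then show ?thesis using that by auto
qed

text \<open>Schwarz's theorem.  Both mixed derivatives are limits of the same second difference
  quotient, by two applications of the mean value theorem in either order.\<close>

lemma dir_deriv_commute_real:
  fixes f :: "'a::real_normed_vector \<Rightarrow> real"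
  assumes f: "Ck (Suc (Suc k)) f"
  shows "dir_deriv v (dir_deriv w f) x = dir_deriv w (dir_deriv v f) x"
proof -
  have quotient: "\<exists>s t. 0 < s \<and> s < h \<and> 0 < t \<and> t < h \<and>
      f (x + h *\<^sub>R v + h *\<^sub>R w) - f (x + h *\<^sub>R v) - f (x + h *\<^sub>R w) + f x
        = h * h * dir_deriv w (dir_deriv v f) (x + s *\<^sub>R v + t *\<^sub>R w)"
    if h: "h > 0" for h v w
  proof -
    have "((\<lambda>y. f (y + h *\<^sub>R w) - f y) has_derivative
        (\<lambda>d. dir_deriv d f (y + h *\<^sub>R w) - dir_deriv d f y)) (at y)" for y
      by (intro has_derivative_diff Ck_has_derivative[OF f] has_derivative_compose[OF _ Ck_has_derivative[OF f]])
        (auto intro!: derivative_eq_intros)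
    from mvt_along_line[OF this h] obtain s where s: "0 < s" "s < h"
      "f (x + h *\<^sub>R v + h *\<^sub>R w) - f (x + h *\<^sub>R v) - (f (x + h *\<^sub>R w) - f x)
        = h * (dir_deriv v f (x + s *\<^sub>R v + h *\<^sub>R w) - dir_deriv v f (x + s *\<^sub>R v))" by blast
    from mvt_along_line[OF Ck_has_derivative[OF Ck_dir_deriv[OF f]] h]
    obtain t where "0 < t" "t < h"
      "dir_deriv v f (x + s *\<^sub>R v + h *\<^sub>R w) - dir_deriv v f (x + s *\<^sub>R v)
        = h * dir_deriv w (dir_deriv v f) (x + s *\<^sub>R v + t *\<^sub>R w)" by metis
    with s show ?thesis by (intro exI[of _ s] exI[of _ t]) (simp add: algebra_simps)
  qed
  define Q where "Q v w h = (f (x + h *\<^sub>R v + h *\<^sub>R w) - f (x + h *\<^sub>R v) - f (x + h *\<^sub>R w) + f x) / (h * h)"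
    for v w h
  have Q_commute: "Q v w h = Q w v h" for v w h
    unfolding Q_def by (simp add: add_ac)
  have lim: "(\<lambda>n. Q v w (inverse (real (Suc n)))) \<longlonglongrightarrow> dir_deriv w (dir_deriv v f) x" for v w
  proof -
    define h where "h n = inverse (real (Suc n))" for n
    have hpos: "h n > 0" for n by (simp add: h_def)
    have h0: "h \<longlonglongrightarrow> 0" unfolding h_def by (rule LIMSEQ_inverse_real_of_nat)
    obtain s t where st: "\<And>n. 0 < s n \<and> s n < h n \<and> 0 < t n \<and> t n < h n \<and>
      f (x + h n *\<^sub>R v + h n *\<^sub>R w) - f (x + h n *\<^sub>R v) - f (x + h n *\<^sub>R w) + f x
        = h n * h n * dir_deriv w (dir_deriv v f) (x + s n *\<^sub>R v + t n *\<^sub>R w)"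
    proof -
      have "\<forall>n. \<exists>s t. 0 < s \<and> s < h n \<and> 0 < t \<and> t < h n \<and>
        f (x + h n *\<^sub>R v + h n *\<^sub>R w) - f (x + h n *\<^sub>R v) - f (x + h n *\<^sub>R w) + f x
          = h n * h n * dir_deriv w (dir_deriv v f) (x + s *\<^sub>R v + t *\<^sub>R w)"
        using quotient[OF hpos, of _ v w] by simp
      then show ?thesis unfolding choice_iff using that by blast
    qed
    have "s \<longlonglongrightarrow> 0" "t \<longlonglongrightarrow> 0"
      using st by (auto intro!: tendsto_sandwich[OF _ _ tendsto_const h0] always_eventually less_imp_le)
    then have "(\<lambda>n. x + s n *\<^sub>R v + t n *\<^sub>R w) \<longlonglongrightarrow> x + 0 *\<^sub>R v + 0 *\<^sub>R w"
      by (intro tendsto_intros)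
    moreover have "isCont (dir_deriv w (dir_deriv v f)) x"
      using Ck_continuous[OF Ck_dir_deriv[OF Ck_dir_deriv[OF f]], of UNIV]
      by (simp add: continuous_on_eq_continuous_at)
    ultimately have "(\<lambda>n. dir_deriv w (dir_deriv v f) (x + s n *\<^sub>R v + t n *\<^sub>R w))
        \<longlonglongrightarrow> dir_deriv w (dir_deriv v f) x"
      by (auto intro: isCont_tendsto_compose)
    moreover have "h n \<noteq> 0" for n using hpos[of n] by simp
    ultimately show ?thesis using st unfolding h_def[symmetric] Q_def by simp
  qed
  show ?thesis
    using LIMSEQ_unique[OF lim[of w v] lim[of v w, unfolded Q_commute[of v w]]] .
qed

text \<open>The vector-valued case follows coordinate by coordinate; the mean value theorem holds only
  for real values.\<close>

lemma dir_deriv_commute: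
  fixes f :: "'a::real_normed_vector \<Rightarrow> 'b::euclidean_space"
  assumes f: "Ck (Suc (Suc k)) f"
  shows "dir_deriv v (dir_deriv w f) x = dir_deriv w (dir_deriv v f) x"
proof (rule euclidean_eqI)
  fix b :: 'b assume "b \<in> Basis"
  have c: "dir_deriv v (dir_deriv w (\<lambda>x. f x \<bullet> b)) x = dir_deriv v (dir_deriv w f) x \<bullet> b" for v w
  proof -
    have "dir_deriv w (\<lambda>x. f x \<bullet> b) = (\<lambda>x. dir_deriv w f x \<bullet> b)"
      by (rule ext) (rule dir_deriv_bounded_linear[OF bounded_linear_inner_left f])
    then show ?thesis
      using dir_deriv_bounded_linear[OF bounded_linear_inner_left Ck_dir_deriv[OF f]] by simp
  qed
  show "dir_deriv v (dir_deriv w f) x \<bullet> b = dir_deriv w (dir_deriv v f) x \<bullet> b"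
    unfolding c[symmetric]
    by (rule dir_deriv_commute_real[OF Ck_bounded_linear_compose[OF bounded_linear_inner_left f]])
qed


section \<open>Integrals over the past light cone\<close>

lemma cball_borel [measurable]: "cball (a::'a::euclidean_space) r \<in> sets borel"
  by simp

definition locally_integrable :: "('a::euclidean_space \<Rightarrow> real) \<Rightarrow> bool" where
  "locally_integrable k \<longleftrightarrow> k \<in> borel_measurable borel \<and>
     (\<forall>R. integrable lborel (\<lambda>u. indicator (cball 0 R) u * k u))"

lemma locally_integrable_measurable: "locally_integrable k \<Longrightarrow> k \<in> borel_measurable borel"
  by (simp add: locally_integrable_def)

lemma term_le_suminf_ennreal: "f n \<le> (\<Sum>n. f n)" for f :: "nat \<Rightarrow> ennreal"
  using sum_le_suminf[of f "{n}"] by simp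

text \<open>Dyadic shells: on \<open>R / 2^(n+1) < \<bar>u\<bar> \<le> R / 2^n\<close> the integrand is at most \<open>4^(n+1) / R\<^sup>2\<close>,
  while the volume is of order \<open>8^(-n)\<close>.\<close>

lemma inverse_square_integrable_on_ball:
  "integrable lborel (\<lambda>u::real^3. indicator (cball 0 R) u * (1 / (norm u)\<^sup>2))"
proof (cases "R > 0")
  case False
  then have "(\<lambda>u::real^3. indicator (cball 0 R) u * (1 / (norm u)\<^sup>2)) = (\<lambda>u. 0)"
    by (auto simp: indicator_def fun_eq_iff)
      (smt (verit) norm_ge_zero norm_eq_zero)
  then show ?thesis by simp
next
  case R: True
  define V where "V = unit_ball_vol (real DIM(real^3))"
  have V: "V \<ge> 0" unfolding V_def by simp
  let ?t = "\<lambda>(n::nat) (u::real^3). ennreal (4 ^ Suc n / R\<^sup>2) * indicator (cball 0 (R / 2 ^ n)) u"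
  have bound: "ennreal (norm (indicator (cball 0 R) u * (1 / (norm u)\<^sup>2))) \<le> (\<Sum>n. ?t n u)"
    for u :: "real^3"
  proof (cases "u \<noteq> 0 \<and> norm u \<le> R")
    case True
    then have u: "norm u > 0" "norm u \<le> R" by auto
    obtain m where "(1/2) ^ m < norm u / R"
      using real_arch_pow_inv[of "norm u / R" "1/2"] u R by auto
    then have ex: "\<exists>m. R / 2 ^ m < norm u"
      using R by (intro exI[of _ m]) (simp add: field_simps power_divide)
    (* The least such m identifies the dyadic shell of u: it is m - 1. *)
    define m where "m = (LEAST m. R / 2 ^ m < norm u)"
    have m: "R / 2 ^ m < norm u" unfolding m_def by (rule LeastI_ex[OF ex])
    have "m \<noteq> 0" using m u by (intro notI) simp
    then obtain n where n: "m = Suc n" by (cases m) auto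
    have "\<not> R / 2 ^ n < norm u"
      using not_less_Least[of n "\<lambda>m. R / 2 ^ m < norm u"] n unfolding m_def by simp
    then have in_ball: "u \<in> cball 0 (R / 2 ^ n)" by simp
    have "R\<^sup>2 / 4 ^ Suc n = (R / 2 ^ m)\<^sup>2"
      by (simp add: n power_divide power_mult_distrib power_mult[symmetric] mult.commute[of _ 2])
        (simp add: power_mult)
    also have "\<dots> \<le> (norm u)\<^sup>2" using m R by (intro power_mono) auto
    finally have "1 / (norm u)\<^sup>2 \<le> 1 / (R\<^sup>2 / 4 ^ Suc n)"
      using R u(1) by (intro divide_left_mono) (auto intro!: mult_pos_pos divide_pos_pos zero_less_power simp del: power_Suc)
    then have "1 / (norm u)\<^sup>2 \<le> 4 ^ Suc n / R\<^sup>2" by simp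
    then have "ennreal (norm (indicator (cball 0 R) u * (1 / (norm u)\<^sup>2))) \<le> ?t n u"
      using in_ball u by (simp add: indicator_def)
    also have "\<dots> \<le> (\<Sum>n. ?t n u)"
      by (rule term_le_suminf_ennreal)
    finally show ?thesis .
  qed (auto simp: indicator_def)
  have vol: "(\<integral>\<^sup>+u. ?t n u \<partial>lborel) = ennreal (4 * V * R * (1/2) ^ n)" for n
  proof -
    have "(\<integral>\<^sup>+u. ?t n u \<partial>lborel) = ennreal (4 ^ Suc n / R\<^sup>2) * ennreal (V * (R / 2 ^ n) ^ 3)"
      using R by (subst nn_integral_cmult_indicator) (simp_all add: emeasure_cball V_def)
    also have "\<dots> = ennreal (4 ^ Suc n / R\<^sup>2 * (V * (R / 2 ^ n) ^ 3))"
      using R V by (intro ennreal_mult[symmetric]) auto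
    also have "4 ^ Suc n / R\<^sup>2 * (V * (R / 2 ^ n) ^ 3) = 4 * V * R * (1/2) ^ n"
    proof -
      have "(2::real) ^ n * 2 ^ n = 4 ^ n" by (simp add: power_mult_distrib[symmetric])
      then show ?thesis
        using R by (simp add: field_simps power2_eq_square power3_eq_cube)
    qed
    finally show ?thesis .
  qed
  have "(\<integral>\<^sup>+u. ennreal (norm (indicator (cball 0 R) u * (1 / (norm (u::real^3))\<^sup>2))) \<partial>lborel)
      \<le> (\<integral>\<^sup>+u. (\<Sum>n. ?t n u) \<partial>lborel)"
    by (intro nn_integral_mono bound)
  also have "\<dots> = (\<Sum>n. \<integral>\<^sup>+u. ?t n u \<partial>lborel)"
    by (rule nn_integral_suminf) (intro borel_measurable_times_ennreal borel_measurable_const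
        borel_measurable_indicator, simp)
  also have "\<dots> = (\<Sum>n. ennreal (4 * V * R * (1/2) ^ n))"
    by (simp only: vol)
  also have "\<dots> < \<infinity>"
    using R V by (subst suminf_ennreal2) (auto intro!: summable_mult)
  finally show ?thesis by (intro integrableI_bounded) auto
qed

lemma integrable_indicator_cball:
  "integrable lborel (\<lambda>u::'a::euclidean_space. indicator (cball 0 R) u * (a::real))"
  using emeasure_bounded_finite[of "cball (0::'a) R"] by (intro integrable_mult_left) simp

lemma locally_integrableI_inverse_square:
  fixes k :: "real^3 \<Rightarrow> real"
  assumes "k \<in> borel_measurable borel" and bound: "\<And>u. \<bar>k u\<bar> \<le> a + b / (norm u)\<^sup>2"
  shows "locally_integrable k"
  unfolding locally_integrable_def
proof (intro conjI allI assms(1))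
  fix R
  note [measurable] = assms(1)
  have "integrable lborel (\<lambda>u::real^3. indicator (cball 0 R) u * a
      + b * (indicator (cball 0 R) u * (1 / (norm u)\<^sup>2)))"
    by (intro Bochner_Integration.integrable_add integrable_mult_right integrable_indicator_cball
        inverse_square_integrable_on_ball)
  then show "integrable lborel (\<lambda>u. indicator (cball 0 R) u * k u)"
  proof (rule Bochner_Integration.integrable_bound)
    show "AE u in lborel. norm (indicator (cball 0 R) u * k u)
        \<le> norm (indicator (cball 0 R) u * a + b * (indicator (cball 0 R) u * (1 / (norm u)\<^sup>2)))"
      using bound by (intro AE_I2) (auto simp: indicator_def abs_mult intro: order_trans[OF _ abs_ge_self])
  qed measurable
qed

type_synonym spacetime = "(real^3) \<times> real"

text \<open>Seen from the event \<open>z = (r, t)\<close>, the point \<open>r + u\<close> at the retarded time \<open>t - \<bar>u\<bar>/c\<close> is \<open>z + past_cone c u\<close>.\<close>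

definition past_cone :: "real \<Rightarrow> real^3 \<Rightarrow> spacetime" where
  "past_cone c u = (u, - norm u / c)"

text \<open>The retarded integral of \<open>F\<close> against \<open>k(r' - r)\<close>, after the substitution \<open>u = r' - r\<close>.\<close>

definition cone_integral ::
    "real \<Rightarrow> (real^3 \<Rightarrow> real) \<Rightarrow> (spacetime \<Rightarrow> 'b::euclidean_space) \<Rightarrow> spacetime \<Rightarrow> 'b" where
  "cone_integral c k F z = (LINT u|lborel. k u *\<^sub>R F (z + past_cone c u))"

definition spatially_bounded :: "(spacetime \<Rightarrow> 'b::real_normed_vector) \<Rightarrow> bool" where
  "spatially_bounded F \<longleftrightarrow> (\<exists>R. \<forall>z. norm (fst z) > R \<longrightarrow> F z = 0)"

lemma continuous_on_past_cone [continuous_intros]: "continuous_on S (past_cone c)"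
  unfolding past_cone_def divide_inverse by (intro continuous_intros)

lemma borel_measurable_on_cone:
  fixes F :: "spacetime \<Rightarrow> 'b::real_normed_vector"
  assumes "continuous_on UNIV F"
  shows "(\<lambda>u. F (z + past_cone c u)) \<in> borel_measurable borel"
  by (intro borel_measurable_continuous_onI continuous_on_compose2[OF assms] continuous_intros) auto

lemma borel_measurable_cone_integrand:
  fixes F :: "spacetime \<Rightarrow> 'b::euclidean_space"
  assumes "continuous_on UNIV F" "k \<in> borel_measurable borel"
  shows "(\<lambda>u. k u *\<^sub>R F (z + past_cone c u)) \<in> borel_measurable lborel"
  using borel_measurable_scaleR[OF assms(2) borel_measurable_on_cone[OF assms(1)]] by simp

lemma dir_deriv_zero_on_open:
  assumes "open S" "x \<in> S" "\<And>y. y \<in> S \<Longrightarrow> f y = a"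
  shows "dir_deriv v f x = 0"
proof (rule dir_deriv_eq[where f'="\<lambda>_. 0"])
  show "(f has_derivative (\<lambda>_. 0)) (at x)"
    by (rule has_derivative_transform_within_open[OF has_derivative_const assms(1,2)])
      (simp add: assms(3))
qed

lemma open_norm_fst_greater: "open {z::spacetime. norm (fst z) > R}"
  by (intro open_Collect_less continuous_intros)

lemma open_norm_fst_less: "open {z::spacetime. norm (fst z) < R}"
  by (intro open_Collect_less continuous_intros)

lemma spatially_bounded_dir_deriv:
  assumes "spatially_bounded F" shows "spatially_bounded (dir_deriv v F)"
proof -
  obtain R where R: "\<And>z. norm (fst z) > R \<Longrightarrow> F z = 0"
    using assms unfolding spatially_bounded_def by blast
  have "dir_deriv v F z = 0" if "norm (fst z) > R" for z
    by (rule dir_deriv_zero_on_open[OF open_norm_fst_greater[of R]]) (use that R in auto)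
  then show ?thesis unfolding spatially_bounded_def by blast
qed

lemma norm_fst_cone_shift:
  assumes "y \<in> cball z 1" "norm u > R + norm z + 1"
  shows "norm (fst (y + past_cone c u)) > R"
proof -
  have "norm u \<le> norm (fst y + u) + norm (fst y)"
    using norm_triangle_ineq4[of "fst y + u" "fst y"] by simp
  moreover have "norm (fst y) \<le> norm y" using norm_fst_le[of "fst y" "snd y"] by simp
  moreover have "norm y \<le> norm z + 1"
    using assms(1) norm_triangle_sub[of y z] by (simp add: dist_norm norm_minus_commute)
  ultimately show ?thesis using assms(2) by (simp add: past_cone_def)
qed

lemma compact_cone_neighbourhood:
  "compact ((\<lambda>(y, u). y + past_cone c u) ` (cball z 1 \<times> cball 0 R))"
  by (intro compact_continuous_image compact_Times compact_cball)
    (auto simp: case_prod_beta intro!: continuous_intros continuous_on_compose2[OF continuous_on_past_cone])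

text \<open>For all events near \<open>z\<close> at once, the source on the past cone is dominated by a multiple of one
  indicator; this is the bound for dominated convergence when \<open>z\<close> varies.\<close>

lemma bounded_on_cones:
  fixes F :: "spacetime \<Rightarrow> 'b::real_normed_vector"
  assumes "continuous_on UNIV F" "spatially_bounded F"
  obtains R M where "M > 0"
    "\<And>y u. y \<in> cball z 1 \<Longrightarrow> norm (F (y + past_cone c u)) \<le> M * indicator (cball 0 R) u"
proof -
  obtain R where R: "\<And>z. norm (fst z) > R \<Longrightarrow> F z = 0"
    using assms(2) unfolding spatially_bounded_def by blast
  let ?R = "R + norm z + 1"
  have "compact (F ` (\<lambda>(y, u). y + past_cone c u) ` (cball z 1 \<times> cball 0 ?R))"
    by (rule compact_continuous_image[OF continuous_on_subset[OF assms(1)] compact_cone_neighbourhood]) simp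
  then have "bounded (F ` (\<lambda>(y, u). y + past_cone c u) ` (cball z 1 \<times> cball 0 ?R))"
    by (rule compact_imp_bounded)
  then obtain M where "M > 0"
    "\<forall>x\<in>F ` (\<lambda>(y, u). y + past_cone c u) ` (cball z 1 \<times> cball 0 ?R). norm x \<le> M"
    unfolding bounded_pos by (elim exE conjE)
  then have M: "M > 0"
    "\<And>y u. y \<in> cball z 1 \<Longrightarrow> u \<in> cball 0 ?R \<Longrightarrow> norm (F (y + past_cone c u)) \<le> M"
    by auto
  show thesis
  proof (rule that[OF M(1)])
    fix y u assume y: "y \<in> cball z 1"
    show "norm (F (y + past_cone c u)) \<le> M * indicator (cball 0 ?R) u"
    proof (cases "norm u \<le> ?R")
      case False
      then have "F (y + past_cone c u) = 0" by (intro R norm_fst_cone_shift[OF y]) simp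
      then show ?thesis using M(1) by simp
    qed (use M(2)[OF y, of u] in simp)
  qed
qed

lemma integrable_cone:
  fixes F :: "spacetime \<Rightarrow> 'b::euclidean_space"
  assumes "continuous_on UNIV F" "spatially_bounded F" "locally_integrable k"
  shows "integrable lborel (\<lambda>u. k u *\<^sub>R F (z + past_cone c u))"
proof -
  obtain M R where M: "M > 0"
    "\<And>y u. y \<in> cball z 1 \<Longrightarrow> norm (F (y + past_cone c u)) \<le> M * indicator (cball 0 R) u"
    using bounded_on_cones[OF assms(1,2)] by metis
  have "integrable lborel (\<lambda>u. M * (indicator (cball 0 R) u * k u))"
    using assms(3) by (auto simp: locally_integrable_def)
  then show ?thesis
  proof (rule Bochner_Integration.integrable_bound)
    show "AE u in lborel. norm (k u *\<^sub>R F (z + past_cone c u)) \<le> norm (M * (indicator (cball 0 R) u * k u))"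
    proof (rule AE_I2)
      fix u
      have "\<bar>k u\<bar> * norm (F (z + past_cone c u)) \<le> \<bar>k u\<bar> * (M * indicator (cball 0 R) u)"
        by (rule mult_left_mono[OF M(2)]) auto
      then show "norm (k u *\<^sub>R F (z + past_cone c u)) \<le> norm (M * (indicator (cball 0 R) u * k u))"
        using M(1) by (simp add: abs_mult mult_ac)
    qed
  qed (rule borel_measurable_cone_integrand[OF assms(1) locally_integrable_measurable[OF assms(3)]])
qed

lemma continuous_cone_integral:
  fixes F :: "spacetime \<Rightarrow> 'b::euclidean_space"
  assumes F: "continuous_on UNIV F" "spatially_bounded F" and k: "locally_integrable k"
  shows "continuous_on UNIV (cone_integral c k F)"
proof -
  have "cone_integral c k F \<midarrow>z\<rightarrow> cone_integral c k F z" for z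
  proof -
    obtain M R where M: "M > 0"
      "\<And>y u. y \<in> cball z 1 \<Longrightarrow> norm (F (y + past_cone c u)) \<le> M * indicator (cball 0 R) u"
      using bounded_on_cones[OF F] by metis
    have "(cone_integral c k F \<longlongrightarrow> cone_integral c k F z) (at z within cball z 1)"
      unfolding tendsto_at_iff_sequentially comp_def
    proof (intro allI impI)
      fix X :: "nat \<Rightarrow> spacetime"
      assume X: "\<forall>i. X i \<in> cball z 1 - {z}" "X \<longlonglongrightarrow> z"
      show "(\<lambda>n. cone_integral c k F (X n)) \<longlonglongrightarrow> cone_integral c k F z"
        unfolding cone_integral_def
      proof (rule integral_dominated_convergence)
        show "integrable lborel (\<lambda>u. M * \<bar>indicator (cball 0 R) u * k u\<bar>)"
          using k by (auto simp: locally_integrable_def)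
        show "AE u in lborel. norm (k u *\<^sub>R F (X n + past_cone c u)) \<le> M * \<bar>indicator (cball 0 R) u * k u\<bar>" for n
        proof (rule AE_I2)
          fix u
          have "\<bar>k u\<bar> * norm (F (X n + past_cone c u)) \<le> \<bar>k u\<bar> * (M * indicator (cball 0 R) u)"
            by (rule mult_left_mono[OF M(2)]) (use X(1) in auto)
          then show "norm (k u *\<^sub>R F (X n + past_cone c u)) \<le> M * \<bar>indicator (cball 0 R) u * k u\<bar>"
            by (simp add: abs_mult mult_ac)
        qed
        show "AE u in lborel. (\<lambda>n. k u *\<^sub>R F (X n + past_cone c u)) \<longlonglongrightarrow> k u *\<^sub>R F (z + past_cone c u)"
        proof (intro AE_I2 tendsto_intros)
          fix u
          have "isCont F (z + past_cone c u)"
            using F(1) unfolding continuous_on_eq_continuous_at[OF open_UNIV] by blast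
          then show "(\<lambda>n. F (X n + past_cone c u)) \<longlonglongrightarrow> F (z + past_cone c u)"
            by (rule isCont_tendsto_compose) (intro tendsto_intros X(2))
        qed
      qed (rule borel_measurable_cone_integrand[OF F(1) locally_integrable_measurable[OF k]])+
    qed
    then show ?thesis using at_within_interior[of z "cball z 1"] by simp
  qed
  then show ?thesis by (simp add: continuous_on_def)
qed

text \<open>Differentiation under the integral sign is possible because the cone is moved
  rigidly: \<open>z\<close> enters the argument of \<open>F\<close> but not the singular kernel.\<close>

lemma cone_integral_has_derivative:
  fixes F :: "spacetime \<Rightarrow> 'b::euclidean_space"
  assumes F: "Ck (Suc m) F" "spatially_bounded F" and k: "locally_integrable k"
  shows "(cone_integral c k F has_derivative (\<lambda>v. cone_integral c k (dir_deriv v F) z)) (at z)"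
proof -
  obtain R where R: "\<And>z. norm (fst z) > R \<Longrightarrow> F z = 0"
    using F(2) unfolding spatially_bounded_def by blast
  define R' where "R' = R + norm z + 1"
  obtain C where C: "C > 0"
    "\<And>x v. x \<in> (\<lambda>(y, u). y + past_cone c u) ` (cball z 1 \<times> cball 0 R') \<Longrightarrow> norm (dir_deriv v F x) \<le> C * norm v"
    using Ck_derivative_bounded_on_compact[OF F(1) compact_cone_neighbourhood] by metis
  have far: "F (y + past_cone c u) = 0" if "y \<in> cball z 1" "norm u > R'" for y u
    by (rule R[OF norm_fst_cone_shift[OF that[unfolded R'_def]]])
  have far': "dir_deriv v F (y + past_cone c u) = 0" if "y \<in> cball z 1" "norm u > R'" for y u v
    by (rule dir_deriv_zero_on_open[OF open_norm_fst_greater[of R]])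
      (use norm_fst_cone_shift[OF that[unfolded R'_def]] R in auto)
  have deriv_bound: "norm (dir_deriv v F (y + past_cone c u)) \<le> C * norm v * indicator (cball 0 R') u"
    if "y \<in> cball z 1" for y u v
    using C(2)[of "y + past_cone c u" v] far'[OF that, of u v] that
    by (cases "norm u \<le> R'") (force simp: image_iff)+
  have diff_bound: "norm (F (y + past_cone c u) - F (z + past_cone c u))
      \<le> C * norm (y - z) * indicator (cball 0 R') u" if y: "y \<in> cball z 1" for y u
  proof (cases "norm u \<le> R'")
    case True
    have "norm (F (y + past_cone c u) - F (z + past_cone c u)) \<le> C * norm (y - z)"
    proof (rule differentiable_bound[where S="cball z 1" and f="\<lambda>y. F (y + past_cone c u)"])
      fix x assume x: "x \<in> cball z 1"
      have "((\<lambda>y. F (y + past_cone c u)) has_derivative (\<lambda>v. dir_deriv v F (x + past_cone c u))) (at x)"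
        by (rule has_derivative_compose[OF _ Ck_has_derivative[OF F(1)]]) (auto intro!: derivative_eq_intros)
      then show "((\<lambda>y. F (y + past_cone c u)) has_derivative (\<lambda>v. dir_deriv v F (x + past_cone c u)))
          (at x within cball z 1)" by (rule has_derivative_at_withinI)
      show "onorm (\<lambda>v. dir_deriv v F (x + past_cone c u)) \<le> C"
        using deriv_bound[OF x, of _ u] True by (intro onorm_le) (simp add: indicator_def)
    qed (use y in auto)
    then show ?thesis using True by simp
  qed (use far[OF y, of u] far[of z u] C(1) in simp)
  note meas = locally_integrable_measurable[OF k]
  note cont = Ck_continuous[OF F(1)] and cont' = Ck_continuous[OF Ck_dir_deriv[OF F(1)]]
  note int = integrable_cone[OF cont F(2) k] and
    int' = integrable_cone[OF cont' spatially_bounded_dir_deriv[OF F(2)] k]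
  have lin: "linear (\<lambda>v. dir_deriv v F x)" for x by (rule linear_dir_deriv[OF F(1)])
  have bl: "bounded_linear (\<lambda>v. cone_integral c k (dir_deriv v F) z)"
    unfolding linear_conv_bounded_linear[symmetric]
    by (rule linearI)
      (simp_all add: cone_integral_def linear_add[OF lin] linear_scale[OF lin] scaleR_add_right int'
        integral_scaleR_right[symmetric] mult.commute del: integral_scaleR_right)
  have "(cone_integral c k F has_derivative (\<lambda>v. cone_integral c k (dir_deriv v F) z)) (at z within ball z 1)"
    unfolding has_derivative_within tendsto_at_iff_sequentially comp_def
  proof (intro conjI allI impI bl)
    fix X :: "nat \<Rightarrow> spacetime"
    assume X: "\<forall>i. X i \<in> ball z 1 - {z}" "X \<longlonglongrightarrow> z"
    define q where "q n u = (1 / norm (X n - z)) *\<^sub>R (k u *\<^sub>R (F (X n + past_cone c u)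
        - (F (z + past_cone c u) + dir_deriv (X n - z) F (z + past_cone c u))))" for n u
    have eq: "(1 / norm (X n - z)) *\<^sub>R (cone_integral c k F (X n) - (cone_integral c k F z
        + cone_integral c k (dir_deriv (X n - z) F) z)) = (LINT u|lborel. q n u)" for n
    proof -
      have "(LINT u|lborel. k u *\<^sub>R (F (X n + past_cone c u)
          - (F (z + past_cone c u) + dir_deriv (X n - z) F (z + past_cone c u))))
        = cone_integral c k F (X n) - (cone_integral c k F z + cone_integral c k (dir_deriv (X n - z) F) z)"
        unfolding cone_integral_def by (simp add: scaleR_diff_right scaleR_add_right int int')
      then show ?thesis unfolding q_def integral_scaleR_right by simp
    qed
    have "(\<lambda>n. LINT u|lborel. q n u) \<longlonglongrightarrow> (LINT (u::real^3)|lborel. (0::'b))"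
    proof (rule integral_dominated_convergence)
      show "integrable lborel (\<lambda>u. 2 * C * \<bar>indicator (cball 0 R') u * k u\<bar>)"
        using k by (auto simp: locally_integrable_def)
      show "q n \<in> borel_measurable lborel" for n
      proof -
        have "(\<lambda>u. (1 / norm (X n - z)) *\<^sub>R (k u *\<^sub>R F (X n + past_cone c u) - (k u *\<^sub>R F (z + past_cone c u)
            + k u *\<^sub>R dir_deriv (X n - z) F (z + past_cone c u)))) \<in> borel_measurable lborel"
          by (intro borel_measurable_scaleR[OF borel_measurable_const] borel_measurable_diff borel_measurable_add
              borel_measurable_cone_integrand cont cont' meas)
        then show ?thesis unfolding q_def by (simp only: scaleR_diff_right scaleR_add_right)
      qed
      show "AE u in lborel. norm (q n u) \<le> 2 * C * \<bar>indicator (cball 0 R') u * k u\<bar>" for n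
      proof (rule AE_I2)
        fix u
        have Xn: "X n \<in> cball z 1" "norm (X n - z) > 0"
          using X(1)[rule_format, of n] by (auto simp: less_imp_le)
        have "norm (F (X n + past_cone c u) - (F (z + past_cone c u) + dir_deriv (X n - z) F (z + past_cone c u)))
          \<le> norm (F (X n + past_cone c u) - F (z + past_cone c u)) + norm (dir_deriv (X n - z) F (z + past_cone c u))"
          using norm_triangle_ineq4 by (metis diff_diff_eq)
        also have "\<dots> \<le> 2 * C * norm (X n - z) * indicator (cball 0 R') u"
          using diff_bound[OF Xn(1), of u] deriv_bound[of z "X n - z" u] by simp
        finally have le: "norm (F (X n + past_cone c u) - (F (z + past_cone c u) + dir_deriv (X n - z) F (z + past_cone c u)))
          \<le> 2 * C * norm (X n - z) * indicator (cball 0 R') u" .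
        have "norm (q n u) = (1 / norm (X n - z)) * (\<bar>k u\<bar> * norm (F (X n + past_cone c u)
            - (F (z + past_cone c u) + dir_deriv (X n - z) F (z + past_cone c u))))"
          unfolding q_def by simp
        also have "\<dots> \<le> (1 / norm (X n - z)) * (\<bar>k u\<bar> * (2 * C * norm (X n - z) * indicator (cball 0 R') u))"
          by (intro mult_left_mono le) auto
        also have "\<dots> = 2 * C * \<bar>indicator (cball 0 R') u * k u\<bar>"
          using Xn(2) by (simp add: abs_mult)
        finally show "norm (q n u) \<le> 2 * C * \<bar>indicator (cball 0 R') u * k u\<bar>" .
      qed
      show "AE u in lborel. (\<lambda>n. q n u) \<longlonglongrightarrow> 0"
      proof (rule AE_I2)
        fix u
        have "((\<lambda>y. F (y + past_cone c u)) has_derivative (\<lambda>v. dir_deriv v F (z + past_cone c u))) (at z)"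
          by (rule has_derivative_compose[OF _ Ck_has_derivative[OF F(1)]]) (auto intro!: derivative_eq_intros)
        then have "((\<lambda>y. F (y + past_cone c u)) has_derivative (\<lambda>v. dir_deriv v F (z + past_cone c u))) (at z within ball z 1)"
          by (rule has_derivative_at_withinI)
        then have "(\<lambda>n. (1 / norm (X n - z)) *\<^sub>R (F (X n + past_cone c u)
          - (F (z + past_cone c u) + dir_deriv (X n - z) F (z + past_cone c u)))) \<longlonglongrightarrow> 0"
          unfolding has_derivative_within tendsto_at_iff_sequentially comp_def using X by blast
        from tendsto_scaleR[OF tendsto_const[of "k u"] this]
        show "(\<lambda>n. q n u) \<longlonglongrightarrow> 0"
          unfolding q_def by (simp add: scaleR_left_commute[of "k u"])
      qed
    qed simp
    then show "(\<lambda>n. (1 / norm (X n - z)) *\<^sub>R (cone_integral c k F (X n) - (cone_integral c k F z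
        + cone_integral c k (dir_deriv (X n - z) F) z))) \<longlonglongrightarrow> 0"
      unfolding eq by simp
  qed
  then show ?thesis by (simp add: at_within_open[of z "ball z 1"])
qed

lemma Ck_cone_integral:
  assumes "locally_integrable k"
  shows "Ck m F \<Longrightarrow> spatially_bounded F \<Longrightarrow> Ck m (cone_integral c k F)"
proof (induction m arbitrary: F)
  case 0
  then show ?case using continuous_cone_integral assms by simp
next
  case (Suc m)
  show ?case
    by (rule Ck_SucI[OF cone_integral_has_derivative[OF Suc.prems assms]])
      (rule Suc.IH[OF Ck_dir_deriv[OF Suc.prems(1)] spatially_bounded_dir_deriv[OF Suc.prems(2)]])
qed

lemma dir_deriv_cone_integral:
  assumes "Ck (Suc m) F" "spatially_bounded F" "locally_integrable k"
  shows "dir_deriv v (cone_integral c k F) = cone_integral c k (dir_deriv v F)"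
  using dir_deriv_eq[OF cone_integral_has_derivative[OF assms]] by blast


section \<open>Integration by parts on the past light cone\<close>

text \<open>The right regularity for integration by parts here: it is closed under products, it tolerates the
  kink of a truncated kernel on a sphere, and it holds for a smooth source on the past cone, which is not
  differentiable at \<open>u = 0\<close>.\<close>

definition ball_lipschitz :: "('a::real_normed_vector \<Rightarrow> 'b::real_normed_vector) \<Rightarrow> bool" where
  "ball_lipschitz g \<longleftrightarrow> (\<forall>R. \<exists>L. L-lipschitz_on (cball 0 R) g)"

lemma ball_lipschitzE:
  assumes "ball_lipschitz g"
  obtains L where "L \<ge> 0" "\<And>x y. norm x \<le> R \<Longrightarrow> norm y \<le> R \<Longrightarrow> norm (g x - g y) \<le> L * norm (x - y)"
proof -
  obtain L where "L-lipschitz_on (cball 0 R) g" using assms unfolding ball_lipschitz_def by blast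
  then show thesis
    by (intro that[of L]) (auto simp: lipschitz_on_def dist_norm)
qed

lemma ball_lipschitzI:
  assumes "\<And>R. \<exists>L\<ge>0. \<forall>x y. norm x \<le> R \<longrightarrow> norm y \<le> R \<longrightarrow> norm (g x - g y) \<le> L * norm (x - y)"
  shows "ball_lipschitz g"
  unfolding ball_lipschitz_def
proof
  fix R
  obtain L where "L \<ge> 0" "\<forall>x y. norm x \<le> R \<longrightarrow> norm y \<le> R \<longrightarrow> norm (g x - g y) \<le> L * norm (x - y)"
    using assms by blast
  then show "\<exists>L. L-lipschitz_on (cball 0 R) g"
    by (intro exI[of _ L]) (auto simp: lipschitz_on_def dist_norm)
qed

lemma ball_lipschitz_continuous:
  assumes "ball_lipschitz g" shows "continuous_on S g"
proof -
  have "isCont g x" for x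
  proof -
    obtain L where "L-lipschitz_on (cball 0 (norm x + 1)) g"
      using assms unfolding ball_lipschitz_def by blast
    then have "continuous_on (ball 0 (norm x + 1)) g"
      by (rule continuous_on_subset[OF lipschitz_on_continuous_on]) auto
    then show ?thesis by (simp add: continuous_on_eq_continuous_at)
  qed
  then show ?thesis by (simp add: continuous_at_imp_continuous_on)
qed

lemma ball_lipschitz_bounded:
  assumes "ball_lipschitz g"
  obtains M where "M \<ge> 0" "\<And>x. norm x \<le> R \<Longrightarrow> norm (g x) \<le> M"
proof -
  obtain L where L: "L \<ge> 0" "\<And>x y. norm x \<le> \<bar>R\<bar> \<Longrightarrow> norm y \<le> \<bar>R\<bar> \<Longrightarrow> norm (g x - g y) \<le> L * norm (x - y)"
    using ball_lipschitzE[OF assms] by metis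
  show thesis
  proof (rule that[of "norm (g 0) + L * \<bar>R\<bar>"])
    fix x :: 'a assume x: "norm x \<le> R"
    have "norm (g x - g 0) \<le> L * norm (x - 0)" by (rule L(2)) (use x in auto)
    also have "\<dots> \<le> L * \<bar>R\<bar>" using x L(1) by (intro mult_left_mono) auto
    finally show "norm (g x) \<le> norm (g 0) + L * \<bar>R\<bar>"
      using norm_triangle_sub[of "g x" "g 0"] by linarith
  qed (use L(1) in simp)
qed

lemma ball_lipschitz_const: "ball_lipschitz (\<lambda>x. a)"
  by (rule ball_lipschitzI) auto

lemma ball_lipschitz_bounded_linear:
  assumes "bounded_linear f" shows "ball_lipschitz f"
proof (rule ball_lipschitzI)
  interpret bounded_linear f by fact
  obtain K where K: "K > 0" "\<And>x. norm (f x) \<le> norm x * K" using pos_bounded by blast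
  show "\<exists>L\<ge>0. \<forall>x y. norm x \<le> R \<longrightarrow> norm y \<le> R \<longrightarrow> norm (f x - f y) \<le> L * norm (x - y)" for R
    using K(1) K(2)[of "_ - _"] by (intro exI[of _ K]) (auto simp: diff mult.commute less_imp_le)
qed

lemma ball_lipschitz_add:
  assumes "ball_lipschitz f" "ball_lipschitz g"
  shows "ball_lipschitz (\<lambda>x. f x + g x)"
proof (rule ball_lipschitzI)
  fix R
  obtain K where K: "K \<ge> 0" "\<And>x y. norm x \<le> R \<Longrightarrow> norm y \<le> R \<Longrightarrow> norm (f x - f y) \<le> K * norm (x - y)"
    using ball_lipschitzE[OF assms(1)] by metis
  obtain L where L: "L \<ge> 0" "\<And>x y. norm x \<le> R \<Longrightarrow> norm y \<le> R \<Longrightarrow> norm (g x - g y) \<le> L * norm (x - y)"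
    using ball_lipschitzE[OF assms(2)] by metis
  have "norm (f x + g x - (f y + g y)) \<le> (K + L) * norm (x - y)" if "norm x \<le> R" "norm y \<le> R" for x y
  proof -
    have "norm (f x + g x - (f y + g y)) \<le> norm (f x - f y) + norm (g x - g y)"
      by (rule norm_diff_triangle_ineq)
    also have "\<dots> \<le> (K + L) * norm (x - y)"
      using K(2)[OF that] L(2)[OF that] by (simp add: distrib_right)
    finally show ?thesis .
  qed
  then show "\<exists>L\<ge>0. \<forall>x y. norm x \<le> R \<longrightarrow> norm y \<le> R \<longrightarrow> norm (f x + g x - (f y + g y)) \<le> L * norm (x - y)"
    using K(1) L(1) by (intro exI[of _ "K + L"]) auto
qed

lemma ball_lipschitz_scaleR:
  assumes "ball_lipschitz f" "ball_lipschitz g"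
  shows "ball_lipschitz (\<lambda>x. f x *\<^sub>R g x)"
proof (rule ball_lipschitzI)
  fix R
  obtain K where K: "K \<ge> 0" "\<And>x y. norm x \<le> R \<Longrightarrow> norm y \<le> R \<Longrightarrow> norm (f x - f y) \<le> K * norm (x - y)"
    using ball_lipschitzE[OF assms(1)] by metis
  obtain L where L: "L \<ge> 0" "\<And>x y. norm x \<le> R \<Longrightarrow> norm y \<le> R \<Longrightarrow> norm (g x - g y) \<le> L * norm (x - y)"
    using ball_lipschitzE[OF assms(2)] by metis
  obtain A where A: "A \<ge> 0" "\<And>x. norm x \<le> R \<Longrightarrow> norm (f x) \<le> A"
    using ball_lipschitz_bounded[OF assms(1)] by metis
  obtain B where B: "B \<ge> 0" "\<And>x. norm x \<le> R \<Longrightarrow> norm (g x) \<le> B"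
    using ball_lipschitz_bounded[OF assms(2)] by metis
  have "norm (f x *\<^sub>R g x - f y *\<^sub>R g y) \<le> (A * L + K * B) * norm (x - y)"
    if "norm x \<le> R" "norm y \<le> R" for x y
  proof -
    have "f x *\<^sub>R g x - f y *\<^sub>R g y = f x *\<^sub>R (g x - g y) + (f x - f y) *\<^sub>R g y"
      by (simp add: scaleR_diff_right scaleR_diff_left)
    also have "norm \<dots> \<le> norm (f x) * norm (g x - g y) + norm (f x - f y) * norm (g y)"
      using norm_triangle_ineq[of "f x *\<^sub>R (g x - g y)" "(f x - f y) *\<^sub>R g y"] by simp
    also have "\<dots> \<le> A * (L * norm (x - y)) + (K * norm (x - y)) * B"
      using that by (intro add_mono mult_mono A B K L) (auto intro!: mult_nonneg_nonneg K A)
    finally show ?thesis by (simp add: algebra_simps)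
  qed
  then show "\<exists>L\<ge>0. \<forall>x y. norm x \<le> R \<longrightarrow> norm y \<le> R \<longrightarrow> norm (f x *\<^sub>R g x - f y *\<^sub>R g y) \<le> L * norm (x - y)"
    using K(1) L(1) A(1) B(1) by (intro exI[of _ "A * L + K * B"]) auto
qed

lemma ball_lipschitz_mult:
  fixes f g :: "'a::real_normed_vector \<Rightarrow> real"
  shows "ball_lipschitz f \<Longrightarrow> ball_lipschitz g \<Longrightarrow> ball_lipschitz (\<lambda>x. f x * g x)"
  using ball_lipschitz_scaleR[of f g] by simp

lemma ball_lipschitz_power:
  fixes f :: "'a::real_normed_vector \<Rightarrow> real"
  assumes "ball_lipschitz f" shows "ball_lipschitz (\<lambda>x. f x ^ d)"
proof (induction d)
  case (Suc d)
  then show ?case using ball_lipschitz_mult[OF assms] by simp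
qed (simp add: ball_lipschitz_const)

text \<open>The cone itself is Lipschitz in \<open>u\<close>, and a \<open>C\<^sup>1\<close> map is Lipschitz on balls by the mean value inequality.\<close>

lemma ball_lipschitz_on_cone:
  fixes F :: "spacetime \<Rightarrow> 'b::euclidean_space"
  assumes F: "Ck (Suc m) F"
  shows "ball_lipschitz (\<lambda>u. F (z + past_cone c u))"
proof (rule ball_lipschitzI)
  fix R :: real
  define l where "l = 1 + 1 / \<bar>c\<bar>"
  have l: "l \<ge> 0" unfolding l_def by simp
  have cone: "norm (past_cone c u - past_cone c w) \<le> l * norm (u - w)" for u w
  proof -
    have "past_cone c u - past_cone c w = (u - w, - (norm u - norm w) / c)"
      by (simp add: past_cone_def diff_divide_distrib)
    also have "norm \<dots> \<le> norm (u - w) + norm (- (norm u - norm w) / c)"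
      by (rule norm_Pair_le)
    also have "norm (- (norm u - norm w) / c) = \<bar>norm u - norm w\<bar> / \<bar>c\<bar>"
      by (simp only: real_norm_def abs_divide abs_minus_cancel)
    also have "\<dots> \<le> norm (u - w) / \<bar>c\<bar>"
      by (intro divide_right_mono norm_triangle_ineq3) simp
    finally show ?thesis by (simp add: l_def distrib_right)
  qed
  define M where "M = norm z + l * \<bar>R\<bar>"
  have in_ball: "z + past_cone c u \<in> cball 0 M" if "norm u \<le> R" for u
  proof -
    have "norm (past_cone c u - past_cone c 0) \<le> l * norm (u - 0)" by (rule cone)
    moreover have "l * norm (u - 0) \<le> l * \<bar>R\<bar>" using that l by (intro mult_left_mono) auto
    ultimately show ?thesis
      using norm_triangle_ineq[of z "past_cone c u"] by (simp add: M_def past_cone_def)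
  qed
  obtain C where C: "C > 0" "\<And>x v. x \<in> cball 0 M \<Longrightarrow> norm (dir_deriv v F x) \<le> C * norm v"
    using Ck_derivative_bounded_on_compact[OF F compact_cball] by metis
  have lip: "norm (F x - F y) \<le> C * norm (x - y)" if "x \<in> cball 0 M" "y \<in> cball 0 M" for x y
    by (rule differentiable_bound[OF convex_cball has_derivative_at_withinI[OF Ck_has_derivative[OF F]] _ that])
      (rule onorm_le, rule C(2))
  have "norm (F (z + past_cone c u) - F (z + past_cone c w)) \<le> (C * l) * norm (u - w)"
    if "norm u \<le> R" "norm w \<le> R" for u w
  proof -
    have "norm (F (z + past_cone c u) - F (z + past_cone c w)) \<le> C * norm (past_cone c u - past_cone c w)"
      using lip[OF in_ball[OF that(1)] in_ball[OF that(2)]] by simp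
    also have "\<dots> \<le> C * (l * norm (u - w))" using C(1) by (intro mult_left_mono cone) simp
    finally show ?thesis by simp
  qed
  then show "\<exists>L\<ge>0. \<forall>x y. norm x \<le> R \<longrightarrow> norm y \<le> R \<longrightarrow>
      norm (F (z + past_cone c x) - F (z + past_cone c y)) \<le> L * norm (x - y)"
    using C(1) l by (intro exI[of _ "C * l"]) auto
qed

lemma locally_integrable_bounded:
  fixes k :: "'a::euclidean_space \<Rightarrow> real"
  assumes k: "k \<in> borel_measurable borel" and bound: "\<And>R. \<exists>M. \<forall>u. norm u \<le> R \<longrightarrow> \<bar>k u\<bar> \<le> M"
  shows "locally_integrable k"
  unfolding locally_integrable_def
proof (intro conjI allI k)
  fix R
  obtain M where M: "\<And>u. norm u \<le> R \<Longrightarrow> \<bar>k u\<bar> \<le> M" using bound by blast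
  note [measurable] = k
  show "integrable lborel (\<lambda>u. indicator (cball 0 R) u * k u)"
    by (rule Bochner_Integration.integrable_bound[OF integrable_indicator_cball[of R M]], measurable)
      (use M in \<open>auto simp: indicator_def intro!: AE_I2 order_trans[OF _ abs_ge_self]\<close>)
qed

lemma locally_integrable_ball_lipschitz:
  fixes q b :: "'a::euclidean_space \<Rightarrow> real"
  assumes q: "ball_lipschitz q" and b: "b \<in> borel_measurable borel" "\<And>u. \<bar>b u\<bar> \<le> M"
  shows "locally_integrable (\<lambda>u. q u * b u)"
proof (rule locally_integrable_bounded)
  have "q \<in> borel_measurable borel"
    by (intro borel_measurable_continuous_onI ball_lipschitz_continuous q)
  then show "(\<lambda>u. q u * b u) \<in> borel_measurable borel" using b(1) by measurable
  fix R
  obtain A where A: "A \<ge> 0" "\<And>u. norm u \<le> R \<Longrightarrow> norm (q u) \<le> A"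
    using ball_lipschitz_bounded[OF q] by metis
  show "\<exists>M. \<forall>u. norm u \<le> R \<longrightarrow> \<bar>q u * b u\<bar> \<le> M"
    using A b(2) by (intro exI[of _ "A * M"]) (auto simp: abs_mult intro!: mult_mono)
qed

lemma lborel_integral_translate:
  fixes g :: "'a::euclidean_space \<Rightarrow> 'b::euclidean_space"
  assumes "g \<in> borel_measurable borel"
  shows "(LINT u|lborel. g (v + u)) = (LINT u|lborel. g u)"
proof -
  have "(LINT u|lborel. g u) = (LINT u|distr lborel borel ((+) v). g u)"
    by (simp only: lborel_distr_plus)
  also have "\<dots> = (LINT u|lborel. g (v + u))"
    by (rule integral_distr) (use assms in auto)
  finally show ?thesis by simp
qed

lemma integrable_lborel_translate:
  fixes g :: "'a::euclidean_space \<Rightarrow> 'b::euclidean_space"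
  assumes "integrable lborel g"
  shows "integrable lborel (\<lambda>u. g (v + u))"
proof -
  have "integrable (distr lborel borel ((+) v)) g" using assms by (simp only: lborel_distr_plus)
  then show ?thesis by (rule integrable_distr[rotated]) simp
qed

text \<open>By translation invariance every difference quotient of \<open>g\<close> has integral \<open>0\<close>; the Lipschitz
  bound lets the limit pass under the integral.  Exceptional null sets are harmless, so kernels
  with a kink on a sphere are admissible.\<close>

lemma integral_directional_derivative_eq_0:
  fixes g :: "'a::euclidean_space \<Rightarrow> 'b::euclidean_space"
  assumes lip: "ball_lipschitz g" and supp: "\<And>u. norm u > R \<Longrightarrow> g u = 0"
    and der: "AE u in lborel. ((\<lambda>h. g (u + h *\<^sub>R v)) has_vector_derivative g' u) (at 0)"
    and g': "g' \<in> borel_measurable lborel"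
  shows "(LINT u|lborel. g' u) = 0"
proof -
  define h where "h n = inverse (real (Suc n))" for n
  have h: "h n > 0" "h n \<le> 1" for n unfolding h_def by (auto simp: field_simps)
  have h0: "h \<longlonglongrightarrow> 0" unfolding h_def by (rule LIMSEQ_inverse_real_of_nat)
  define s where "s n u = (1 / h n) *\<^sub>R (g (h n *\<^sub>R v + u) - g u)" for n u
  have g: "g \<in> borel_measurable borel"
    by (intro borel_measurable_continuous_onI ball_lipschitz_continuous lip)
  obtain M where M: "M \<ge> 0" "\<And>u. norm u \<le> R \<Longrightarrow> norm (g u) \<le> M"
    using ball_lipschitz_bounded[OF lip] by metis
  have int: "integrable lborel g"
  proof (rule Bochner_Integration.integrable_bound[OF integrable_indicator_cball[of R M]])
    show "AE u in lborel. norm (g u) \<le> norm (indicator (cball 0 R) u * M)"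
      using M supp by (intro AE_I2) (auto simp: indicator_def)
  qed (use g in simp)
  have s_int: "(LINT u|lborel. s n u) = 0" for n
    unfolding s_def integral_scaleR_right
    by (simp add: integrable_lborel_translate int lborel_integral_translate g)
  obtain L where L: "L \<ge> 0" "\<And>x y. norm x \<le> R + 2 * norm v \<Longrightarrow> norm y \<le> R + 2 * norm v \<Longrightarrow> norm (g x - g y) \<le> L * norm (x - y)"
    using ball_lipschitzE[OF lip] by metis
  have "(\<lambda>n. LINT u|lborel. s n u) \<longlonglongrightarrow> (LINT u|lborel. g' u)"
  proof (rule integral_dominated_convergence[OF g'])
    show "integrable lborel (\<lambda>u::'a. indicator (cball 0 (R + norm v)) u * (L * norm v))"
      by (rule integrable_indicator_cball)
    show "s n \<in> borel_measurable lborel" for n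
      unfolding s_def using g by measurable
    show "AE u in lborel. (\<lambda>n. s n u) \<longlonglongrightarrow> g' u"
      using der
    proof eventually_elim
      case (elim u)
      then have "((\<lambda>t. norm (g (u + t *\<^sub>R v) - g u - t *\<^sub>R g' u) / norm t) \<longlongrightarrow> 0) (at 0)"
        by (simp add: has_vector_derivative_def has_derivative_iff_norm)
      moreover have "\<forall>n. h n \<in> UNIV - {0}" using h(1) by (auto simp: less_le)
      ultimately have "(\<lambda>n. norm (g (u + h n *\<^sub>R v) - g u - h n *\<^sub>R g' u) / norm (h n)) \<longlonglongrightarrow> 0"
        using h0 unfolding tendsto_at_iff_sequentially comp_def by blast
      moreover have "norm (g (u + h n *\<^sub>R v) - g u - h n *\<^sub>R g' u) / norm (h n) = norm (s n u - g' u)" for n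
      proof -
        have "s n u - g' u = (1 / h n) *\<^sub>R (g (u + h n *\<^sub>R v) - g u - h n *\<^sub>R g' u)"
          using h(1)[of n] by (simp add: s_def scaleR_diff_right add.commute)
        then show ?thesis using h(1)[of n] by simp
      qed
      ultimately have "(\<lambda>n. norm (s n u - g' u)) \<longlonglongrightarrow> 0" by simp
      then show ?case by (rule LIM_zero_cancel[OF tendsto_norm_zero_cancel])
    qed
    show "AE u in lborel. norm (s n u) \<le> indicator (cball 0 (R + norm v)) u * (L * norm v)" for n
    proof (rule AE_I2)
      fix u
      have hv: "norm (h n *\<^sub>R v) \<le> norm v" using h[of n] by (simp add: mult_left_le_one_le)
      show "norm (s n u) \<le> indicator (cball 0 (R + norm v)) u * (L * norm v)"
      proof (cases "norm u \<le> R + norm v")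
        case True
        have "norm (g (h n *\<^sub>R v + u) - g u) \<le> L * norm (h n *\<^sub>R v + u - u)"
          using True hv norm_triangle_ineq[of "h n *\<^sub>R v" u] by (intro L(2)) (auto intro: order_trans)
        also have "\<dots> = h n * (L * norm v)" using h[of n] by simp
        finally have le: "norm (g (h n *\<^sub>R v + u) - g u) \<le> h n * (L * norm v)" .
        have "norm (s n u) = (1 / h n) * norm (g (h n *\<^sub>R v + u) - g u)"
          using h[of n] by (simp only: s_def norm_scaleR) simp
        also have "\<dots> \<le> (1 / h n) * (h n * (L * norm v))"
          using h[of n] by (intro mult_left_mono le) simp
        finally show ?thesis using True h(1)[of n] by simp
      next
        case False
        have "norm u \<le> norm (h n *\<^sub>R v + u) + norm (h n *\<^sub>R v)"
          using norm_triangle_ineq4[of "h n *\<^sub>R v + u" "h n *\<^sub>R v"] by simp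
        then have "norm u > R" "norm (h n *\<^sub>R v + u) > R"
          using False hv norm_ge_zero[of v] by linarith+
        then show ?thesis using False by (simp add: s_def supp)
      qed
    qed
  qed
  then show ?thesis unfolding s_int using LIMSEQ_unique tendsto_const by blast
qed

lemma norm_has_derivative_along_line:
  fixes u a :: "'a::real_inner"
  assumes "u \<noteq> 0"
  shows "((\<lambda>h. norm (u + h *\<^sub>R a)) has_real_derivative sgn u \<bullet> a) (at 0)"
proof -
  have "((\<lambda>h. norm (u + h *\<^sub>R a)) has_derivative (\<lambda>d. (d *\<^sub>R a) \<bullet> sgn (u + 0 *\<^sub>R a))) (at 0)"
  proof (rule has_derivative_compose[where f="\<lambda>h. u + h *\<^sub>R a"])
    show "(norm has_derivative (\<lambda>x. x \<bullet> sgn (u + 0 *\<^sub>R a))) (at (u + 0 *\<^sub>R a))"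
      by (rule has_derivative_norm) (use assms in simp)
  qed (auto intro!: derivative_eq_intros)
  then show ?thesis
    by (simp add: has_field_derivative_def inner_commute mult_commute_abs)
qed

lemma dir_deriv_split:
  fixes F :: "spacetime \<Rightarrow> 'b::euclidean_space"
  assumes "Ck (Suc m) F"
  shows "dir_deriv (a, s) F z = dir_deriv (a, 0) F z + s *\<^sub>R dir_deriv (0, 1) F z"
proof -
  have "(a, s) = (a, 0) + s *\<^sub>R (0, 1)" by simp
  then show ?thesis
    using linear_add[OF linear_dir_deriv[OF assms]] linear_scale[OF linear_dir_deriv[OF assms]]
    by metis
qed

lemma AE_lborel_not_in_singleton: "AE u in lborel. u \<noteq> (a::'a::euclidean_space)"
  by (rule AE_I'[of "{a}"]) (auto simp: null_sets_def)

text \<open>The retarded time depends on \<open>u\<close>, so moving a spatial derivative from \<open>F\<close> onto the kernel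
  also produces a term with the time derivative of \<open>F\<close>.\<close>

lemma cone_integral_by_parts:
  fixes F :: "spacetime \<Rightarrow> 'b::euclidean_space"
  assumes F: "Ck (Suc m) F" "spatially_bounded F"
    and q: "ball_lipschitz q" "AE u in lborel. ((\<lambda>h. q (u + h *\<^sub>R a)) has_real_derivative q' u) (at 0)"
    and q': "locally_integrable q'"
  shows "cone_integral c q (dir_deriv (a, 0) F) z
    = cone_integral c (\<lambda>u. q u * ((sgn u \<bullet> a) / c)) (dir_deriv (0, 1) F) z - cone_integral c q' F z"
proof -
  let ?n = "\<lambda>u. (sgn u \<bullet> a) / c"
  have n: "?n \<in> borel_measurable borel" by measurable
  have nb: "\<bar>?n u\<bar> \<le> norm a / \<bar>c\<bar>" for u
  proof -
    have "\<bar>sgn u \<bullet> a\<bar> \<le> norm (sgn u) * norm a" by (rule Cauchy_Schwarz_ineq2)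
    also have "\<dots> \<le> norm a" by (simp add: norm_sgn)
    finally show ?thesis by (simp add: divide_right_mono)
  qed
  have qn: "locally_integrable (\<lambda>u. q u * ?n u)" by (rule locally_integrable_ball_lipschitz[OF q(1) n nb])
  have q0: "locally_integrable q"
    using locally_integrable_ball_lipschitz[OF q(1), of "\<lambda>_. 1" 1] by simp
  note contF = Ck_continuous[OF F(1)] and contD = Ck_continuous[OF Ck_dir_deriv[OF F(1)]]
  note bd = spatially_bounded_dir_deriv[OF F(2)]
  define g' where "g' u = q u *\<^sub>R dir_deriv (a, 0) F (z + past_cone c u)
      - (q u * ?n u) *\<^sub>R dir_deriv (0, 1) F (z + past_cone c u) + q' u *\<^sub>R F (z + past_cone c u)" for u
  obtain R where R: "\<And>z. norm (fst z) > R \<Longrightarrow> F z = 0"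
    using F(2) unfolding spatially_bounded_def by blast
  have "(LINT u|lborel. g' u) = 0"
  proof (rule integral_directional_derivative_eq_0)
    show "ball_lipschitz (\<lambda>u. q u *\<^sub>R F (z + past_cone c u))"
      by (rule ball_lipschitz_scaleR[OF q(1) ball_lipschitz_on_cone[OF F(1)]])
    show "q u *\<^sub>R F (z + past_cone c u) = 0" if "norm u > R + norm z + 1" for u
      using R[OF norm_fst_cone_shift[OF _ that], of z c] by simp
    show "g' \<in> borel_measurable lborel"
      unfolding g'_def
      by (intro borel_measurable_add borel_measurable_diff borel_measurable_cone_integrand contF contD
          locally_integrable_measurable q0 qn q')
    show "AE u in lborel. ((\<lambda>h. q (u + h *\<^sub>R a) *\<^sub>R F (z + past_cone c (u + h *\<^sub>R a)))
        has_vector_derivative g' u) (at 0)"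
      using q(2) AE_lborel_not_in_singleton[of 0]
    proof eventually_elim
      case (elim u)
      have "((\<lambda>h. z + past_cone c (u + h *\<^sub>R a)) has_vector_derivative 0 + (a, - (sgn u \<bullet> a) / c)) (at 0)"
        unfolding past_cone_def
      proof (intro has_vector_derivative_add has_vector_derivative_const has_vector_derivative_Pair)
        show "((\<lambda>h. u + h *\<^sub>R a) has_vector_derivative a) (at 0)"
          by (auto intro!: derivative_eq_intros)
        show "((\<lambda>h. - norm (u + h *\<^sub>R a) / c) has_vector_derivative - (sgn u \<bullet> a) / c) (at 0)"
          unfolding has_real_derivative_iff_has_vector_derivative[symmetric]
          by (intro DERIV_cdivide DERIV_minus norm_has_derivative_along_line elim)
      qed
      from vector_derivative_diff_chain_within[OF this has_derivative_at_withinI[OF Ck_has_derivative[OF F(1)]]]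
      have "((\<lambda>h. F (z + past_cone c (u + h *\<^sub>R a))) has_vector_derivative
          dir_deriv (a, - (sgn u \<bullet> a) / c) F (z + past_cone c u)) (at 0)"
        by (simp add: o_def)
      from has_vector_derivative_scaleR[OF elim(1) this]
      have "((\<lambda>h. q (u + h *\<^sub>R a) *\<^sub>R F (z + past_cone c (u + h *\<^sub>R a))) has_vector_derivative
        q u *\<^sub>R dir_deriv (a, - (sgn u \<bullet> a) / c) F (z + past_cone c u) + q' u *\<^sub>R F (z + past_cone c u)) (at 0)"
        by simp
      moreover have "q u *\<^sub>R dir_deriv (a, - (sgn u \<bullet> a) / c) F (z + past_cone c u) + q' u *\<^sub>R F (z + past_cone c u) = g' u"
        unfolding g'_def dir_deriv_split[OF F(1), of a "- (sgn u \<bullet> a) / c"] by (simp add: scaleR_add_right scaleR_diff_right)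
      ultimately show ?case by simp
    qed
  qed
  also have "(LINT u|lborel. g' u) = cone_integral c q (dir_deriv (a, 0) F) z
      - cone_integral c (\<lambda>u. q u * ?n u) (dir_deriv (0, 1) F) z + cone_integral c q' F z"
    unfolding g'_def cone_integral_def
    using integrable_cone[OF contD bd q0] integrable_cone[OF contD bd qn] integrable_cone[OF contF F(2) q']
    by (subst Bochner_Integration.integral_add Bochner_Integration.integral_diff;
        (intro Bochner_Integration.integrable_diff)?; simp)+
  finally show ?thesis by (simp add: algebra_simps)
qed

text \<open>The kernel of the potential, truncated near its singularity.\<close>

definition inv_norm :: "real \<Rightarrow> 'a::real_normed_vector \<Rightarrow> real" where
  "inv_norm e u = 1 / max (norm u) e"

lemma inv_norm_pos: "e > 0 \<Longrightarrow> inv_norm e u > 0"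
  by (simp add: inv_norm_def less_max_iff_disj)

lemma inv_norm_le: "e > 0 \<Longrightarrow> inv_norm e u \<le> 1 / e"
  unfolding inv_norm_def by (rule divide_left_mono) (auto intro!: mult_pos_pos simp: less_max_iff_disj)

lemma inv_norm_le_inverse: "e > 0 \<Longrightarrow> u \<noteq> 0 \<Longrightarrow> inv_norm e u \<le> 1 / norm u"
  by (simp add: inv_norm_def max_def frac_le)

lemma norm_mult_inv_norm_le: "e > 0 \<Longrightarrow> norm u * inv_norm e u \<le> 1"
  by (cases "u = 0") (auto simp: inv_norm_def max_def)

lemma borel_measurable_inv_norm [measurable]: "inv_norm e \<in> borel_measurable borel"
  unfolding inv_norm_def[abs_def] by measurable

lemma ball_lipschitz_inv_norm:
  assumes e: "e > 0"
  shows "ball_lipschitz (inv_norm e :: 'a::real_normed_vector \<Rightarrow> real)"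
proof (rule ball_lipschitzI)
  fix R
  have "norm (inv_norm e x - inv_norm e y) \<le> (1 / e\<^sup>2) * norm (x - y)" for x y :: 'a
  proof -
    let ?X = "max (norm x) e" and ?Y = "max (norm y) e"
    have pos: "?X \<ge> e" "?Y \<ge> e" by auto
    have "inv_norm e x - inv_norm e y = (?Y - ?X) / (?X * ?Y)"
      using pos e by (simp add: inv_norm_def field_simps)
    then have "norm (inv_norm e x - inv_norm e y) = \<bar>?Y - ?X\<bar> / (?X * ?Y)"
      using pos e by (simp add: abs_mult)
    also have "\<dots> \<le> norm (x - y) / (e * e)"
    proof (rule frac_le)
      have "\<bar>norm x - norm y\<bar> \<le> norm (x - y)" by (rule norm_triangle_ineq3)
      then show "\<bar>?Y - ?X\<bar> \<le> norm (x - y)" by (auto simp: max_def abs_if split: if_splits)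
      show "e * e \<le> ?X * ?Y" using pos e by (intro mult_mono) auto
    qed (use e in auto)
    finally show ?thesis by (simp add: power2_eq_square)
  qed
  then show "\<exists>L\<ge>0. \<forall>x y::'a. norm x \<le> R \<longrightarrow> norm y \<le> R \<longrightarrow>
      norm (inv_norm e x - inv_norm e y) \<le> L * norm (x - y)"
    by (intro exI[of _ "1 / e\<^sup>2"]) auto
qed

lemma inv_norm_has_derivative_along_line:
  fixes u a :: "'a::real_inner"
  assumes e: "e > 0" and u: "u \<noteq> 0" "norm u \<noteq> e"
  shows "((\<lambda>h. inv_norm e (u + h *\<^sub>R a)) has_real_derivative
    (if norm u > e then - (inv_norm e u)\<^sup>2 * (sgn u \<bullet> a) else 0)) (at 0)"
proof (cases "norm u > e")
  case True
  have "((\<lambda>h. inverse (norm (u + h *\<^sub>R a))) has_real_derivative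
      - (inverse (norm (u + 0 *\<^sub>R a)) * (sgn u \<bullet> a) * inverse (norm (u + 0 *\<^sub>R a)))) (at 0)"
    by (rule DERIV_inverse'[OF norm_has_derivative_along_line[OF u(1)]]) (use u in simp)
  then have "((\<lambda>h. inverse (norm (u + h *\<^sub>R a))) has_real_derivative - (inv_norm e u)\<^sup>2 * (sgn u \<bullet> a)) (at 0)"
    using True by (simp add: inv_norm_def max_def power2_eq_square divide_inverse mult_ac)
  then have "((\<lambda>h. inv_norm e (u + h *\<^sub>R a)) has_real_derivative - (inv_norm e u)\<^sup>2 * (sgn u \<bullet> a)) (at 0)"
  proof (rule has_field_derivative_transform_within_open)
    show "open {h. norm (u + h *\<^sub>R a) > e}"
      by (intro open_Collect_less continuous_intros)
  qed (use True in \<open>auto simp: inv_norm_def max_def divide_inverse\<close>)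
  then show ?thesis using True by simp
next
  case False
  have "((\<lambda>h. 1 / e) has_real_derivative 0) (at 0)" by simp
  then have "((\<lambda>h. inv_norm e (u + h *\<^sub>R a)) has_real_derivative 0) (at 0)"
  proof (rule has_field_derivative_transform_within_open)
    show "open {h. norm (u + h *\<^sub>R a) < e}"
      by (intro open_Collect_less continuous_intros)
  qed (use False u in \<open>auto simp: inv_norm_def max_def\<close>)
  then show ?thesis using False by simp
qed

lemma AE_lborel_norm_neq: "AE u in lborel. norm (u::'a::euclidean_space) \<noteq> e"
proof (rule AE_I'[of "sphere 0 e"])
  show "sphere (0::'a) e \<in> null_sets lborel"
    using negligible_sphere[of "0::'a" e] by (simp add: negligible_iff_null_sets null_sets_completion_iff)
qed auto

lemma ball_lipschitz_truncated_kernel: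
  fixes w :: "'a::real_inner"
  assumes "e > 0" shows "ball_lipschitz (\<lambda>u. (\<alpha> + w \<bullet> u) * inv_norm e u ^ d)"
  by (rule ball_lipschitz_mult[OF ball_lipschitz_add[OF ball_lipschitz_const
          ball_lipschitz_bounded_linear[OF bounded_linear_inner_right]]
        ball_lipschitz_power[OF ball_lipschitz_inv_norm[OF assms]]])

lemma abs_sgn_inner_le: "\<bar>sgn u \<bullet> a\<bar> \<le> norm a"
proof -
  have "\<bar>sgn u \<bullet> a\<bar> \<le> norm (sgn u) * norm a" by (rule Cauchy_Schwarz_ineq2)
  also have "\<dots> \<le> norm a" by (simp add: norm_sgn)
  finally show ?thesis .
qed

lemma locally_integrable_truncated_derivative:
  fixes w a :: "real^3"
  assumes e: "e > 0"
  shows "locally_integrable (\<lambda>u. (w \<bullet> a) * inv_norm e u ^ d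
      - (if norm u > e then real d * (\<alpha> + w \<bullet> u) * inv_norm e u ^ Suc d * (sgn u \<bullet> a) else 0))"
proof -
  have s: "\<bar>if norm u > e then sgn u \<bullet> a else 0\<bar> \<le> norm a" for u
    by (simp add: abs_sgn_inner_le)
  have sm: "(\<lambda>u. if norm u > e then sgn u \<bullet> a else 0) \<in> borel_measurable borel" by measurable
  have k1: "locally_integrable (\<lambda>u::real^3. (w \<bullet> a) * inv_norm e u ^ d)"
    using locally_integrable_ball_lipschitz[OF ball_lipschitz_truncated_kernel[OF e, of "w \<bullet> a" 0], of "\<lambda>_. 1" 1]
    by simp
  have k2: "locally_integrable (\<lambda>u. (\<alpha> + w \<bullet> u) * inv_norm e u ^ Suc d * (if norm u > e then sgn u \<bullet> a else 0))"
    by (rule locally_integrable_ball_lipschitz[OF ball_lipschitz_truncated_kernel[OF e] sm s])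
  have "locally_integrable (\<lambda>u. (w \<bullet> a) * inv_norm e u ^ d
      - real d * ((\<alpha> + w \<bullet> u) * inv_norm e u ^ Suc d * (if norm u > e then sgn u \<bullet> a else 0)))"
    using k1 k2 unfolding locally_integrable_def
    by (auto simp: right_diff_distrib mult.left_commute[of _ "real d"] simp del: power_Suc
        intro!: borel_measurable_diff borel_measurable_times)
  moreover have "(\<lambda>u. (w \<bullet> a) * inv_norm e u ^ d
      - real d * ((\<alpha> + w \<bullet> u) * inv_norm e u ^ Suc d * (if norm u > e then sgn u \<bullet> a else 0)))
    = (\<lambda>u. (w \<bullet> a) * inv_norm e u ^ d
      - (if norm u > e then real d * (\<alpha> + w \<bullet> u) * inv_norm e u ^ Suc d * (sgn u \<bullet> a) else 0))"
    by (rule ext) simp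
  ultimately show ?thesis by simp
qed

text \<open>All kernels needed are of the form \<open>(\<alpha> + w \<bullet> u) / \<bar>u\<bar>\<^sup>d\<close>: the potential has \<open>\<alpha> = 1\<close>, \<open>w = 0\<close>, \<open>d = 1\<close>, and the
  components of \<open>u/\<bar>u\<bar>\<^sup>d\<close> have \<open>\<alpha> = 0\<close> and \<open>w\<close> a basis vector.  Truncation makes them Lipschitz, and then the derivative
  of \<open>1/\<bar>u\<bar>\<close> only counts outside the ball of radius \<open>e\<close>.\<close>

lemma cone_integral_by_parts_truncated:
  fixes F :: "spacetime \<Rightarrow> 'b::euclidean_space"
  assumes F: "Ck (Suc m) F" "spatially_bounded F" and e: "e > 0"
  shows "cone_integral c (\<lambda>u. (\<alpha> + w \<bullet> u) * inv_norm e u ^ d) (dir_deriv (a, 0) F) z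
    = cone_integral c (\<lambda>u. (\<alpha> + w \<bullet> u) * inv_norm e u ^ d * ((sgn u \<bullet> a) / c)) (dir_deriv (0, 1) F) z
    - cone_integral c (\<lambda>u. (w \<bullet> a) * inv_norm e u ^ d
        - (if norm u > e then real d * (\<alpha> + w \<bullet> u) * inv_norm e u ^ Suc d * (sgn u \<bullet> a) else 0)) F z"
proof (rule cone_integral_by_parts[OF F ball_lipschitz_truncated_kernel[OF e] _
      locally_integrable_truncated_derivative[OF e]])
  show "AE u in lborel. ((\<lambda>h. (\<alpha> + w \<bullet> (u + h *\<^sub>R a)) * inv_norm e (u + h *\<^sub>R a) ^ d) has_real_derivative
      (w \<bullet> a) * inv_norm e u ^ d
        - (if norm u > e then real d * (\<alpha> + w \<bullet> u) * inv_norm e u ^ Suc d * (sgn u \<bullet> a) else 0)) (at 0)"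
    using AE_lborel_not_in_singleton[of 0] AE_lborel_norm_neq[of e]
  proof eventually_elim
    case (elim u)
    have 1: "((\<lambda>h. \<alpha> + w \<bullet> (u + h *\<^sub>R a)) has_real_derivative w \<bullet> a) (at 0)"
      by (auto intro!: derivative_eq_intros simp: inner_add_right)
    note 2 = DERIV_power[OF inv_norm_has_derivative_along_line[OF e elim, of a], where n=d]
    have "(w \<bullet> a) * inv_norm e u ^ d + real d * ((if norm u > e then - (inv_norm e u)\<^sup>2 * (sgn u \<bullet> a) else 0)
        * inv_norm e u ^ (d - Suc 0)) * (\<alpha> + w \<bullet> u)
      = (w \<bullet> a) * inv_norm e u ^ d
        - (if norm u > e then real d * (\<alpha> + w \<bullet> u) * inv_norm e u ^ Suc d * (sgn u \<bullet> a) else 0)"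
      by (cases d) (simp_all add: power2_eq_square)
    with DERIV_mult[OF 1 2] show ?case by (simp only: scaleR_zero_left add_0_right)
  qed
qed


section \<open>The singular kernels and the wave equation\<close>

lemma locally_integrable_inverse_square:
  "locally_integrable (\<lambda>u::real^3. A + B / (norm u)\<^sup>2)"
proof (rule locally_integrableI_inverse_square)
  show "\<bar>A + B / (norm u)\<^sup>2\<bar> \<le> \<bar>A\<bar> + \<bar>B\<bar> / (norm u)\<^sup>2" for u :: "real^3"
    using abs_triangle_ineq[of A "B / (norm u)\<^sup>2"] by simp
qed measurable

text \<open>The kernels in question are at worst of order \<open>1/\<bar>u\<bar>\<^sup>2\<close>, which is integrable near \<open>0\<close> in three dimensions, and
  truncating them only makes them smaller.\<close>

lemma cone_integral_kernel_limit:
  fixes F :: "spacetime \<Rightarrow> 'b::euclidean_space"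
  assumes F: "continuous_on UNIV F" "spatially_bounded F"
    and meas: "\<And>n. k n \<in> borel_measurable borel" "k' \<in> borel_measurable borel"
    and bound: "\<And>n u. u \<noteq> 0 \<Longrightarrow> \<bar>k n u\<bar> \<le> A + B / (norm u)\<^sup>2"
    and lim: "\<And>u. u \<noteq> 0 \<Longrightarrow> (\<lambda>n. k n u) \<longlonglongrightarrow> k' u"
  shows "(\<lambda>n. cone_integral c (k n) F z) \<longlonglongrightarrow> cone_integral c k' F z"
proof -
  obtain M R where M: "M > 0"
    "\<And>y u. y \<in> cball z 1 \<Longrightarrow> norm (F (y + past_cone c u)) \<le> M * indicator (cball 0 R) u"
    using bounded_on_cones[OF F] by metis
  show ?thesis
    unfolding cone_integral_def
  proof (rule integral_dominated_convergence)
    show "integrable lborel (\<lambda>u::real^3. M * (indicator (cball 0 R) u * (A + B / (norm u)\<^sup>2)))"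
      using locally_integrable_inverse_square[of A B] unfolding locally_integrable_def by simp
    show "AE u in lborel. norm (k n u *\<^sub>R F (z + past_cone c u))
        \<le> M * (indicator (cball 0 R) u * (A + B / (norm u)\<^sup>2))" for n
      using AE_lborel_not_in_singleton[of 0]
    proof eventually_elim
      case (elim u)
      have "\<bar>k n u\<bar> * norm (F (z + past_cone c u)) \<le> (A + B / (norm u)\<^sup>2) * (M * indicator (cball 0 R) u)"
        using bound[OF elim, of n] M(2)[of z u] by (intro mult_mono) auto
      then show ?case by (simp add: mult_ac)
    qed
    show "AE u in lborel. (\<lambda>n. k n u *\<^sub>R F (z + past_cone c u)) \<longlonglongrightarrow> k' u *\<^sub>R F (z + past_cone c u)"
      using AE_lborel_not_in_singleton[of 0]
      by eventually_elim (intro tendsto_scaleR tendsto_const lim)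
  qed (intro borel_measurable_cone_integrand F(1) meas)+
qed

lemma inv_norm_eventually:
  assumes "u \<noteq> 0"
  shows "\<forall>\<^sub>F n in sequentially. norm u > 1 / real (Suc n) \<and> inv_norm (1 / real (Suc n)) u = 1 / norm u"
proof -
  have "(\<lambda>n. inverse (real (Suc n))) \<longlonglongrightarrow> 0" by (rule LIMSEQ_inverse_real_of_nat)
  then have "\<forall>\<^sub>F n in sequentially. inverse (real (Suc n)) < norm u"
    by (rule order_tendstoD) (use assms in simp)
  then show ?thesis
    by eventually_elim (auto simp: inv_norm_def max_def inverse_eq_divide)
qed

lemma cone_integral_scale: "cone_integral c (\<lambda>u. r * k u) F z = r *\<^sub>R cone_integral c k F z"
  unfolding cone_integral_def integral_scaleR_right[symmetric] by simp

lemma cone_integral_sum: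
  fixes F :: "spacetime \<Rightarrow> 'b::euclidean_space"
  assumes "continuous_on UNIV F" "spatially_bounded F" "\<And>i. i \<in> I \<Longrightarrow> locally_integrable (k i)"
  shows "(\<Sum>i\<in>I. cone_integral c (k i) F z) = cone_integral c (\<lambda>u. \<Sum>i\<in>I. k i u) F z"
  unfolding cone_integral_def scaleR_sum_left
  by (rule Bochner_Integration.integral_sum[symmetric]) (rule integrable_cone[OF assms(1,2,3)])

lemma inverse_norm_le: "1 / norm u \<le> 1 + 1 / (norm u)\<^sup>2"
proof -
  have "x \<le> 1 + x\<^sup>2" for x :: real
    using zero_le_power2[of "x - 1/2"] zero_le_power2[of x] by (simp add: power2_eq_square algebra_simps)
  from this[of "1 / norm u"] show ?thesis by (simp add: power_divide)
qed

lemma inv_norm_power_le: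
  assumes "e > 0" "u \<noteq> 0"
  shows "0 \<le> inv_norm e u ^ d" "inv_norm e u ^ d \<le> (1 / norm u) ^ d"
    "norm u * inv_norm e u ^ Suc d \<le> (1 / norm u) ^ d"
proof -
  have p: "0 \<le> inv_norm e u" using inv_norm_pos[OF assms(1), of u] by simp
  then show "0 \<le> inv_norm e u ^ d" by simp
  show le: "inv_norm e u ^ d \<le> (1 / norm u) ^ d"
    by (rule power_mono[OF inv_norm_le_inverse[OF assms] p])
  have "norm u * inv_norm e u * inv_norm e u ^ d \<le> 1 * (1 / norm u) ^ d"
    using norm_mult_inv_norm_le[OF assms(1), of u] le p by (intro mult_mono) auto
  then show "norm u * inv_norm e u ^ Suc d \<le> (1 / norm u) ^ d" by simp
qed

text \<open>The gradient of the retarded potential, with the derivative moved onto the kernel.  This is the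
  computation behind Jefimenko's equations.\<close>

lemma cone_integral_inverse_norm_gradient:
  fixes F :: "spacetime \<Rightarrow> 'b::euclidean_space"
  assumes F: "Ck (Suc m) F" "spatially_bounded F"
  shows "cone_integral c (\<lambda>u. 1 / norm u) (dir_deriv (a, 0) F) z
    = cone_integral c (\<lambda>u. (sgn u \<bullet> a) / (c * norm u)) (dir_deriv (0, 1) F) z
    + cone_integral c (\<lambda>u. (sgn u \<bullet> a) / (norm u)\<^sup>2) F z"
proof -
  define e where "e n = 1 / real (Suc n)" for n
  have e: "e n > 0" for n by (simp add: e_def)
  note contF = Ck_continuous[OF F(1)] and contD = Ck_continuous[OF Ck_dir_deriv[OF F(1)]]
  note bd = spatially_bounded_dir_deriv[OF F(2)]
  have le: "inv_norm (e n) u \<le> 1 + 1 / (norm u)\<^sup>2" "0 \<le> inv_norm (e n) u"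
    if "u \<noteq> 0" for n and u :: "real^3"
    using inv_norm_le_inverse[OF e that] inv_norm_pos[OF e, of n u] inverse_norm_le[of u]
    by (auto intro: order_trans)
  have L1: "(\<lambda>n. cone_integral c (\<lambda>u. (1 + 0 \<bullet> u) * inv_norm (e n) u ^ 1) (dir_deriv (a, 0) F) z)
      \<longlonglongrightarrow> cone_integral c (\<lambda>u. 1 / norm u) (dir_deriv (a, 0) F) z"
  proof (rule cone_integral_kernel_limit[OF contD bd])
    fix u :: "real^3" assume u: "u \<noteq> 0"
    show "\<bar>(1 + 0 \<bullet> u) * inv_norm (e n) u ^ 1\<bar> \<le> 1 + 1 / (norm u)\<^sup>2" for n
      using le[OF u, of n] by simp
    show "(\<lambda>n. (1 + 0 \<bullet> u) * inv_norm (e n) u ^ 1) \<longlonglongrightarrow> 1 / norm u"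
      by (rule tendsto_eventually, rule eventually_mono[OF inv_norm_eventually[OF u]]) (simp add: e_def)
  qed measurable
  have L2: "(\<lambda>n. cone_integral c (\<lambda>u. (1 + 0 \<bullet> u) * inv_norm (e n) u ^ 1 * ((sgn u \<bullet> a) / c)) (dir_deriv (0, 1) F) z)
      \<longlonglongrightarrow> cone_integral c (\<lambda>u. (sgn u \<bullet> a) / (c * norm u)) (dir_deriv (0, 1) F) z"
  proof (rule cone_integral_kernel_limit[OF contD bd])
    fix u :: "real^3" assume u: "u \<noteq> 0"
    have "\<bar>inv_norm (e n) u\<bar> * \<bar>(sgn u \<bullet> a) / c\<bar> \<le> (1 + 1 / (norm u)\<^sup>2) * (norm a / \<bar>c\<bar>)" for n
      using le[OF u, of n] by (intro mult_mono) (auto simp: abs_sgn_inner_le divide_right_mono)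
    then show "\<bar>(1 + 0 \<bullet> u) * inv_norm (e n) u ^ 1 * ((sgn u \<bullet> a) / c)\<bar>
        \<le> norm a / \<bar>c\<bar> + (norm a / \<bar>c\<bar>) / (norm u)\<^sup>2" for n
      by (simp add: abs_mult algebra_simps add_divide_distrib)
    show "(\<lambda>n. (1 + 0 \<bullet> u) * inv_norm (e n) u ^ 1 * ((sgn u \<bullet> a) / c)) \<longlonglongrightarrow> (sgn u \<bullet> a) / (c * norm u)"
      by (rule tendsto_eventually, rule eventually_mono[OF inv_norm_eventually[OF u]]) (simp add: e_def)
  qed measurable
  have L3: "(\<lambda>n. cone_integral c (\<lambda>u. (0 \<bullet> a) * inv_norm (e n) u ^ 1
        - (if norm u > e n then real 1 * (1 + 0 \<bullet> u) * inv_norm (e n) u ^ Suc 1 * (sgn u \<bullet> a) else 0)) F z)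
      \<longlonglongrightarrow> cone_integral c (\<lambda>u. (- 1) * ((sgn u \<bullet> a) / (norm u)\<^sup>2)) F z"
  proof (rule cone_integral_kernel_limit[OF contF F(2)])
    fix u :: "real^3" assume u: "u \<noteq> 0"
    have "inv_norm (e n) u ^ 2 * \<bar>sgn u \<bullet> a\<bar> \<le> (1 / norm u) ^ 2 * norm a" for n
      by (rule mult_mono[OF inv_norm_power_le(2)[OF e u] abs_sgn_inner_le]) auto
    then show "\<bar>(0 \<bullet> a) * inv_norm (e n) u ^ 1
        - (if norm u > e n then real 1 * (1 + 0 \<bullet> u) * inv_norm (e n) u ^ Suc 1 * (sgn u \<bullet> a) else 0)\<bar>
        \<le> 0 + norm a / (norm u)\<^sup>2" for n
      by (simp add: abs_mult power2_eq_square)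
    show "(\<lambda>n. (0 \<bullet> a) * inv_norm (e n) u ^ 1
        - (if norm u > e n then real 1 * (1 + 0 \<bullet> u) * inv_norm (e n) u ^ Suc 1 * (sgn u \<bullet> a) else 0))
      \<longlonglongrightarrow> (- 1) * ((sgn u \<bullet> a) / (norm u)\<^sup>2)"
      by (rule tendsto_eventually, rule eventually_mono[OF inv_norm_eventually[OF u]])
        (simp add: e_def power2_eq_square)
  qed measurable
  show ?thesis
    using LIMSEQ_unique[OF L1[unfolded cone_integral_by_parts_truncated[OF F e]] tendsto_diff[OF L2 L3]]
    unfolding cone_integral_scale by simp
qed

lemma inner_sgn_self: "(\<Sum>b\<in>Basis. (b \<bullet> u) * (sgn u \<bullet> b)) = norm (u::'a::euclidean_space)"
proof -
  have "(\<Sum>b\<in>Basis. (b \<bullet> u) * (sgn u \<bullet> b)) = u \<bullet> sgn u"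
    by (subst euclidean_inner[of u "sgn u"]) (simp add: inner_commute)
  also have "\<dots> = norm u"
    by (cases "u = 0") (simp_all add: sgn_div_norm power2_norm_eq_inner[symmetric] power2_eq_square)
  finally show ?thesis .
qed

lemma locally_integrableI_radial:
  assumes "k \<in> borel_measurable borel" "\<And>u. \<bar>k u\<bar> \<le> B / (norm (u::real^3))\<^sup>2"
  shows "locally_integrable k"
  by (rule locally_integrableI_inverse_square[OF assms(1), of 0 B]) (use assms(2) in simp)

lemma locally_integrableI_inverse_norm:
  assumes "k \<in> borel_measurable borel" "\<And>u. \<bar>k u\<bar> \<le> B / norm (u::real^3)"
  shows "locally_integrable k"
proof (rule locally_integrableI_inverse_square[OF assms(1)])
  fix u :: "real^3"
  have "B / norm u \<le> \<bar>B\<bar> * (1 / norm u)" by (simp add: divide_right_mono)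
  also have "\<dots> \<le> \<bar>B\<bar> * (1 + 1 / (norm u)\<^sup>2)" by (intro mult_left_mono inverse_norm_le) simp
  finally show "\<bar>k u\<bar> \<le> \<bar>B\<bar> + \<bar>B\<bar> / (norm u)\<^sup>2" using assms(2)[of u] by (simp add: algebra_simps)
qed

text \<open>Summing integration by parts over the coordinates of the truncated field \<open>u/\<bar>u\<bar>\<^sup>d\<close>: the kernel against \<open>F\<close> is
  its divergence.\<close>

lemma cone_integral_truncated_divergence:
  fixes F :: "spacetime \<Rightarrow> 'b::euclidean_space"
  assumes F: "Ck (Suc m) F" "spatially_bounded F" and e: "e > 0"
  shows "(\<Sum>b\<in>Basis. cone_integral c (\<lambda>u. (b \<bullet> u) * inv_norm e u ^ d) (dir_deriv (b, 0) F) z)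
    = (1 / c) *\<^sub>R cone_integral c (\<lambda>u. norm u * inv_norm e u ^ d) (dir_deriv (0, 1) F) z
    - cone_integral c (\<lambda>u. 3 * inv_norm e u ^ d
        - (if norm u > e then real d * (norm u * inv_norm e u ^ Suc d) else 0)) F z"
proof -
  note contF = Ck_continuous[OF F(1)] and contD = Ck_continuous[OF Ck_dir_deriv[OF F(1)]]
  define k1 where "k1 b u = (b \<bullet> u) * (sgn u \<bullet> b) * inv_norm e u ^ d" for b u :: "real^3"
  define k2 where "k2 b u = inv_norm e u ^ d
      - (if norm u > e then real d * ((b \<bullet> u) * (sgn u \<bullet> b)) * inv_norm e u ^ Suc d else 0)" for b u :: "real^3"
  have l1: "locally_integrable (k1 b)" for b
  proof -
    have "k1 b = (\<lambda>u. (0 + b \<bullet> u) * inv_norm e u ^ d * (sgn u \<bullet> b))"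
      by (rule ext) (simp add: k1_def)
    then show ?thesis
      using locally_integrable_ball_lipschitz[OF ball_lipschitz_truncated_kernel[OF e, where \<alpha>=0 and w=b and d=d]
          _ abs_sgn_inner_le[where a=b]]
      by simp
  qed
  have k2: "k2 b = (\<lambda>u. (b \<bullet> b) * inv_norm e u ^ d
      - (if norm u > e then real d * (0 + b \<bullet> u) * inv_norm e u ^ Suc d * (sgn u \<bullet> b) else 0))"
    if "b \<in> Basis" for b
    using that by (intro ext) (simp add: k2_def)
  have l2: "locally_integrable (k2 b)" if "b \<in> Basis" for b
    unfolding k2[OF that] by (rule locally_integrable_truncated_derivative[OF e])
  have each: "cone_integral c (\<lambda>u. (b \<bullet> u) * inv_norm e u ^ d) (dir_deriv (b, 0) F) z
      = (1 / c) *\<^sub>R cone_integral c (k1 b) (dir_deriv (0, 1) F) z - cone_integral c (k2 b) F z"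
    if b: "b \<in> Basis" for b
  proof -
    have "(\<lambda>u. (0 + b \<bullet> u) * inv_norm e u ^ d) = (\<lambda>u. (b \<bullet> u) * inv_norm e u ^ d)" by simp
    moreover have "(\<lambda>u. (0 + b \<bullet> u) * inv_norm e u ^ d * ((sgn u \<bullet> b) / c)) = (\<lambda>u. (1 / c) * k1 b u)"
      by (rule ext) (simp add: k1_def)
    ultimately show ?thesis
      using cone_integral_by_parts_truncated[OF F e, of c 0 b d b z] by (simp only: cone_integral_scale k2[OF b])
  qed
  have "(\<Sum>b\<in>Basis. cone_integral c (\<lambda>u. (b \<bullet> u) * inv_norm e u ^ d) (dir_deriv (b, 0) F) z)
    = (\<Sum>b\<in>Basis. (1 / c) *\<^sub>R cone_integral c (k1 b) (dir_deriv (0, 1) F) z - cone_integral c (k2 b) F z)"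
    by (rule sum.cong[OF refl each])
  also have "\<dots> = (1 / c) *\<^sub>R cone_integral c (\<lambda>u. \<Sum>b\<in>Basis. k1 b u) (dir_deriv (0, 1) F) z
    - cone_integral c (\<lambda>u. \<Sum>b\<in>Basis. k2 b u) F z"
    by (simp only: sum_subtractf scaleR_sum_right[symmetric]
        cone_integral_sum[OF contD spatially_bounded_dir_deriv[OF F(2)] l1, where I=Basis]
        cone_integral_sum[OF contF F(2) l2, where I=Basis])
  also have "(\<lambda>u. \<Sum>b\<in>Basis. k1 b u) = (\<lambda>u. norm u * inv_norm e u ^ d)"
    unfolding k1_def sum_distrib_right[symmetric] inner_sgn_self ..
  also have "(\<lambda>u. \<Sum>b\<in>Basis. k2 b u) = (\<lambda>u. 3 * inv_norm e u ^ d
        - (if norm u > e then real d * (norm u * inv_norm e u ^ Suc d) else 0))"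
  proof
    fix u :: "real^3"
    show "(\<Sum>b\<in>Basis. k2 b u) = 3 * inv_norm e u ^ d
        - (if norm u > e then real d * (norm u * inv_norm e u ^ Suc d) else 0)"
      unfolding k2_def sum_subtractf
      by (cases "norm u > e")
        (simp_all add: sum_distrib_right[symmetric] sum_distrib_left[symmetric] inner_sgn_self del: power_Suc)
  qed
  finally show ?thesis .
qed

text \<open>For \<open>d \<le> 2\<close> the field \<open>u/\<bar>u\<bar>\<^sup>d\<^sup>+\<^sup>1\<close> is locally integrable, and the truncation can be removed.\<close>

lemma cone_integral_truncated_field_limit:
  fixes F :: "spacetime \<Rightarrow> 'b::euclidean_space"
  assumes F: "continuous_on UNIV F" "spatially_bounded F"
    and d: "\<And>u::real^3. u \<noteq> 0 \<Longrightarrow> (1 / norm u) ^ d \<le> 1 + 1 / (norm u)\<^sup>2"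
  shows "b \<in> Basis \<Longrightarrow> (\<lambda>n. cone_integral c (\<lambda>u. (b \<bullet> u) * inv_norm (1 / real (Suc n)) u ^ Suc d) F z)
      \<longlonglongrightarrow> cone_integral c (\<lambda>u. (sgn u \<bullet> b) / norm u ^ d) F z"
    and "(\<lambda>n. cone_integral c (\<lambda>u. norm u * inv_norm (1 / real (Suc n)) u ^ Suc d) F z)
      \<longlonglongrightarrow> cone_integral c (\<lambda>u. 1 / norm u ^ d) F z"
proof -
  have le: "norm u * inv_norm (1 / real (Suc n)) u ^ Suc d \<le> 1 + 1 / (norm u)\<^sup>2"
    and nonneg: "0 \<le> inv_norm (1 / real (Suc n)) u ^ Suc d" if "u \<noteq> 0" for n and u :: "real^3"
    using inv_norm_power_le[of "1 / real (Suc n)" u d] inv_norm_power_le(1)[of "1 / real (Suc n)" u "Suc d"] d[OF that] that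
    by (simp_all del: power_Suc)
  show "(\<lambda>n. cone_integral c (\<lambda>u. (b \<bullet> u) * inv_norm (1 / real (Suc n)) u ^ Suc d) F z)
      \<longlonglongrightarrow> cone_integral c (\<lambda>u. (sgn u \<bullet> b) / norm u ^ d) F z" if b: "b \<in> Basis"
  proof (rule cone_integral_kernel_limit[OF F])
    fix u :: "real^3" assume u: "u \<noteq> 0"
    show "\<bar>(b \<bullet> u) * inv_norm (1 / real (Suc n)) u ^ Suc d\<bar> \<le> 1 + 1 / (norm u)\<^sup>2" for n
    proof -
      have "\<bar>(b \<bullet> u) * inv_norm (1 / real (Suc n)) u ^ Suc d\<bar> \<le> norm u * inv_norm (1 / real (Suc n)) u ^ Suc d"
        using Cauchy_Schwarz_ineq2[of b u] b nonneg[OF u, of n]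
        by (simp add: abs_mult[of "b \<bullet> u"] mult_right_mono del: power_Suc)
      then show ?thesis using le[OF u, of n] by linarith
    qed
    show "(\<lambda>n. (b \<bullet> u) * inv_norm (1 / real (Suc n)) u ^ Suc d) \<longlonglongrightarrow> (sgn u \<bullet> b) / norm u ^ d"
      by (rule tendsto_eventually, rule eventually_mono[OF inv_norm_eventually[OF u]])
        (simp add: sgn_div_norm inner_commute power_inverse divide_inverse)
  qed measurable
  show "(\<lambda>n. cone_integral c (\<lambda>u. norm u * inv_norm (1 / real (Suc n)) u ^ Suc d) F z)
      \<longlonglongrightarrow> cone_integral c (\<lambda>u. 1 / norm u ^ d) F z"
  proof (rule cone_integral_kernel_limit[OF F])
    fix u :: "real^3" assume u: "u \<noteq> 0"
    show "\<bar>norm u * inv_norm (1 / real (Suc n)) u ^ Suc d\<bar> \<le> 1 + 1 / (norm u)\<^sup>2" for n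
      using le[OF u, of n] nonneg[OF u, of n] by (simp del: power_Suc)
    show "(\<lambda>n. norm u * inv_norm (1 / real (Suc n)) u ^ Suc d) \<longlonglongrightarrow> 1 / norm u ^ d"
      by (rule tendsto_eventually, rule eventually_mono[OF inv_norm_eventually[OF u]])
        (use u in \<open>simp add: power_divide\<close>)
  qed measurable
qed

text \<open>The last term is there because the divergence of \<open>u/\<bar>u\<bar>\<^sup>2\<close> is \<open>3/\<bar>u\<bar>\<^sup>2 - 2/\<bar>u\<bar>\<^sup>2 = 1/\<bar>u\<bar>\<^sup>2\<close>, without a point source: this field
  is of lower order than \<open>u/\<bar>u\<bar>\<^sup>3\<close>.\<close>

lemma cone_integral_divergence_inverse_square:
  fixes G :: "spacetime \<Rightarrow> 'b::euclidean_space"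
  assumes G: "Ck (Suc m) G" "spatially_bounded G"
  shows "(\<Sum>b\<in>Basis. cone_integral c (\<lambda>u. (sgn u \<bullet> b) / norm u) (dir_deriv (b, 0) G) z)
    = (1 / c) *\<^sub>R cone_integral c (\<lambda>u. 1 / norm u) (dir_deriv (0, 1) G) z
    - cone_integral c (\<lambda>u. 1 / (norm u)\<^sup>2) G z"
proof -
  note contG = Ck_continuous[OF G(1)] and contD = Ck_continuous[OF Ck_dir_deriv[OF G(1)]]
  note bd = spatially_bounded_dir_deriv[OF G(2)]
  have e: "1 / real (Suc n) > 0" for n by simp
  have d: "(1 / norm u) ^ 1 \<le> 1 + 1 / (norm u)\<^sup>2" for u :: "real^3"
    using inverse_norm_le[of u] by simp
  note lim = cone_integral_truncated_field_limit[OF contD bd d, simplified power_one_right]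
  have L3: "(\<lambda>n. cone_integral c (\<lambda>u. 3 * inv_norm (1 / real (Suc n)) u ^ Suc 1 - (if norm u > 1 / real (Suc n)
      then real (Suc 1) * (norm u * inv_norm (1 / real (Suc n)) u ^ Suc (Suc 1)) else 0)) G z)
      \<longlonglongrightarrow> cone_integral c (\<lambda>u. 1 / (norm u)\<^sup>2) G z"
  proof (rule cone_integral_kernel_limit[OF contG G(2)])
    fix u :: "real^3" assume u: "u \<noteq> 0"
    show "\<bar>3 * inv_norm (1 / real (Suc n)) u ^ Suc 1 - (if norm u > 1 / real (Suc n)
      then real (Suc 1) * (norm u * inv_norm (1 / real (Suc n)) u ^ Suc (Suc 1)) else 0)\<bar> \<le> 0 + 3 / (norm u)\<^sup>2" for n
    proof -
      define x where "x = inv_norm (1 / real (Suc n)) u"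
      have x: "0 \<le> x ^ 2" "x ^ 2 \<le> 1 / (norm u)\<^sup>2" "norm u * x ^ 3 \<le> 1 / (norm u)\<^sup>2" "0 \<le> norm u * x ^ 3"
        using inv_norm_power_le[OF e[of n] u, of 2] inv_norm_power_le(1)[OF e[of n] u, of 3]
        by (simp_all add: x_def power_divide numeral_3_eq_3 del: power_Suc)
      show ?thesis
        unfolding x_def[symmetric] using x
        by (auto simp: numeral_2_eq_2 numeral_3_eq_3 simp del: power_Suc)
    qed
    show "(\<lambda>n. 3 * inv_norm (1 / real (Suc n)) u ^ Suc 1 - (if norm u > 1 / real (Suc n)
      then real (Suc 1) * (norm u * inv_norm (1 / real (Suc n)) u ^ Suc (Suc 1)) else 0)) \<longlonglongrightarrow> 1 / (norm u)\<^sup>2"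
      by (rule tendsto_eventually, rule eventually_mono[OF inv_norm_eventually[OF u]])
        (use u in \<open>simp add: power2_eq_square\<close>)
  qed measurable
  show ?thesis
  proof (rule LIMSEQ_unique)
    show "(\<lambda>n. \<Sum>b\<in>Basis. cone_integral c (\<lambda>u. (b \<bullet> u) * inv_norm (1 / real (Suc n)) u ^ Suc 1) (dir_deriv (b, 0) G) z)
      \<longlonglongrightarrow> (\<Sum>b\<in>Basis. cone_integral c (\<lambda>u. (sgn u \<bullet> b) / norm u) (dir_deriv (b, 0) G) z)"
      by (intro tendsto_sum lim(1))
    show "(\<lambda>n. \<Sum>b\<in>Basis. cone_integral c (\<lambda>u. (b \<bullet> u) * inv_norm (1 / real (Suc n)) u ^ Suc 1) (dir_deriv (b, 0) G) z)
      \<longlonglongrightarrow> (1 / c) *\<^sub>R cone_integral c (\<lambda>u. 1 / norm u) (dir_deriv (0, 1) G) z - cone_integral c (\<lambda>u. 1 / (norm u)\<^sup>2) G z"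
      unfolding cone_integral_truncated_divergence[OF G e]
      by (intro tendsto_diff tendsto_scaleR tendsto_const lim(2) L3)
  qed
qed

text \<open>The mean of \<open>F\<close> over shrinking balls of the past cone tends to its value at the tip;
  this is where the factor \<open>4\<pi>\<close> enters, through the volume of the ball.\<close>

lemma cone_integral_ball_mean:
  fixes F :: "spacetime \<Rightarrow> 'b::euclidean_space"
  assumes F: "continuous_on UNIV F" "spatially_bounded F"
  shows "(\<lambda>n. cone_integral c (\<lambda>u. 3 * real (Suc n) ^ 3 * indicator (cball 0 (1 / real (Suc n))) u) F z)
      \<longlonglongrightarrow> (4 * pi) *\<^sub>R F z"
proof (rule LIMSEQ_I)
  fix \<epsilon> :: real assume "\<epsilon> > 0"
  (* The kernel has total mass 4 * pi; the spare factor 2 gives the strict inequality. *)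
  define \<delta> where "\<delta> = \<epsilon> / (8 * pi)"
  have \<delta>: "\<delta> > 0" using \<open>\<epsilon> > 0\<close> by (simp add: \<delta>_def)
  have "continuous_on UNIV (\<lambda>u. F (z + past_cone c u))"
    by (intro continuous_on_compose2[OF F(1)] continuous_intros) auto
  then have "isCont (\<lambda>u. F (z + past_cone c u)) 0"
    unfolding continuous_on_eq_continuous_at[OF open_UNIV] by blast
  then obtain r where r: "r > 0" "\<And>u. norm u < r \<Longrightarrow> norm (F (z + past_cone c u) - F z) < \<delta>"
    using \<delta> unfolding continuous_at_eps_delta by (fastforce simp: dist_norm past_cone_def zero_prod_def[symmetric])
  obtain N where N: "inverse (real (Suc N)) < r" using reals_Archimedean[OF r(1)] by blast
  show "\<exists>no. \<forall>n\<ge>no. norm (cone_integral c (\<lambda>u. 3 * real (Suc n) ^ 3 * indicator (cball 0 (1 / real (Suc n))) u) F z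
      - (4 * pi) *\<^sub>R F z) < \<epsilon>"
  proof (intro exI allI impI)
    fix n assume n: "n \<ge> N"
    define k where "k u = 3 * real (Suc n) ^ 3 * indicator (cball (0::real^3) (1 / real (Suc n))) u" for u
    have k_int: "integrable lborel k"
      unfolding k_def using integrable_indicator_cball[of "1 / real (Suc n)" "3 * real (Suc n) ^ 3"]
      by (simp add: mult.commute)
    have k_eq: "(LINT u|lborel. k u) = 4 * pi"
    proof -
      have "(LINT u|lborel. k u) = 3 * real (Suc n) ^ 3 * measure lborel (cball (0::real^3) (1 / real (Suc n)))"
        unfolding k_def by simp
      also have "measure lborel (cball (0::real^3) (1 / real (Suc n))) = 4 / 3 * pi * (1 / real (Suc n)) ^ 3"
        by (simp add: content_cball unit_ball_vol_numeral fact_numeral)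
      finally show ?thesis by (simp add: power_divide)
    qed
    have k_loc: "locally_integrable k"
      unfolding locally_integrable_def
    proof (intro conjI allI)
      show [measurable]: "k \<in> borel_measurable borel" unfolding k_def by measurable
      show "integrable lborel (\<lambda>u. indicator (cball 0 R) u * k u)" for R
        by (rule Bochner_Integration.integrable_bound[OF k_int]) (auto simp: indicator_def)
    qed
    have k0: "k u \<ge> 0" for u by (simp add: k_def)
    have "cone_integral c k F z - (4 * pi) *\<^sub>R F z = (LINT u|lborel. k u *\<^sub>R (F (z + past_cone c u) - F z))"
      unfolding cone_integral_def k_eq[symmetric] scaleR_diff_right
      using integrable_cone[OF F k_loc, of z c] k_int by simp
    also have "norm \<dots> \<le> (LINT u|lborel. k u * \<delta>)"
    proof (rule Bochner_Integration.integral_norm_bound_integral)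
      show "integrable lborel (\<lambda>u. k u *\<^sub>R (F (z + past_cone c u) - F z))"
        unfolding scaleR_diff_right
        using integrable_cone[OF F k_loc, of z c] k_int by (intro Bochner_Integration.integrable_diff) auto
      show "integrable lborel (\<lambda>u. k u * \<delta>)" using k_int by simp
      fix u
      show "norm (k u *\<^sub>R (F (z + past_cone c u) - F z)) \<le> k u * \<delta>"
      proof (cases "norm u \<le> 1 / real (Suc n)")
        case True
        have "1 / real (Suc n) \<le> inverse (real (Suc N))" using n by (simp add: inverse_eq_divide frac_le)
        then have "norm u < r" using True N by linarith
        then show ?thesis using r(2)[of u] k0[of u] by (simp add: mult_left_mono less_imp_le)
      qed (simp add: k_def)
    qed
    also have "\<dots> = 4 * pi * \<delta>" using k_eq by simp
    also have "\<dots> < \<epsilon>" using \<open>\<epsilon> > 0\<close> by (simp add: \<delta>_def)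
    finally show "norm (cone_integral c (\<lambda>u. 3 * real (Suc n) ^ 3 * indicator (cball 0 (1 / real (Suc n))) u) F z
      - (4 * pi) *\<^sub>R F z) < \<epsilon>" unfolding k_def .
  qed
qed

text \<open>Truncated at distance \<open>e\<close>, the field \<open>u/\<bar>u\<bar>\<^sup>3\<close> is \<open>u/e\<^sup>3\<close> inside the ball, with divergence \<open>3/e\<^sup>3\<close>, and it is free of
  divergence outside.  Hence \<open>\<integral> (\<nabla> \<bullet> k) F\<close> is \<open>4\<pi>\<close> times a mean of \<open>F\<close> over the ball.\<close>

lemma cone_integral_divergence_point_source:
  fixes F :: "spacetime \<Rightarrow> 'b::euclidean_space"
  assumes F: "Ck (Suc m) F" "spatially_bounded F"
  shows "(\<Sum>b\<in>Basis. cone_integral c (\<lambda>u. (sgn u \<bullet> b) / (norm u)\<^sup>2) (dir_deriv (b, 0) F) z)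
    = (1 / c) *\<^sub>R cone_integral c (\<lambda>u. 1 / (norm u)\<^sup>2) (dir_deriv (0, 1) F) z - (4 * pi) *\<^sub>R F z"
proof -
  note contF = Ck_continuous[OF F(1)] and contD = Ck_continuous[OF Ck_dir_deriv[OF F(1)]]
  note bd = spatially_bounded_dir_deriv[OF F(2)]
  have e: "1 / real (Suc n) > 0" for n by simp
  have d: "(1 / norm u) ^ 2 \<le> 1 + 1 / (norm u)\<^sup>2" for u :: "real^3"
    by (simp add: power_divide)
  note lim = cone_integral_truncated_field_limit[OF contD bd d]
  have mean: "(\<lambda>u::real^3. 3 * inv_norm (1 / real (Suc n)) u ^ Suc 2 - (if norm u > 1 / real (Suc n)
      then real (Suc 2) * (norm u * inv_norm (1 / real (Suc n)) u ^ Suc (Suc 2)) else 0))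
    = (\<lambda>u. 3 * real (Suc n) ^ 3 * indicator (cball 0 (1 / real (Suc n))) u)" for n
  proof
    fix u :: "real^3"
    show "3 * inv_norm (1 / real (Suc n)) u ^ Suc 2 - (if norm u > 1 / real (Suc n)
      then real (Suc 2) * (norm u * inv_norm (1 / real (Suc n)) u ^ Suc (Suc 2)) else 0)
    = 3 * real (Suc n) ^ 3 * indicator (cball 0 (1 / real (Suc n))) u"
    proof (cases "norm u > 1 / real (Suc n)")
      case True
      then have "norm u > 0" using e[of n] by linarith
      then have "u \<noteq> 0" by simp
      moreover have "inv_norm (1 / real (Suc n)) u = 1 / norm u"
        using True by (simp add: inv_norm_def max_def)
      ultimately show ?thesis using True by (simp add: not_le power_divide numeral_eq_Suc)
    next
      case False
      then have "inv_norm (1 / real (Suc n)) u = real (Suc n)" by (simp add: inv_norm_def max_def)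
      then show ?thesis using False by (simp add: numeral_3_eq_3 numeral_2_eq_2)
    qed
  qed
  show ?thesis
  proof (rule LIMSEQ_unique)
    show "(\<lambda>n. \<Sum>b\<in>Basis. cone_integral c (\<lambda>u. (b \<bullet> u) * inv_norm (1 / real (Suc n)) u ^ Suc 2) (dir_deriv (b, 0) F) z)
      \<longlonglongrightarrow> (\<Sum>b\<in>Basis. cone_integral c (\<lambda>u. (sgn u \<bullet> b) / (norm u)\<^sup>2) (dir_deriv (b, 0) F) z)"
      by (intro tendsto_sum lim(1))
    show "(\<lambda>n. \<Sum>b\<in>Basis. cone_integral c (\<lambda>u. (b \<bullet> u) * inv_norm (1 / real (Suc n)) u ^ Suc 2) (dir_deriv (b, 0) F) z)
      \<longlonglongrightarrow> (1 / c) *\<^sub>R cone_integral c (\<lambda>u. 1 / (norm u)\<^sup>2) (dir_deriv (0, 1) F) z - (4 * pi) *\<^sub>R F z"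
      unfolding cone_integral_truncated_divergence[OF F e] mean
      by (intro tendsto_diff tendsto_scaleR tendsto_const lim(2) cone_integral_ball_mean[OF contF F(2)])
  qed
qed

text \<open>The wave equation: in \<open>\<Delta>\<close> applied under the integral sign, one derivative is moved onto the kernel,
  giving a divergence of \<open>u/\<bar>u\<bar>\<^sup>2\<close> against \<open>\<partial>\<^sub>tF\<close> and one of \<open>u/\<bar>u\<bar>\<^sup>3\<close> against \<open>F\<close>.  The terms in
  \<open>\<partial>\<^sub>tF/\<bar>u\<bar>\<^sup>2\<close> cancel; the point source of \<open>u/\<bar>u\<bar>\<^sup>3\<close> leaves \<open>- 4\<pi>F\<close>.\<close>

lemma cone_integral_wave_equation:
  fixes F :: "spacetime \<Rightarrow> 'b::euclidean_space"
  assumes F: "Ck (Suc (Suc m)) F" "spatially_bounded F"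
  shows "(\<Sum>b\<in>Basis. cone_integral c (\<lambda>u. 1 / norm u) (dir_deriv (b, 0) (dir_deriv (b, 0) F)) z)
    = (1 / c\<^sup>2) *\<^sub>R cone_integral c (\<lambda>u. 1 / norm u) (dir_deriv (0, 1) (dir_deriv (0, 1) F)) z
    - (4 * pi) *\<^sub>R F z"
proof -
  have swap: "dir_deriv (0, 1) (dir_deriv (b, 0) F) = dir_deriv (b, 0) (dir_deriv (0, 1) F)" for b
    by (rule ext) (rule dir_deriv_commute[OF F(1)])
  have "cone_integral c (\<lambda>u. 1 / norm u) (dir_deriv (b, 0) (dir_deriv (b, 0) F)) z
    = (1 / c) *\<^sub>R cone_integral c (\<lambda>u. (sgn u \<bullet> b) / norm u) (dir_deriv (b, 0) (dir_deriv (0, 1) F)) z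
    + cone_integral c (\<lambda>u. (sgn u \<bullet> b) / (norm u)\<^sup>2) (dir_deriv (b, 0) F) z" for b
  proof -
    have "(\<lambda>u. (sgn u \<bullet> b) / (c * norm u)) = (\<lambda>u. (1 / c) * ((sgn u \<bullet> b) / norm u))" by simp
    then show ?thesis
      using cone_integral_inverse_norm_gradient[OF Ck_dir_deriv[OF F(1), of "(b, 0)"]
          spatially_bounded_dir_deriv[OF F(2)], where a=b and c=c and z=z]
      by (simp only: swap cone_integral_scale)
  qed
  then have "(\<Sum>b\<in>Basis. cone_integral c (\<lambda>u. 1 / norm u) (dir_deriv (b, 0) (dir_deriv (b, 0) F)) z)
    = (1 / c) *\<^sub>R (\<Sum>b\<in>Basis. cone_integral c (\<lambda>u. (sgn u \<bullet> b) / norm u) (dir_deriv (b, 0) (dir_deriv (0, 1) F)) z)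
    + (\<Sum>b\<in>Basis. cone_integral c (\<lambda>u. (sgn u \<bullet> b) / (norm u)\<^sup>2) (dir_deriv (b, 0) F) z)"
    by (simp add: sum.distrib scaleR_sum_right)
  then show ?thesis
    unfolding cone_integral_divergence_inverse_square[OF Ck_dir_deriv[OF F(1)] spatially_bounded_dir_deriv[OF F(2)]]
      cone_integral_divergence_point_source[OF F]
    by (simp add: scaleR_diff_right power2_eq_square)
qed


section \<open>Spatial cutoffs\<close>

text \<open>At the kink the difference quotient is itself a lower power of the ramp.\<close>

lemma ramp_power_has_derivative:
  "((\<lambda>x::real. max 0 x ^ Suc (Suc k)) has_real_derivative real (Suc (Suc k)) * max 0 x ^ Suc k) (at x)"
proof -
  consider "x < 0" | "x > 0" | "x = 0" by linarith
  then show ?thesis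
  proof cases
    case 1
    have "((\<lambda>x::real. 0) has_real_derivative 0) (at x)" by simp
    then have "((\<lambda>x::real. max 0 x ^ Suc (Suc k)) has_real_derivative 0) (at x)"
      by (rule has_field_derivative_transform_within_open[where S="{..<0}"]) (use 1 in auto)
    then show ?thesis using 1 by simp
  next
    case 2
    have "((\<lambda>x::real. x ^ Suc (Suc k)) has_real_derivative real (Suc (Suc k)) * x ^ Suc k) (at x)"
      using DERIV_pow[of "Suc (Suc k)" x] by simp
    then have "((\<lambda>x::real. max 0 x ^ Suc (Suc k)) has_real_derivative real (Suc (Suc k)) * x ^ Suc k) (at x)"
      by (rule has_field_derivative_transform_within_open[where S="{0<..}"]) (use 2 in auto)
    then show ?thesis using 2 by simp
  next
    case 3
    have "(\<lambda>h::real. max 0 h ^ Suc k) \<midarrow>0\<rightarrow> max 0 0 ^ Suc k"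
      by (intro tendsto_intros)
    then have "(\<lambda>h::real. max 0 h ^ Suc k) \<midarrow>0\<rightarrow> 0" by simp
    moreover have "(max 0 (0 + h) ^ Suc (Suc k) - max 0 0 ^ Suc (Suc k)) / h = max 0 h ^ Suc k" if "h \<noteq> 0" for h :: real
      using that by (cases "h > 0") (auto simp: max_def)
    ultimately have "(\<lambda>h. (max 0 (0 + h) ^ Suc (Suc k) - max 0 0 ^ Suc (Suc k)) / h) \<midarrow>(0::real)\<rightarrow> 0"
      by (subst LIM_equal[where g="\<lambda>h. max 0 h ^ Suc k"]) auto
    then show ?thesis using 3 unfolding has_field_derivative_def field_has_derivative_at by simp
  qed
qed

lemma Ck_ramp_power: "Ck k (\<lambda>x::real. max 0 x ^ Suc k)"
proof (induction k)
  case 0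
  show ?case by (auto intro!: continuous_intros)
next
  case (Suc k)
  show ?case
  proof (rule Ck_SucI[where f'="\<lambda>x v. v *\<^sub>R (real (Suc (Suc k)) *\<^sub>R max 0 x ^ Suc k)"])
    show "((\<lambda>x. max 0 x ^ Suc (Suc k)) has_derivative (\<lambda>v. v *\<^sub>R (real (Suc (Suc k)) *\<^sub>R max 0 x ^ Suc k))) (at x)"
      for x :: real
      by (rule has_derivative_eq_rhs[OF ramp_power_has_derivative[of k x, unfolded has_field_derivative_def]])
        (rule ext, simp only: real_scaleR_def mult_ac)
    show "Ck k (\<lambda>x::real. v *\<^sub>R (real (Suc (Suc k)) *\<^sub>R max 0 x ^ Suc k))" for v :: real
      by (rule Ck_scaleR[OF Ck_const Ck_scaleR[OF Ck_const Suc]])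
  qed
qed

lemma Ck_compose_linear:
  assumes L: "bounded_linear L"
  shows "Ck k f \<Longrightarrow> Ck k (\<lambda>x. f (L x))"
proof (induction k arbitrary: f)
  case 0
  then show ?case by (auto intro: continuous_on_compose2 linear_continuous_on[OF L])
next
  case (Suc k)
  show ?case
  proof (rule Ck_SucI[where f'="\<lambda>x v. dir_deriv (L v) f (L x)"])
    show "((\<lambda>x. f (L x)) has_derivative (\<lambda>v. dir_deriv (L v) f (L x))) (at x)" for x
      by (rule has_derivative_compose[OF bounded_linear_imp_has_derivative[OF L] Ck_has_derivative[OF Suc.prems]])
    show "Ck k (\<lambda>x. dir_deriv (L v) f (L x))" for v
      by (rule Suc.IH[OF Ck_dir_deriv[OF Suc.prems]])
  qed
qed

lemma dir_deriv_compose_linear: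
  assumes "bounded_linear L" "Ck (Suc k) f"
  shows "dir_deriv v (\<lambda>x. f (L x)) x = dir_deriv (L v) f (L x)"
  by (rule dir_deriv_eq[OF has_derivative_compose[OF bounded_linear_imp_has_derivative[OF assms(1)]
          Ck_has_derivative[OF assms(2)]]])

text \<open>A cubed ramp is \<open>C\<^sup>2\<close>, which is all the smoothness that the cutoffs need.  Composing two of them gives a
  function that is \<open>1\<close> on the unit ball and \<open>0\<close> where \<open>x \<bullet> x \<ge> 2\<close>.\<close>

definition bump :: "real^3 \<Rightarrow> real" where
  "bump x = max 0 (1 - max 0 (x \<bullet> x - 1) ^ 3) ^ 3"

lemma Ck_bump: "Ck 2 bump"
proof -
  have ramp: "Ck 2 (\<lambda>x::real. max 0 x ^ 3)"
    using Ck_ramp_power[of 2] by (simp add: numeral_eq_Suc)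
  have "Ck 2 (\<lambda>x::real^3. x \<bullet> x - 1)"
    by (intro Ck_diff Ck_const bounded_bilinear.Ck_bilinear[OF bounded_bilinear_inner]
        Ck_bounded_linear bounded_linear_ident)
  then have "Ck 2 (\<lambda>x::real^3. max 0 (x \<bullet> x - 1) ^ 3)"
    by (rule Ck_compose_real[OF ramp])
  then have "Ck 2 (\<lambda>x::real^3. 1 - max 0 (x \<bullet> x - 1) ^ 3)"
    by (intro Ck_diff Ck_const)
  then show ?thesis
    unfolding bump_def[abs_def] by (rule Ck_compose_real[OF ramp])
qed

lemma bump_bounds: "0 \<le> bump x" "bump x \<le> 1"
  unfolding bump_def by (auto intro!: power_le_one)

lemma bump_eq_1: "norm x \<le> 1 \<Longrightarrow> bump x = 1"
  using power_le_one[of "norm x" 2] by (simp add: bump_def power2_norm_eq_inner)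

lemma bump_eq_0: "norm x \<ge> 2 \<Longrightarrow> bump x = 0"
proof -
  assume "norm x \<ge> 2"
  then have "x \<bullet> x \<ge> 2\<^sup>2" unfolding power2_norm_eq_inner[symmetric] by (intro power_mono) auto
  then have "1 \<le> max 0 (x \<bullet> x - 1) ^ 3" by (intro one_le_power) auto
  then show ?thesis by (simp add: bump_def)
qed

lemma bump_derivative_bounded:
  obtains C where "C > 0" "\<And>x v. norm (dir_deriv v bump x) \<le> C * norm v"
proof -
  have C1: "Ck (Suc 1) bump" using Ck_bump by (simp add: numeral_2_eq_2)
  obtain C where C: "C > 0" "\<And>x v. x \<in> cball 0 2 \<Longrightarrow> norm (dir_deriv v bump x) \<le> C * norm v"
    using Ck_derivative_bounded_on_compact[OF C1 compact_cball] by metis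
  have "dir_deriv v bump x = 0" if "norm x > 2" for x v
  proof (rule dir_deriv_zero_on_open[of "{x. norm x > 2}"])
    show "open {x::real^3. norm x > 2}" by (intro open_Collect_less continuous_intros)
  qed (use that in \<open>auto intro: bump_eq_0\<close>)
  then have "norm (dir_deriv v bump x) \<le> C * norm v" for x v
    using C(1) C(2)[of x v] by (cases "norm x \<le> 2") auto
  with C(1) show thesis by (rule that)
qed

text \<open>Dilation keeps the first derivatives bounded uniformly in \<open>n\<close>, as the Lorenz condition requires.\<close>

definition cutoff :: "nat \<Rightarrow> spacetime \<Rightarrow> real" where
  "cutoff n z = bump ((1 / real (Suc n)) *\<^sub>R fst z)"

lemma bounded_linear_scaled_fst: "bounded_linear (\<lambda>z. r *\<^sub>R fst z)"
  by (rule bounded_linear_compose[OF bounded_linear_scaleR_right bounded_linear_fst])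

lemma Ck_cutoff: "Ck 2 (cutoff n)"
  unfolding cutoff_def[abs_def] by (rule Ck_compose_linear[OF bounded_linear_scaled_fst Ck_bump])

lemma cutoff_bounds: "0 \<le> cutoff n z" "cutoff n z \<le> 1"
  unfolding cutoff_def by (rule bump_bounds)+

lemma cutoff_eq_1: "norm (fst z) \<le> real (Suc n) \<Longrightarrow> cutoff n z = 1"
  unfolding cutoff_def by (rule bump_eq_1) simp

lemma cutoff_eq_0: "norm (fst z) \<ge> 2 * real (Suc n) \<Longrightarrow> cutoff n z = 0"
  unfolding cutoff_def by (rule bump_eq_0) (simp add: field_simps)

lemma dir_deriv_cutoff:
  "dir_deriv v (cutoff n) z = dir_deriv ((1 / real (Suc n)) *\<^sub>R fst v) bump ((1 / real (Suc n)) *\<^sub>R fst z)"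
  unfolding cutoff_def[abs_def]
  by (rule dir_deriv_compose_linear[OF bounded_linear_scaled_fst, of 1]) (use Ck_bump in \<open>simp add: numeral_2_eq_2\<close>)

lemma dir_deriv_cutoff_time: "dir_deriv (0, 1) (cutoff n) z = 0"
proof -
  have "Ck (Suc 1) bump" using Ck_bump by (simp add: numeral_2_eq_2)
  from linear_0[OF linear_dir_deriv[OF this]] show ?thesis by (simp add: dir_deriv_cutoff)
qed

lemma cutoff_derivative_bounded:
  obtains C where "C > 0" "\<And>n z v. norm (dir_deriv v (cutoff n) z) \<le> C * norm v"
proof -
  obtain C where C: "C > 0" "\<And>x v. norm (dir_deriv v bump x) \<le> C * norm v"
    using bump_derivative_bounded by metis
  have "norm (dir_deriv v (cutoff n) z) \<le> C * norm v" for n v z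
  proof -
    have "norm (dir_deriv v (cutoff n) z) \<le> C * norm ((1 / real (Suc n)) *\<^sub>R fst v)"
      unfolding dir_deriv_cutoff by (rule C(2))
    also have "norm ((1 / real (Suc n)) *\<^sub>R fst v) \<le> norm (fst v)"
      by (simp add: divide_le_eq distrib_left)
    also have "norm (fst v) \<le> norm v" using norm_fst_le[of "fst v" "snd v"] by simp
    finally show ?thesis using C(1) by simp
  qed
  with C(1) show thesis by (rule that)
qed

lemma spatially_bounded_cutoff: "spatially_bounded (\<lambda>z. cutoff n z *\<^sub>R f z)"
  unfolding spatially_bounded_def
  by (rule exI[of _ "2 * real (Suc n)"]) (auto simp: cutoff_eq_0)

section \<open>Tails of retarded integrals\<close>

definition cone_tail ::
    "real \<Rightarrow> (spacetime \<Rightarrow> 'b::real_normed_vector) \<Rightarrow> real \<Rightarrow> spacetime \<Rightarrow> ennreal" where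
  "cone_tail c f \<rho> z = (\<integral>\<^sup>+u. indicator {u. norm (fst z + u) > \<rho>} u
      * ennreal (norm (f (z + past_cone c u)) / norm u) \<partial>lborel)"

definition uniform_tails :: "real \<Rightarrow> (spacetime \<Rightarrow> 'b::real_normed_vector) \<Rightarrow> bool" where
  "uniform_tails c f \<longleftrightarrow> (\<forall>N e. e > 0 \<longrightarrow> (\<exists>\<rho>. \<forall>z\<in>cball 0 N. cone_tail c f \<rho> z \<le> ennreal e))"

lemma cone_tail_antimono: "\<rho> \<le> \<rho>' \<Longrightarrow> cone_tail c f \<rho>' z \<le> cone_tail c f \<rho> z"
  unfolding cone_tail_def by (intro nn_integral_mono) (auto simp: indicator_def)

lemma uniform_tailsE:
  assumes "uniform_tails c f" "e > 0"
  obtains \<rho> where "\<And>\<rho>' z. \<rho> \<le> \<rho>' \<Longrightarrow> z \<in> cball 0 N \<Longrightarrow> cone_tail c f \<rho>' z \<le> ennreal e"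
  using assms cone_tail_antimono unfolding uniform_tails_def by (meson order_trans)

text \<open>A source that vanishes within distance \<open>\<rho>\<close> of the origin is seen from \<open>z\<close> only at distances \<open>\<bar>u\<bar> \<ge> 1\<close>, where
  the kernel is at most \<open>K/\<bar>u\<bar>\<close>.\<close>

lemma far_nn_integral_le:
  fixes f :: "spacetime \<Rightarrow> 'c::euclidean_space" and G :: "spacetime \<Rightarrow> 'b::euclidean_space"
  assumes f: "continuous_on UNIV f"
    and G: "\<And>y. norm (G y) \<le> norm (f y)" "\<And>y. norm (fst y) \<le> \<rho> \<Longrightarrow> G y = 0"
    and k: "\<And>u. norm u \<ge> 1 \<Longrightarrow> \<bar>k u\<bar> \<le> K / norm u" and K: "K \<ge> 0"
    and z: "norm (fst z) + 1 \<le> \<rho>" and tail: "cone_tail c f \<rho> z \<le> ennreal e" and e: "e \<ge> 0"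
  shows "(\<integral>\<^sup>+u. ennreal (norm (k u *\<^sub>R G (z + past_cone c u))) \<partial>lborel) \<le> ennreal (K * e)"
proof -
  have "(\<integral>\<^sup>+u. ennreal (norm (k u *\<^sub>R G (z + past_cone c u))) \<partial>lborel)
    \<le> (\<integral>\<^sup>+u. ennreal K * (indicator {u. norm (fst z + u) > \<rho>} u
        * ennreal (norm (f (z + past_cone c u)) / norm u)) \<partial>lborel)"
  proof (rule nn_integral_mono)
    fix u
    show "ennreal (norm (k u *\<^sub>R G (z + past_cone c u))) \<le> ennreal K * (indicator {u. norm (fst z + u) > \<rho>} u
        * ennreal (norm (f (z + past_cone c u)) / norm u))"
    proof (cases "norm (fst z + u) > \<rho>")
      case False
      then have "G (z + past_cone c u) = 0" by (intro G(2)) (simp add: past_cone_def)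
      then show ?thesis by simp
    next
      case True
      then have "norm u \<ge> 1" using z norm_triangle_ineq[of "fst z" u] by linarith
      then have "\<bar>k u\<bar> * norm (G (z + past_cone c u)) \<le> (K / norm u) * norm (f (z + past_cone c u))"
        using K by (intro mult_mono k G(1)) auto
      then show ?thesis using True K by (simp add: ennreal_mult[symmetric] ennreal_leI)
    qed
  qed
  also have "\<dots> = ennreal K * cone_tail c f \<rho> z"
    unfolding cone_tail_def
  proof (rule nn_integral_cmult)
    have "open {u. norm (fst z + u) > \<rho>}" by (intro open_Collect_less continuous_intros)
    then have [measurable]: "{u. norm (fst z + u) > \<rho>} \<in> sets borel" by simp
    have [measurable]: "(\<lambda>u. f (z + past_cone c u)) \<in> borel_measurable borel"
      by (rule borel_measurable_on_cone[OF f])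
    show "(\<lambda>u. indicator {u. norm (fst z + u) > \<rho>} u * ennreal (norm (f (z + past_cone c u)) / norm u))
        \<in> borel_measurable lborel"
      by measurable
  qed
  also have "\<dots> \<le> ennreal K * ennreal e" by (intro mult_left_mono tail) simp
  also have "\<dots> = ennreal (K * e)" using K e by (simp add: ennreal_mult)
  finally show ?thesis .
qed

lemma far_cone_integral_bound:
  fixes f :: "spacetime \<Rightarrow> 'c::euclidean_space" and G :: "spacetime \<Rightarrow> 'b::euclidean_space"
  assumes f: "continuous_on UNIV f" and contG: "continuous_on UNIV G" "spatially_bounded G"
    and G: "\<And>y. norm (G y) \<le> norm (f y)" "\<And>y. norm (fst y) \<le> \<rho> \<Longrightarrow> G y = 0"
    and k: "locally_integrable k" "\<And>u. norm u \<ge> 1 \<Longrightarrow> \<bar>k u\<bar> \<le> K / norm u" and K: "K \<ge> 0"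
    and z: "norm (fst z) + 1 \<le> \<rho>" and tail: "cone_tail c f \<rho> z \<le> ennreal e" and e: "e \<ge> 0"
  shows "norm (cone_integral c k G z) \<le> K * e"
proof -
  have "ennreal (norm (cone_integral c k G z)) \<le> (\<integral>\<^sup>+u. ennreal (norm (k u *\<^sub>R G (z + past_cone c u))) \<partial>lborel)"
    unfolding cone_integral_def by (rule integral_norm_bound_ennreal[OF integrable_cone[OF contG k(1)]])
  also have "\<dots> \<le> ennreal (K * e)"
    by (rule far_nn_integral_le[OF f G k(2) K z tail e])
  finally show ?thesis using K e by (simp add: ennreal_le_iff)
qed

text \<open>The part of \<open>f\<close> near the origin has bounded support; the rest is controlled by the tail.\<close>

lemma integrable_cone_tails:
  fixes f :: "spacetime \<Rightarrow> 'b::euclidean_space"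
  assumes f: "continuous_on UNIV f" and tails: "uniform_tails c f"
    and k: "locally_integrable k" "\<And>u. norm u \<ge> 1 \<Longrightarrow> \<bar>k u\<bar> \<le> K / norm u" and K: "K \<ge> 0"
  shows "integrable lborel (\<lambda>u. k u *\<^sub>R f (z + past_cone c u))"
proof -
  obtain \<rho> where \<rho>: "\<And>\<rho>' y. \<rho> \<le> \<rho>' \<Longrightarrow> y \<in> cball 0 (norm z) \<Longrightarrow> cone_tail c f \<rho>' y \<le> ennreal 1"
    using uniform_tailsE[OF tails, of 1 "norm z"] by auto
  define n where "n = nat \<lceil>max \<rho> (norm (fst z) + 1)\<rceil>"
  have n: "real (Suc n) \<ge> \<rho>" "norm (fst z) + 1 \<le> real (Suc n)"
    unfolding n_def by linarith+
  define G where "G y = (1 - cutoff n y) *\<^sub>R f y" for y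
  have c: "continuous_on UNIV (cutoff n)" by (rule Ck_continuous[OF Ck_cutoff])
  have near: "integrable lborel (\<lambda>u. k u *\<^sub>R (cutoff n (z + past_cone c u) *\<^sub>R f (z + past_cone c u)))"
    by (rule integrable_cone[where F="\<lambda>z. cutoff n z *\<^sub>R f z"])
      (intro continuous_on_scaleR c f spatially_bounded_cutoff k(1))+
  have contG: "continuous_on UNIV G"
    unfolding G_def by (intro continuous_on_scaleR continuous_on_diff continuous_on_const c f)
  have far: "integrable lborel (\<lambda>u. k u *\<^sub>R G (z + past_cone c u))"
  proof (rule integrableI_bounded)
    show "(\<lambda>u. k u *\<^sub>R G (z + past_cone c u)) \<in> borel_measurable lborel"
      by (rule borel_measurable_cone_integrand[OF contG locally_integrable_measurable[OF k(1)]])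
    have "(\<integral>\<^sup>+u. ennreal (norm (k u *\<^sub>R G (z + past_cone c u))) \<partial>lborel) \<le> ennreal (K * 1)"
    proof (rule far_nn_integral_le[OF f _ _ k(2) K n(2) \<rho>[OF n(1)]])
      show "norm (G y) \<le> norm (f y)" for y
        using cutoff_bounds[of n y] by (simp add: G_def mult_left_le_one_le)
      show "G y = 0" if "norm (fst y) \<le> real (Suc n)" for y
        using cutoff_eq_1[OF that] by (simp add: G_def)
    qed auto
    then show "(\<integral>\<^sup>+u. ennreal (norm (k u *\<^sub>R G (z + past_cone c u))) \<partial>lborel) < \<infinity>"
      by (rule order_le_less_trans) simp
  qed
  have "(\<lambda>u. k u *\<^sub>R f (z + past_cone c u))
    = (\<lambda>u. k u *\<^sub>R (cutoff n (z + past_cone c u) *\<^sub>R f (z + past_cone c u)) + k u *\<^sub>R G (z + past_cone c u))"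
    by (rule ext) (simp add: G_def scaleR_add_right[symmetric] scaleR_add_left[symmetric] del: scaleR_scaleR)
  then show ?thesis using Bochner_Integration.integrable_add[OF near far] by simp
qed

lemma cone_integral_cutoff_limit:
  fixes f :: "spacetime \<Rightarrow> 'b::euclidean_space"
  assumes f: "continuous_on UNIV f" and tails: "uniform_tails c f"
    and k: "locally_integrable k" "\<And>u. norm u \<ge> 1 \<Longrightarrow> \<bar>k u\<bar> \<le> K / norm u" and K: "K \<ge> 0"
  shows "(\<lambda>n. cone_integral c k (\<lambda>z. cutoff n z *\<^sub>R f z) z) \<longlonglongrightarrow> cone_integral c k f z"
  unfolding cone_integral_def
proof (rule integral_dominated_convergence)
  note int = integrable_cone_tails[OF f tails k K, of z]
  show "integrable lborel (\<lambda>u. norm (k u *\<^sub>R f (z + past_cone c u)))"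
    by (rule integrable_norm[OF int])
  show "(\<lambda>u. k u *\<^sub>R f (z + past_cone c u)) \<in> borel_measurable lborel"
    using int by (rule borel_measurable_integrable)
  show "(\<lambda>u. k u *\<^sub>R (cutoff n (z + past_cone c u) *\<^sub>R f (z + past_cone c u))) \<in> borel_measurable lborel" for n
    by (rule borel_measurable_cone_integrand[where F="\<lambda>z. cutoff n z *\<^sub>R f z"])
      (intro continuous_on_scaleR Ck_continuous[OF Ck_cutoff] f locally_integrable_measurable k(1))+
  show "AE u in lborel. norm (k u *\<^sub>R (cutoff n (z + past_cone c u) *\<^sub>R f (z + past_cone c u)))
      \<le> norm (k u *\<^sub>R f (z + past_cone c u))" for n
  proof (rule AE_I2)
    fix u
    have "norm (cutoff n y *\<^sub>R f y) \<le> norm (f y)" for y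
      using cutoff_bounds[of n y] by (simp add: mult_left_le_one_le)
    then show "norm (k u *\<^sub>R (cutoff n (z + past_cone c u) *\<^sub>R f (z + past_cone c u)))
      \<le> norm (k u *\<^sub>R f (z + past_cone c u))"
      unfolding norm_scaleR[of "k u"] by (intro mult_left_mono) auto
  qed
  show "AE u in lborel. (\<lambda>n. k u *\<^sub>R (cutoff n (z + past_cone c u) *\<^sub>R f (z + past_cone c u)))
      \<longlonglongrightarrow> k u *\<^sub>R f (z + past_cone c u)"
  proof (rule AE_I2)
    fix u
    have "\<forall>\<^sub>F n in sequentially. norm (fst (z + past_cone c u)) \<le> real (Suc n)"
      using eventually_ge_at_top[of "nat \<lceil>norm (fst (z + past_cone c u))\<rceil>"]
      by eventually_elim linarith
    then show "(\<lambda>n. k u *\<^sub>R (cutoff n (z + past_cone c u) *\<^sub>R f (z + past_cone c u)))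
      \<longlonglongrightarrow> k u *\<^sub>R f (z + past_cone c u)"
      by (intro tendsto_eventually) (erule eventually_mono, simp only: cutoff_eq_1 scaleR_one)
  qed
qed

section \<open>Derivatives of far sources\<close>

text \<open>The difference of two cut off sources.  It vanishes in a large ball, so from an event inside that ball
  the kernels are evaluated away from their singularity.\<close>

definition far_part :: "nat \<Rightarrow> nat \<Rightarrow> (spacetime \<Rightarrow> 'b::real_normed_vector) \<Rightarrow> spacetime \<Rightarrow> 'b" where
  "far_part m n f z = (cutoff m z - cutoff n z) *\<^sub>R f z"

lemma Ck_far_part: "Ck j f \<Longrightarrow> j \<le> 2 \<Longrightarrow> Ck j (far_part m n f)"
  unfolding far_part_def[abs_def]
  by (intro Ck_scaleR Ck_diff Ck_mono[OF Ck_cutoff])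

lemma spatially_bounded_far_part: "spatially_bounded (far_part m n f)"
  unfolding spatially_bounded_def
  by (rule exI[of _ "2 * real (Suc (max m n))"]) (auto simp: far_part_def cutoff_eq_0)

lemma far_part_norm_le: "norm (far_part m n f z) \<le> norm (f z)"
  using cutoff_bounds[of m z] cutoff_bounds[of n z]
  by (auto simp: far_part_def intro!: mult_left_le_one_le)

lemma far_part_near: "norm (fst z) \<le> \<rho> + 1 \<Longrightarrow> \<rho> \<le> real m \<Longrightarrow> \<rho> \<le> real n \<Longrightarrow> far_part m n f z = 0"
  by (simp add: far_part_def cutoff_eq_1)

lemma dir_deriv_scaleR:
  fixes f :: "'a::real_normed_vector \<Rightarrow> 'b::real_normed_vector" and h :: "'a \<Rightarrow> real"
  assumes "Ck (Suc i) h" "Ck (Suc j) f"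
  shows "dir_deriv v (\<lambda>z. h z *\<^sub>R f z) z = h z *\<^sub>R dir_deriv v f z + dir_deriv v h z *\<^sub>R f z"
  by (rule dir_deriv_eq) (rule has_derivative_scaleR[OF Ck_has_derivative[OF assms(1)] Ck_has_derivative[OF assms(2)]])

lemma dir_deriv_diff:
  assumes "Ck (Suc i) f" "Ck (Suc j) g"
  shows "dir_deriv v (\<lambda>z. f z - g z) z = dir_deriv v f z - dir_deriv v g z"
  by (rule dir_deriv_eq) (rule has_derivative_diff[OF Ck_has_derivative[OF assms(1)] Ck_has_derivative[OF assms(2)]])

lemma Ck_cutoff1: "Ck (Suc 0) (cutoff n)"
  by (rule Ck_mono[OF Ck_cutoff]) simp

lemma dir_deriv_far_part_time:
  assumes "Ck (Suc j) f"
  shows "dir_deriv (0, 1) (far_part m n f) = far_part m n (dir_deriv (0, 1) f)"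
proof
  fix z
  show "dir_deriv (0, 1) (far_part m n f) z = far_part m n (dir_deriv (0, 1) f) z"
    unfolding far_part_def[abs_def]
    by (subst dir_deriv_scaleR[OF Ck_diff[OF Ck_cutoff1 Ck_cutoff1] assms])
      (simp add: dir_deriv_diff[OF Ck_cutoff1 Ck_cutoff1] dir_deriv_cutoff_time)
qed

lemma dir_deriv_cutoff_scaleR_time:
  assumes "Ck (Suc j) f"
  shows "dir_deriv (0, 1) (\<lambda>z. cutoff n z *\<^sub>R f z) = (\<lambda>z. cutoff n z *\<^sub>R dir_deriv (0, 1) f z)"
  by (rule ext) (simp add: dir_deriv_scaleR[OF Ck_cutoff1 assms] dir_deriv_cutoff_time)

text \<open>The margin \<open>1\<close> between \<open>\<bar>r\<bar>\<close> and \<open>\<rho>\<close> keeps the far source at distance at least \<open>1\<close> from the event.\<close>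

definition tail_bound ::
    "real \<Rightarrow> (spacetime \<Rightarrow> 'b::euclidean_space) \<Rightarrow> real \<Rightarrow> real \<Rightarrow> spacetime \<Rightarrow> bool" where
  "tail_bound c f \<rho> e z \<longleftrightarrow> norm (fst z) + 1 \<le> \<rho> \<and> 0 \<le> e \<and> cone_tail c f \<rho> z \<le> ennreal e"

lemma far_part_integral_bound:
  assumes f: "Ck j f" "j \<le> 2" and tb: "tail_bound c f \<rho> e z" and mn: "\<rho> \<le> real m" "\<rho> \<le> real n"
    and k: "locally_integrable k" "\<And>u. norm u \<ge> 1 \<Longrightarrow> \<bar>k u\<bar> \<le> K / norm u" and K: "K \<ge> 0"
  shows "norm (cone_integral c k (far_part m n f) z) \<le> K * e"
proof (rule far_cone_integral_bound[OF Ck_continuous[OF f(1)] Ck_continuous[OF Ck_far_part[OF f]]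
      spatially_bounded_far_part far_part_norm_le _ k K])
  show "far_part m n f y = 0" if "norm (fst y) \<le> \<rho>" for y
    by (rule far_part_near[OF _ mn]) (use that in simp)
qed (use tb in \<open>auto simp: tail_bound_def\<close>)

lemma locally_integrable_inverse_norm: "locally_integrable (\<lambda>u::real^3. 1 / norm u)"
  by (rule locally_integrableI_inverse_norm[where B=1]) auto

lemma locally_integrable_sgn_inverse_norm: "locally_integrable (\<lambda>u::real^3. (sgn u \<bullet> a) / (c * norm u))"
proof (rule locally_integrableI_inverse_norm)
  show "\<bar>(sgn u \<bullet> a) / (c * norm u)\<bar> \<le> (norm a / \<bar>c\<bar>) / norm u" for u
    using abs_sgn_inner_le[of u a] by (simp add: abs_mult divide_right_mono)
qed measurable

lemma locally_integrable_sgn_inverse_square: "locally_integrable (\<lambda>u::real^3. (sgn u \<bullet> a) / (norm u)\<^sup>2)"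
proof (rule locally_integrableI_radial)
  show "\<bar>(sgn u \<bullet> a) / (norm u)\<^sup>2\<bar> \<le> norm a / (norm u)\<^sup>2" for u
    using abs_sgn_inner_le[of u a] by (simp add: abs_mult divide_right_mono)
qed measurable

lemma sgn_inverse_norm_far: "\<bar>(sgn u \<bullet> a) / (c * norm u)\<bar> \<le> (norm a / \<bar>c\<bar>) / norm u"
  using abs_sgn_inner_le[of u a] by (simp add: abs_mult divide_right_mono)

lemma sgn_inverse_square_far:
  assumes "norm u \<ge> 1" shows "\<bar>(sgn u \<bullet> a) / (norm u)\<^sup>2\<bar> \<le> norm a / norm u"
proof -
  have "\<bar>(sgn u \<bullet> a) / (norm u)\<^sup>2\<bar> = \<bar>sgn u \<bullet> a\<bar> / (norm u)\<^sup>2" by (simp add: abs_mult)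
  also have "\<dots> \<le> norm a / norm u"
    using assms abs_sgn_inner_le[of u a] self_le_power[of "norm u" 2] by (intro frac_le) auto
  finally show ?thesis .
qed

text \<open>The tails control \<open>f\<close> and its time derivatives but not its spatial derivatives; these have to be moved
  onto the kernel.\<close>

lemma far_gradient_bound:
  assumes f: "Ck (Suc j) f" "j \<le> 1"
    and tb: "tail_bound c f \<rho> e z" "tail_bound c (dir_deriv (0, 1) f) \<rho> e z"
    and mn: "\<rho> \<le> real m" "\<rho> \<le> real n"
  shows "norm (cone_integral c (\<lambda>u. 1 / norm u) (dir_deriv (a, 0) (far_part m n f)) z)
    \<le> norm a * (1 / \<bar>c\<bar> + 1) * e"
proof -
  have F: "Ck (Suc j) (far_part m n f)" by (rule Ck_far_part[OF f(1)]) (use f(2) in simp)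
  have "norm (cone_integral c (\<lambda>u. (sgn u \<bullet> a) / (c * norm u)) (far_part m n (dir_deriv (0, 1) f)) z) \<le> (norm a / \<bar>c\<bar>) * e"
    by (rule far_part_integral_bound[OF Ck_dir_deriv[OF f(1)] _ tb(2) mn locally_integrable_sgn_inverse_norm sgn_inverse_norm_far])
      (use f(2) in auto)
  moreover have "norm (cone_integral c (\<lambda>u. (sgn u \<bullet> a) / (norm u)\<^sup>2) (far_part m n f) z) \<le> norm a * e"
    by (rule far_part_integral_bound[OF f(1) _ tb(1) mn locally_integrable_sgn_inverse_square sgn_inverse_square_far])
      (use f(2) in auto)
  ultimately show ?thesis
    unfolding cone_integral_inverse_norm_gradient[OF F spatially_bounded_far_part] dir_deriv_far_part_time[OF f(1)]
    by (intro order_trans[OF norm_triangle_ineq]) (simp add: algebra_simps)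
qed

lemma dir_deriv_far_part_near:
  assumes "norm (fst y) \<le> \<rho>" "\<rho> \<le> real m" "\<rho> \<le> real n"
  shows "dir_deriv v (far_part m n f) y = 0"
  by (rule dir_deriv_zero_on_open[OF open_norm_fst_less[of "\<rho> + 1"]])
    (use assms in \<open>auto intro!: far_part_near[of _ \<rho>]\<close>)

lemma cone_integral_cong_far:
  assumes "\<And>u. norm u \<ge> 1 \<Longrightarrow> k u = k' u" "\<And>y. norm (fst y) \<le> \<rho> \<Longrightarrow> G y = 0" "norm (fst z) + 1 \<le> \<rho>"
  shows "cone_integral c k G z = cone_integral c k' G z"
  unfolding cone_integral_def
proof (rule Bochner_Integration.integral_cong)
  fix u
  show "k u *\<^sub>R G (z + past_cone c u) = k' u *\<^sub>R G (z + past_cone c u)"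
  proof (cases "norm u \<ge> 1")
    case False
    then have "norm (fst z + u) \<le> \<rho>" using assms(3) norm_triangle_ineq[of "fst z" u] by linarith
    then have "G (z + past_cone c u) = 0" by (intro assms(2)) (simp add: past_cone_def)
    then show ?thesis by simp
  qed (simp add: assms(1))
qed simp

text \<open>Both kernels that integration by parts produces decay at least like \<open>1/\<bar>u\<bar>\<close>, so that tails bound them.\<close>

lemma truncated_kernel_bounds:
  fixes u :: "real^3"
  assumes d: "d \<ge> 2"
  shows "\<bar>(0 + b \<bullet> u) * inv_norm 1 u ^ d * ((sgn u \<bullet> a) / c)\<bar> \<le> norm a * norm b / \<bar>c\<bar> * inv_norm 1 u"
    and "\<bar>(b \<bullet> a) * inv_norm 1 u ^ d
        - (if norm u > 1 then real d * (0 + b \<bullet> u) * inv_norm 1 u ^ Suc d * (sgn u \<bullet> a) else 0)\<bar>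
      \<le> norm a * norm b * (1 + real d) * inv_norm 1 u"
proof -
  define x where "x = inv_norm 1 u"
  have x: "0 \<le> x" "x \<le> 1" "norm u * x \<le> 1"
    using inv_norm_pos[of 1 u] inv_norm_le[of 1 u] norm_mult_inv_norm_le[of 1 u] by (auto simp: x_def)
  obtain j where j: "d = Suc (Suc j)" using d by (metis add_2_eq_Suc le_Suc_ex)
  have pow: "x ^ Suc i \<le> x" for i using x by (simp add: mult_left_le power_le_one)
  have lin: "\<bar>b \<bullet> u\<bar> * x ^ Suc i \<le> norm b * x ^ i" for i
  proof -
    have "\<bar>b \<bullet> u\<bar> * x ^ Suc i \<le> (norm b * norm u) * x ^ Suc i"
      using x by (intro mult_right_mono Cauchy_Schwarz_ineq2) simp
    also have "\<dots> = norm b * ((norm u * x) * x ^ i)" by simp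
    also have "\<dots> \<le> norm b * (1 * x ^ i)" using x by (intro mult_left_mono mult_right_mono) auto
    finally show ?thesis by simp
  qed
  have "\<bar>(0 + b \<bullet> u) * x ^ d * ((sgn u \<bullet> a) / c)\<bar> = (\<bar>b \<bullet> u\<bar> * x ^ d) * (\<bar>sgn u \<bullet> a\<bar> / \<bar>c\<bar>)"
    using x by (simp add: abs_mult)
  also have "\<dots> \<le> (norm b * x) * (norm a / \<bar>c\<bar>)"
  proof (rule mult_mono)
    show "\<bar>sgn u \<bullet> a\<bar> / \<bar>c\<bar> \<le> norm a / \<bar>c\<bar>" by (intro divide_right_mono abs_sgn_inner_le) simp
    show "\<bar>b \<bullet> u\<bar> * x ^ d \<le> norm b * x"
      unfolding j by (rule order_trans[OF lin mult_left_mono[OF pow]]) simp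
  qed (use x in auto)
  finally show "\<bar>(0 + b \<bullet> u) * inv_norm 1 u ^ d * ((sgn u \<bullet> a) / c)\<bar> \<le> norm a * norm b / \<bar>c\<bar> * inv_norm 1 u"
    by (simp add: x_def mult_ac)
  have 1: "\<bar>(b \<bullet> a) * x ^ d\<bar> \<le> norm a * norm b * x"
    unfolding abs_mult j using x pow[of "Suc j"] Cauchy_Schwarz_ineq2[of b a]
    by (intro mult_mono) (auto simp: mult.commute simp del: power_Suc)
  have 2: "\<bar>real d * (0 + b \<bullet> u) * x ^ Suc d * (sgn u \<bullet> a)\<bar> \<le> real d * (norm a * norm b * x)"
  proof -
    have "\<bar>real d * (0 + b \<bullet> u) * x ^ Suc d * (sgn u \<bullet> a)\<bar> = real d * ((\<bar>b \<bullet> u\<bar> * x ^ Suc d) * \<bar>sgn u \<bullet> a\<bar>)"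
      using x by (simp add: abs_mult)
    also have "\<dots> \<le> real d * ((norm b * x) * norm a)"
    proof (rule mult_left_mono[OF mult_mono[OF _ abs_sgn_inner_le]])
      show "\<bar>b \<bullet> u\<bar> * x ^ Suc d \<le> norm b * x"
        by (rule order_trans[OF lin mult_left_mono]) (use pow[of "Suc j"] j in auto)
    qed (use x in auto)
    finally show ?thesis by (simp add: mult_ac)
  qed
  have 3: "0 \<le> real d * (norm a * norm b * x)" using x by simp
  have "\<bar>(b \<bullet> a) * x ^ d - (if norm u > 1 then real d * (0 + b \<bullet> u) * x ^ Suc d * (sgn u \<bullet> a) else 0)\<bar>
      \<le> norm a * norm b * x + real d * (norm a * norm b * x)"
    using 1 2 3 by (auto simp del: power_Suc split: if_splits)
  then show "\<bar>(b \<bullet> a) * inv_norm 1 u ^ d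
        - (if norm u > 1 then real d * (0 + b \<bullet> u) * inv_norm 1 u ^ Suc d * (sgn u \<bullet> a) else 0)\<bar>
      \<le> norm a * norm b * (1 + real d) * inv_norm 1 u"
    unfolding x_def by (simp add: algebra_simps)
qed

lemma far_kernelI:
  fixes k :: "real^3 \<Rightarrow> real"
  assumes "k \<in> borel_measurable borel" "\<And>u. \<bar>k u\<bar> \<le> K * inv_norm 1 u" "K \<ge> 0"
  shows "locally_integrable k" and "norm u \<ge> 1 \<Longrightarrow> \<bar>k u\<bar> \<le> K / norm u"
proof -
  have "\<bar>k u\<bar> \<le> K + 0 / (norm u)\<^sup>2" for u
    using assms(2)[of u] mult_left_mono[OF inv_norm_le[of 1 u] assms(3)] by simp
  then show "locally_integrable k" by (rule locally_integrableI_inverse_square[OF assms(1)])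
  show "\<bar>k u\<bar> \<le> K / norm u" if "norm u \<ge> 1"
    using assms(2)[of u] that by (simp add: inv_norm_def max_def split: if_splits)
qed

lemma far_truncated_kernel_bound:
  assumes f: "Ck (Suc j) f" "j \<le> 1" and d: "d \<ge> 2"
    and tb: "tail_bound c f \<rho> e z" "tail_bound c (dir_deriv (0, 1) f) \<rho> e z"
    and mn: "\<rho> \<le> real m" "\<rho> \<le> real n"
  shows "norm (cone_integral c (\<lambda>u. (0 + b \<bullet> u) * inv_norm 1 u ^ d) (dir_deriv (a, 0) (far_part m n f)) z)
    \<le> norm a * norm b * (1 / \<bar>c\<bar> + 1 + real d) * e"
proof -
  have F: "Ck (Suc j) (far_part m n f)" by (rule Ck_far_part[OF f(1)]) (use f(2) in simp)
  note tk = truncated_kernel_bounds[OF d, where a=a and b=b]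
  have "norm (cone_integral c (\<lambda>u. (0 + b \<bullet> u) * inv_norm 1 u ^ d * ((sgn u \<bullet> a) / c)) (far_part m n (dir_deriv (0, 1) f)) z)
      \<le> norm a * norm b / \<bar>c\<bar> * e"
    by (rule far_part_integral_bound[OF Ck_dir_deriv[OF f(1)] _ tb(2) mn far_kernelI[OF _ tk(1)[where c=c]]])
      (use f(2) in \<open>simp_all\<close>)
  moreover have "norm (cone_integral c (\<lambda>u. (b \<bullet> a) * inv_norm 1 u ^ d
        - (if norm u > 1 then real d * (0 + b \<bullet> u) * inv_norm 1 u ^ Suc d * (sgn u \<bullet> a) else 0)) (far_part m n f) z)
      \<le> norm a * norm b * (1 + real d) * e"
    by (rule far_part_integral_bound[OF f(1) _ tb(1) mn far_kernelI[OF _ tk(2)]])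
      (use f(2) in \<open>simp_all\<close>)
  ultimately show ?thesis
    unfolding cone_integral_by_parts_truncated[OF F spatially_bounded_far_part zero_less_one] dir_deriv_far_part_time[OF f(1)]
    by (intro order_trans[OF norm_triangle_ineq4]) (simp add: algebra_simps)
qed

text \<open>The first derivative is moved by the gradient formula.  Before the second one is moved, its kernels are
  truncated at distance \<open>1\<close>, which does not affect a far source and removes the non-integrable singularity
  of their derivatives.\<close>

lemma far_hessian_bound:
  assumes f: "Ck 2 f"
    and tb: "tail_bound c f \<rho> e z" "tail_bound c (dir_deriv (0, 1) f) \<rho> e z"
      "tail_bound c (dir_deriv (0, 1) (dir_deriv (0, 1) f)) \<rho> e z"
    and mn: "\<rho> \<le> real m" "\<rho> \<le> real n"
  shows "norm (cone_integral c (\<lambda>u. 1 / norm u) (dir_deriv (b, 0) (dir_deriv (a, 0) (far_part m n f))) z)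
    \<le> norm a * norm b * (1 / \<bar>c\<bar> * (1 / \<bar>c\<bar> + 3) + (1 / \<bar>c\<bar> + 4)) * e"
proof -
  have f2: "Ck (Suc (Suc 0)) f" using f by (simp add: numeral_2_eq_2)
  have F: "Ck (Suc (Suc 0)) (far_part m n f)" by (rule Ck_far_part[OF f2]) simp
  have ft: "Ck (Suc 0) (dir_deriv (0, 1) f)" by (rule Ck_dir_deriv[OF f2])
  have time: "dir_deriv (0, 1) (dir_deriv (a, 0) (far_part m n f)) = dir_deriv (a, 0) (far_part m n (dir_deriv (0, 1) f))"
    unfolding dir_deriv_far_part_time[OF f2, symmetric] by (rule ext) (rule dir_deriv_commute[OF F])
  have z: "norm (fst z) + 1 \<le> \<rho>" using tb(1) by (simp add: tail_bound_def)
  have inv: "inv_norm 1 u = 1 / norm u" if "norm u \<ge> 1" for u :: "real^3"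
    using that by (simp add: inv_norm_def max_def)
  have 1: "cone_integral c (\<lambda>u. (sgn u \<bullet> b) / (c * norm u)) (dir_deriv (a, 0) (far_part m n (dir_deriv (0, 1) f))) z
    = (1 / c) *\<^sub>R cone_integral c (\<lambda>u. (0 + b \<bullet> u) * inv_norm 1 u ^ 2) (dir_deriv (a, 0) (far_part m n (dir_deriv (0, 1) f))) z"
    unfolding cone_integral_scale[symmetric]
    by (rule cone_integral_cong_far[OF _ dir_deriv_far_part_near[OF _ mn] z])
      (simp_all add: inv sgn_div_norm inner_commute power2_eq_square divide_inverse)
  have 2: "cone_integral c (\<lambda>u. (sgn u \<bullet> b) / (norm u)\<^sup>2) (dir_deriv (a, 0) (far_part m n f)) z
    = cone_integral c (\<lambda>u. (0 + b \<bullet> u) * inv_norm 1 u ^ 3) (dir_deriv (a, 0) (far_part m n f)) z"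
    by (rule cone_integral_cong_far[OF _ dir_deriv_far_part_near[OF _ mn] z])
      (simp_all add: inv sgn_div_norm inner_commute power2_eq_square power3_eq_cube divide_inverse)
  define K where "K = 1 / \<bar>c\<bar>"
  have K: "\<bar>1 / c\<bar> = K" "K \<ge> 0" by (simp_all add: K_def)
  have "norm ((1 / c) *\<^sub>R cone_integral c (\<lambda>u. (0 + b \<bullet> u) * inv_norm 1 u ^ 2) (dir_deriv (a, 0) (far_part m n (dir_deriv (0, 1) f))) z)
      \<le> K * (norm a * norm b * (K + 1 + real 2) * e)"
    unfolding norm_scaleR real_norm_def K(1)
    by (rule mult_left_mono[OF far_truncated_kernel_bound[OF ft _ _ tb(2,3) mn, folded K_def] K(2)]) auto
  moreover have "norm (cone_integral c (\<lambda>u. (0 + b \<bullet> u) * inv_norm 1 u ^ 3) (dir_deriv (a, 0) (far_part m n f)) z)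
      \<le> norm a * norm b * (K + 1 + real 3) * e"
    by (rule far_truncated_kernel_bound[OF f2 _ _ tb(1,2) mn, folded K_def]) auto
  ultimately show ?thesis
    unfolding cone_integral_inverse_norm_gradient[OF Ck_dir_deriv[OF F] spatially_bounded_dir_deriv[OF spatially_bounded_far_part]]
      time 1 2 K_def[symmetric]
    by (intro order_trans[OF norm_triangle_ineq]) (simp add: algebra_simps)
qed

lemma cone_integral_add_scale:
  fixes F G :: "spacetime \<Rightarrow> 'b::euclidean_space"
  assumes "continuous_on UNIV F" "spatially_bounded F" "continuous_on UNIV G" "spatially_bounded G"
    "locally_integrable k"
  shows "cone_integral c k (\<lambda>y. F y + r *\<^sub>R G y) z = cone_integral c k F z + r *\<^sub>R cone_integral c k G z"
proof -
  have "(\<lambda>u. k u *\<^sub>R (F (z + past_cone c u) + r *\<^sub>R G (z + past_cone c u)))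
    = (\<lambda>u. k u *\<^sub>R F (z + past_cone c u) + r *\<^sub>R (k u *\<^sub>R G (z + past_cone c u)))"
    by (rule ext) (simp add: scaleR_add_right mult.commute)
  then show ?thesis
    unfolding cone_integral_def
    using integrable_cone[OF assms(1,2,5), of z c] integrable_cone[OF assms(3,4,5), of z c]
    by (simp del: scaleR_scaleR)
qed

lemma cone_integral_dir_deriv_split:
  fixes F :: "spacetime \<Rightarrow> 'b::euclidean_space"
  assumes F: "Ck (Suc j) F" "spatially_bounded F" and k: "locally_integrable k"
  shows "cone_integral c k (dir_deriv v F) z
    = cone_integral c k (dir_deriv (fst v, 0) F) z + snd v *\<^sub>R cone_integral c k (dir_deriv (0, 1) F) z"
proof -
  have "dir_deriv v F = (\<lambda>y. dir_deriv (fst v, 0) F y + snd v *\<^sub>R dir_deriv (0, 1) F y)"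
    using dir_deriv_split[OF F(1), of "fst v" "snd v"] by auto
  then show ?thesis
    using cone_integral_add_scale[OF Ck_continuous[OF Ck_dir_deriv[OF F(1)]] spatially_bounded_dir_deriv[OF F(2)]
        Ck_continuous[OF Ck_dir_deriv[OF F(1)]] spatially_bounded_dir_deriv[OF F(2)] k] by simp
qed

lemma far_first_derivative_bound:
  assumes f: "Ck (Suc j) f" "j \<le> 1"
    and tb: "tail_bound c f \<rho> e z" "tail_bound c (dir_deriv (0, 1) f) \<rho> e z"
    and mn: "\<rho> \<le> real m" "\<rho> \<le> real n"
  shows "norm (cone_integral c (\<lambda>u. 1 / norm u) (dir_deriv v (far_part m n f)) z)
    \<le> (norm (fst v) * (1 / \<bar>c\<bar> + 1) + \<bar>snd v\<bar>) * e"
proof -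
  have F: "Ck (Suc j) (far_part m n f)" by (rule Ck_far_part[OF f(1)]) (use f(2) in simp)
  have "norm (cone_integral c (\<lambda>u. 1 / norm u) (far_part m n (dir_deriv (0, 1) f)) z) \<le> 1 * e"
    by (rule far_part_integral_bound[OF Ck_dir_deriv[OF f(1)] _ tb(2) mn locally_integrable_inverse_norm])
      (use f(2) in auto)
  then have "norm (snd v *\<^sub>R cone_integral c (\<lambda>u. 1 / norm u) (far_part m n (dir_deriv (0, 1) f)) z) \<le> \<bar>snd v\<bar> * e"
    by (simp add: mult_left_mono)
  then show ?thesis
    unfolding cone_integral_dir_deriv_split[OF F spatially_bounded_far_part locally_integrable_inverse_norm, of c v]
      dir_deriv_far_part_time[OF f(1)]
    using far_gradient_bound[OF f tb mn, of "fst v"]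
    by (intro order_trans[OF norm_triangle_ineq]) (simp add: algebra_simps)
qed

text \<open>Directions in space-time are split into space and time; a time derivative of a far source is the far
  source of \<open>\<partial>\<^sub>tf\<close>.\<close>

lemma far_second_derivative_bound:
  assumes f: "Ck 2 f"
    and tb: "tail_bound c f \<rho> e z" "tail_bound c (dir_deriv (0, 1) f) \<rho> e z"
      "tail_bound c (dir_deriv (0, 1) (dir_deriv (0, 1) f)) \<rho> e z"
    and mn: "\<rho> \<le> real m" "\<rho> \<le> real n"
  shows "norm (cone_integral c (\<lambda>u. 1 / norm u) (dir_deriv w (dir_deriv v (far_part m n f))) z)
    \<le> (norm (fst v) * norm (fst w) * (1 / \<bar>c\<bar> * (1 / \<bar>c\<bar> + 3) + (1 / \<bar>c\<bar> + 4))
      + \<bar>snd v\<bar> * (norm (fst w) * (1 / \<bar>c\<bar> + 1))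
      + \<bar>snd w\<bar> * (norm (fst v) * (1 / \<bar>c\<bar> + 1) + \<bar>snd v\<bar>)) * e"
proof -
  let ?I = "\<lambda>G. cone_integral c (\<lambda>u. 1 / norm u) G z"
  let ?F = "far_part m n f" and ?G = "far_part m n (dir_deriv (0, 1) f)"
  have f2: "Ck (Suc (Suc 0)) f" using f by (simp add: numeral_2_eq_2)
  have F: "Ck (Suc (Suc 0)) ?F" by (rule Ck_far_part[OF f2]) simp
  have ft: "Ck (Suc 0) (dir_deriv (0, 1) f)" by (rule Ck_dir_deriv[OF f2])
  have G: "Ck (Suc 0) ?G" by (rule Ck_far_part[OF ft]) simp
  have time: "dir_deriv (0, 1) (dir_deriv v ?F) = dir_deriv v ?G" for v
    unfolding dir_deriv_far_part_time[OF f2, symmetric] by (rule ext) (rule dir_deriv_commute[OF F])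
  have swap: "dir_deriv w (dir_deriv v ?F) = dir_deriv v (dir_deriv w ?F)" for v w
    by (rule ext) (rule dir_deriv_commute[OF F])
  note bF = spatially_bounded_far_part
  note split = cone_integral_dir_deriv_split[OF Ck_dir_deriv[OF F] spatially_bounded_dir_deriv[OF bF] locally_integrable_inverse_norm, where c=c and z=z]
  have "?I (dir_deriv w (dir_deriv v ?F)) = ?I (dir_deriv (fst w, 0) (dir_deriv v ?F)) + snd w *\<^sub>R ?I (dir_deriv v ?G)"
    unfolding split[of w v] time ..
  also have "?I (dir_deriv (fst w, 0) (dir_deriv v ?F))
      = ?I (dir_deriv (fst w, 0) (dir_deriv (fst v, 0) ?F)) + snd v *\<^sub>R ?I (dir_deriv (fst w, 0) ?G)"
    unfolding swap[of "(fst w, 0)" v] split[of v "(fst w, 0)"] time swap[of "(fst w, 0)" "(fst v, 0)"] ..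
  finally have eq: "?I (dir_deriv w (dir_deriv v ?F)) = ?I (dir_deriv (fst w, 0) (dir_deriv (fst v, 0) ?F))
      + snd v *\<^sub>R ?I (dir_deriv (fst w, 0) ?G) + snd w *\<^sub>R ?I (dir_deriv v ?G)" .
  have 1: "norm (?I (dir_deriv (fst w, 0) (dir_deriv (fst v, 0) ?F)))
      \<le> norm (fst v) * norm (fst w) * (1 / \<bar>c\<bar> * (1 / \<bar>c\<bar> + 3) + (1 / \<bar>c\<bar> + 4)) * e"
    by (rule far_hessian_bound[OF f tb mn])
  have "norm (snd v *\<^sub>R ?I (dir_deriv (fst w, 0) ?G)) \<le> \<bar>snd v\<bar> * (norm (fst w) * (1 / \<bar>c\<bar> + 1) * e)"
    unfolding norm_scaleR real_norm_def
    by (rule mult_left_mono[OF far_gradient_bound[OF ft _ tb(2,3) mn]]) auto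
  moreover have "norm (snd w *\<^sub>R ?I (dir_deriv v ?G)) \<le> \<bar>snd w\<bar> * ((norm (fst v) * (1 / \<bar>c\<bar> + 1) + \<bar>snd v\<bar>) * e)"
    unfolding norm_scaleR real_norm_def
    by (rule mult_left_mono[OF far_first_derivative_bound[OF ft _ tb(2,3) mn]]) auto
  ultimately have "norm (?I (dir_deriv w (dir_deriv v ?F)))
    \<le> norm (fst v) * norm (fst w) * (1 / \<bar>c\<bar> * (1 / \<bar>c\<bar> + 3) + (1 / \<bar>c\<bar> + 4)) * e
      + \<bar>snd v\<bar> * (norm (fst w) * (1 / \<bar>c\<bar> + 1) * e)
      + \<bar>snd w\<bar> * ((norm (fst v) * (1 / \<bar>c\<bar> + 1) + \<bar>snd v\<bar>) * e)"
    unfolding eq by (intro norm_triangle_le add_mono 1)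
  then show ?thesis by (simp add: algebra_simps)
qed


section \<open>Limits of \<open>C\<^sup>1\<close> maps\<close>

lemma dir_deriv_basis_bound:
  fixes f g :: "'a::euclidean_space \<Rightarrow> 'b::real_normed_vector"
  assumes "Ck (Suc i) f" "Ck (Suc j) g"
    and "\<And>b. b \<in> Basis \<Longrightarrow> norm (dir_deriv b f x - dir_deriv b g x) \<le> e"
  shows "norm (dir_deriv v f x - dir_deriv v g x) \<le> real DIM('a) * e * norm v"
proof -
  define D where "D v = dir_deriv v f x - dir_deriv v g x" for v
  have lin: "linear D"
    unfolding D_def by (rule linear_compose_sub[OF linear_dir_deriv[OF assms(1)] linear_dir_deriv[OF assms(2)]])
  have "D v = (\<Sum>b\<in>Basis. (v \<bullet> b) *\<^sub>R D b)"
    using linear_sum[OF lin, of "\<lambda>b. (v \<bullet> b) *\<^sub>R b" Basis]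
    by (simp add: euclidean_representation linear_scale[OF lin])
  also have "norm \<dots> \<le> (\<Sum>b\<in>(Basis::'a set). norm v * e)"
  proof (rule sum_norm_le)
    fix b :: 'a assume b: "b \<in> Basis"
    show "norm ((v \<bullet> b) *\<^sub>R D b) \<le> norm v * e"
      using assms(3)[OF b] Basis_le_norm[OF b, of v] unfolding D_def norm_scaleR real_norm_def
      by (intro mult_mono) auto
  qed
  finally show ?thesis by (simp add: D_def mult_ac)
qed

text \<open>It suffices to control one direction at a time: the basis directions are finitely many, so the
  derivatives are Cauchy uniformly in the direction, and the limit can be differentiated.\<close>

lemma C1_limit:
  fixes g :: "nat \<Rightarrow> 'a::euclidean_space \<Rightarrow> 'b::euclidean_space"
  assumes C1: "\<And>n. Ck (Suc 0) (g n)"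
    and lim: "\<And>x. (\<lambda>n. g n x) \<longlonglongrightarrow> G x"
    and cauchy: "\<And>v N e. e > 0 \<Longrightarrow> \<exists>n0. \<forall>m\<ge>n0. \<forall>n\<ge>n0. \<forall>x\<in>cball 0 N.
        norm (dir_deriv v (g m) x - dir_deriv v (g n) x) \<le> e"
  shows "Ck (Suc 0) G" and "(\<lambda>n. dir_deriv v (g n) x) \<longlonglongrightarrow> dir_deriv v G x"
proof -
  have "Cauchy (\<lambda>n. dir_deriv v (g n) x)" for v x :: 'a
    unfolding Cauchy_altdef2
  proof (intro allI impI)
    fix e :: real assume "e > 0"
    then obtain n0 where "\<forall>m\<ge>n0. \<forall>n\<ge>n0. \<forall>y\<in>cball 0 (norm x). norm (dir_deriv v (g m) y - dir_deriv v (g n) y) \<le> e / 2"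
      using cauchy[of "e / 2" "norm x" v] by auto
    then have "\<forall>n\<ge>n0. dist (dir_deriv v (g n) x) (dir_deriv v (g n0) x) \<le> e / 2"
      by (simp add: dist_norm)
    then show "\<exists>N. \<forall>n\<ge>N. dist (dir_deriv v (g n) x) (dir_deriv v (g N) x) < e"
      using \<open>e > 0\<close> by (intro exI[of _ n0]) force
  qed
  then have "\<exists>l. (\<lambda>n. dir_deriv v (g n) x) \<longlonglongrightarrow> l" for v x :: 'a
    using Cauchy_convergent convergent_def by blast
  then obtain H where H: "\<And>v x. (\<lambda>n. dir_deriv v (g n) x) \<longlonglongrightarrow> H v x" by metis
  have unif: "\<forall>\<^sub>F n in sequentially. \<forall>x\<in>cball 0 N. \<forall>v. norm (dir_deriv v (g n) x - H v x) \<le> e * norm v"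
    if e: "e > 0" for e N
  proof -
    define e' where "e' = e / real DIM('a)"
    have e': "e' > 0" using e by (simp add: e'_def)
    obtain n0 where n0: "\<And>b m n x. m \<ge> n0 b \<Longrightarrow> n \<ge> n0 b \<Longrightarrow> x \<in> cball 0 N \<Longrightarrow>
        norm (dir_deriv b (g m) x - dir_deriv b (g n) x) \<le> e'"
      using cauchy[OF e', of N] by metis
    define M where "M = Max (n0 ` (Basis :: 'a set))"
    have M: "n0 b \<le> M" if "b \<in> Basis" for b :: 'a unfolding M_def using that by simp
    show ?thesis
      unfolding eventually_sequentially
    proof (intro exI allI impI ballI)
      fix n and x v :: 'a assume n: "n \<ge> M" and x: "x \<in> cball 0 N"
      have bound: "norm (dir_deriv v (g n) x - dir_deriv v (g m) x) \<le> e * norm v" if "m \<ge> M" for m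
      proof -
        have "norm (dir_deriv v (g n) x - dir_deriv v (g m) x) \<le> real DIM('a) * e' * norm v"
          by (rule dir_deriv_basis_bound[OF C1 C1 n0[OF _ _ x]]) (use M n that in \<open>auto intro: order_trans\<close>)
        then show ?thesis by (simp add: e'_def)
      qed
      have "(\<lambda>m. norm (dir_deriv v (g n) x - dir_deriv v (g m) x)) \<longlonglongrightarrow> norm (dir_deriv v (g n) x - H v x)"
        by (intro tendsto_intros H)
      then show "norm (dir_deriv v (g n) x - H v x) \<le> e * norm v"
        by (rule LIMSEQ_le_const2) (use bound in blast)
    qed
  qed
  have deriv: "(G has_derivative (\<lambda>v. H v x)) (at x)" for x
  proof -
    define S where "S = ball (0::'a) (norm x + 1)"
    have S: "open S" "x \<in> S" by (auto simp: S_def)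
    have "\<exists>g'. \<forall>y\<in>S. (\<lambda>n. g n y) \<longlonglongrightarrow> g' y \<and> (g' has_derivative (\<lambda>v. H v y)) (at y within S)"
    proof (rule has_derivative_sequence)
      show "convex S" by (simp add: S_def)
      show "(g n has_derivative (\<lambda>v. dir_deriv v (g n) y)) (at y within S)" for n y
        by (rule has_derivative_at_withinI[OF Ck_has_derivative[OF C1]])
      show "\<forall>\<^sub>F n in sequentially. \<forall>y\<in>S. \<forall>h. norm (dir_deriv h (g n) y - H h y) \<le> e * norm h" if "e > 0" for e
        by (rule eventually_mono[OF unif[OF that, of "norm x + 1"]]) (auto simp: S_def)
    qed (fact S(2), fact lim)
    then obtain g' where g': "\<And>y. y \<in> S \<Longrightarrow> (\<lambda>n. g n y) \<longlonglongrightarrow> g' y"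
      "\<And>y. y \<in> S \<Longrightarrow> (g' has_derivative (\<lambda>v. H v y)) (at y within S)" by blast
    have eq: "g' y = G y" if "y \<in> S" for y using LIMSEQ_unique[OF g'(1)[OF that] lim] .
    have "(g' has_derivative (\<lambda>v. H v x)) (at x)"
      using g'(2)[OF S(2)] at_within_open[OF S(2,1)] by simp
    then show ?thesis
      by (rule has_derivative_transform_within_open[OF _ S]) (rule eq)
  qed
  have cont: "continuous_on UNIV (H v)" for v
  proof -
    have "isCont (H v) x" for x
    proof -
      have "continuous_on (cball 0 (norm x + 1)) (H v)"
      proof (rule uniform_limit_theorem[where f="\<lambda>n. dir_deriv v (g n)" and F=sequentially])
        show "\<forall>\<^sub>F n in sequentially. continuous_on (cball 0 (norm x + 1)) (dir_deriv v (g n))"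
          by (intro always_eventually allI Ck_continuous[OF Ck_dir_deriv[OF C1]])
        show "uniform_limit (cball 0 (norm x + 1)) (\<lambda>n. dir_deriv v (g n)) (H v) sequentially"
          unfolding uniform_limit_iff
        proof (intro allI impI)
          fix e :: real assume e: "e > 0"
          then have pos: "e / (norm v + 1) > 0" by (simp add: add_nonneg_pos)
          have "norm v + 1 > 0" by (simp add: add_nonneg_pos)
          from pos_divide_less_eq[OF this] have "e / (norm v + 1) * norm v < e"
            using e by (simp add: distrib_left)
          then show "\<forall>\<^sub>F n in sequentially. \<forall>y\<in>cball 0 (norm x + 1). dist (dir_deriv v (g n) y) (H v y) < e"
            by (intro eventually_mono[OF unif[OF pos, of "norm x + 1"]])
              (fastforce simp: dist_norm intro: le_less_trans)
        qed
      qed simp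
      then have "continuous_on (ball 0 (norm x + 1)) (H v)" by (rule continuous_on_subset) auto
      then show ?thesis by (simp add: continuous_on_eq_continuous_at)
    qed
    then show ?thesis by (simp add: continuous_at_imp_continuous_on)
  qed
  show "Ck (Suc 0) G" by (rule Ck_SucI[OF deriv]) (simp add: cont)
  show "(\<lambda>n. dir_deriv v (g n) x) \<longlonglongrightarrow> dir_deriv v G x"
    using H[of v x] dir_deriv_eq[OF deriv, of v x] by simp
qed

section \<open>The retarded potential of a source with uniformly small tails\<close>

lemma uniform_tails_tail_bound:
  fixes f :: "spacetime \<Rightarrow> 'b::euclidean_space"
  assumes "uniform_tails c f" "e > 0"
  obtains n0 where "\<And>\<rho> z. n0 \<le> \<rho> \<Longrightarrow> z \<in> cball 0 N \<Longrightarrow> tail_bound c f \<rho> e z"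
proof -
  obtain \<rho>0 where \<rho>0: "\<And>\<rho>' z. \<rho>0 \<le> \<rho>' \<Longrightarrow> z \<in> cball 0 N \<Longrightarrow> cone_tail c f \<rho>' z \<le> ennreal e"
    using uniform_tailsE[OF assms] by metis
  have "tail_bound c f \<rho> e z" if "max \<rho>0 (N + 1) \<le> \<rho>" "z \<in> cball 0 N" for \<rho> z
  proof -
    have "norm (fst z) \<le> norm z" using norm_fst_le[of "fst z" "snd z"] by simp
    then show ?thesis using \<rho>0[of \<rho> z] that assms(2) by (simp add: tail_bound_def)
  qed
  then show thesis by (rule that)
qed

text \<open>The retarded potential of \<open>f\<close>, up to the factor \<open>1/(4\<pi>\<epsilon>\<^sub>0)\<close> or \<open>\<mu>\<^sub>0/(4\<pi>)\<close>.\<close>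

definition inv_dist_potential ::
    "real \<Rightarrow> (spacetime \<Rightarrow> 'b::euclidean_space) \<Rightarrow> spacetime \<Rightarrow> 'b" where
  "inv_dist_potential c = cone_integral c (\<lambda>u. 1 / norm u)"

definition admissible_source :: "real \<Rightarrow> (spacetime \<Rightarrow> 'b::euclidean_space) \<Rightarrow> bool" where
  "admissible_source c f \<longleftrightarrow> Ck 2 f \<and> uniform_tails c f \<and> uniform_tails c (dir_deriv (0, 1) f)
     \<and> uniform_tails c (dir_deriv (0, 1) (dir_deriv (0, 1) f))"

context
  fixes c :: real and f :: "spacetime \<Rightarrow> 'b::euclidean_space"
  assumes f: "admissible_source c f"
begin

private abbreviation "F n \<equiv> \<lambda>z. cutoff n z *\<^sub>R f z"

lemma Ck2_source: "Ck (Suc (Suc 0)) f"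
  using f by (simp add: admissible_source_def numeral_2_eq_2)

lemma Ck2_cutoff_source: "Ck (Suc (Suc 0)) (F n)"
  using Ck_scaleR[OF Ck_cutoff, of f n] f by (simp add: admissible_source_def numeral_2_eq_2)

lemma far_part_eq_diff: "far_part m n f = (\<lambda>z. F m z - F n z)"
  by (rule ext) (simp add: far_part_def scaleR_diff_left)

lemma cone_integral_diff:
  fixes F G :: "spacetime \<Rightarrow> 'b"
  assumes "continuous_on UNIV F" "spatially_bounded F" "continuous_on UNIV G" "spatially_bounded G"
    "locally_integrable k"
  shows "cone_integral c k F z - cone_integral c k G z = cone_integral c k (\<lambda>y. F y - G y) z"
  using cone_integral_add_scale[OF assms, of c "- 1" z] by simp

lemma potential_first_derivative_difference:
  "dir_deriv v (inv_dist_potential c (F m)) z - dir_deriv v (inv_dist_potential c (F n)) z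
    = cone_integral c (\<lambda>u. 1 / norm u) (dir_deriv v (far_part m n f)) z"
proof -
  have "dir_deriv v (far_part m n f) = (\<lambda>y. dir_deriv v (F m) y - dir_deriv v (F n) y)"
    unfolding far_part_eq_diff by (rule ext) (rule dir_deriv_diff[OF Ck2_cutoff_source Ck2_cutoff_source])
  then show ?thesis
    unfolding inv_dist_potential_def
      dir_deriv_cone_integral[OF Ck2_cutoff_source spatially_bounded_cutoff locally_integrable_inverse_norm]
    using cone_integral_diff[OF Ck_continuous[OF Ck_dir_deriv[OF Ck2_cutoff_source]]
        spatially_bounded_dir_deriv[OF spatially_bounded_cutoff]
        Ck_continuous[OF Ck_dir_deriv[OF Ck2_cutoff_source]]
        spatially_bounded_dir_deriv[OF spatially_bounded_cutoff] locally_integrable_inverse_norm]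
    by simp
qed

lemma potential_second_derivative:
  "dir_deriv w (dir_deriv v (inv_dist_potential c (F n)))
    = cone_integral c (\<lambda>u. 1 / norm u) (dir_deriv w (dir_deriv v (F n)))"
  unfolding inv_dist_potential_def
    dir_deriv_cone_integral[OF Ck2_cutoff_source spatially_bounded_cutoff locally_integrable_inverse_norm]
  by (rule dir_deriv_cone_integral[OF Ck_dir_deriv[OF Ck2_cutoff_source]
        spatially_bounded_dir_deriv[OF spatially_bounded_cutoff] locally_integrable_inverse_norm])

lemma potential_second_derivative_difference:
  "dir_deriv w (dir_deriv v (inv_dist_potential c (F m))) z - dir_deriv w (dir_deriv v (inv_dist_potential c (F n))) z
    = cone_integral c (\<lambda>u. 1 / norm u) (dir_deriv w (dir_deriv v (far_part m n f))) z"
proof -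
  have "dir_deriv v (far_part m n f) = (\<lambda>y. dir_deriv v (F m) y - dir_deriv v (F n) y)"
    unfolding far_part_eq_diff by (rule ext) (rule dir_deriv_diff[OF Ck2_cutoff_source Ck2_cutoff_source])
  then have "dir_deriv w (dir_deriv v (far_part m n f))
      = (\<lambda>y. dir_deriv w (dir_deriv v (F m)) y - dir_deriv w (dir_deriv v (F n)) y)"
    by (simp only:) (rule ext, rule dir_deriv_diff[OF Ck_dir_deriv[OF Ck2_cutoff_source] Ck_dir_deriv[OF Ck2_cutoff_source]])
  then show ?thesis
    unfolding potential_second_derivative
    using cone_integral_diff[OF Ck_continuous[OF Ck_dir_deriv[OF Ck_dir_deriv[OF Ck2_cutoff_source]]]
        spatially_bounded_dir_deriv[OF spatially_bounded_dir_deriv[OF spatially_bounded_cutoff]]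
        Ck_continuous[OF Ck_dir_deriv[OF Ck_dir_deriv[OF Ck2_cutoff_source]]]
        spatially_bounded_dir_deriv[OF spatially_bounded_dir_deriv[OF spatially_bounded_cutoff]]
        locally_integrable_inverse_norm]
    by simp
qed

lemma tails_small:
  assumes "e > 0"
  obtains n0 where "\<And>m n (z :: spacetime). n0 \<le> m \<Longrightarrow> n0 \<le> n \<Longrightarrow> z \<in> cball 0 N \<Longrightarrow> \<exists>\<rho>. \<rho> \<le> real m \<and> \<rho> \<le> real n \<and>
    tail_bound c f \<rho> e z \<and> tail_bound c (dir_deriv (0, 1) f) \<rho> e z
    \<and> tail_bound c (dir_deriv (0, 1) (dir_deriv (0, 1) f)) \<rho> e z"
proof -
  obtain n1 where n1: "\<And>\<rho> z. n1 \<le> \<rho> \<Longrightarrow> z \<in> cball 0 N \<Longrightarrow> tail_bound c f \<rho> e z"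
    using uniform_tails_tail_bound[of c f e N] f assms unfolding admissible_source_def by metis
  obtain n2 where n2: "\<And>\<rho> z. n2 \<le> \<rho> \<Longrightarrow> z \<in> cball 0 N \<Longrightarrow> tail_bound c (dir_deriv (0, 1) f) \<rho> e z"
    using uniform_tails_tail_bound[of c "dir_deriv (0, 1) f" e N] f assms unfolding admissible_source_def by metis
  obtain n3 where n3: "\<And>\<rho> z. n3 \<le> \<rho> \<Longrightarrow> z \<in> cball 0 N \<Longrightarrow> tail_bound c (dir_deriv (0, 1) (dir_deriv (0, 1) f)) \<rho> e z"
    using uniform_tails_tail_bound[of c "dir_deriv (0, 1) (dir_deriv (0, 1) f)" e N] f assms
    unfolding admissible_source_def by metis
  define \<rho> where "\<rho> = max n1 (max n2 n3)"
  show thesis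
  proof (rule that[of "nat \<lceil>\<rho>\<rceil>"])
    fix m n and z :: "spacetime" assume "nat \<lceil>\<rho>\<rceil> \<le> m" "nat \<lceil>\<rho>\<rceil> \<le> n" and z: "z \<in> cball 0 N"
    then have "\<rho> \<le> real m" "\<rho> \<le> real n" by linarith+
    then show "\<exists>\<rho>. \<rho> \<le> real m \<and> \<rho> \<le> real n \<and> tail_bound c f \<rho> e z \<and> tail_bound c (dir_deriv (0, 1) f) \<rho> e z
      \<and> tail_bound c (dir_deriv (0, 1) (dir_deriv (0, 1) f)) \<rho> e z"
      using n1[OF _ z] n2[OF _ z] n3[OF _ z] by (intro exI[of _ \<rho>]) (auto simp: \<rho>_def)
  qed
qed

lemma small_multiple:
  fixes K e :: real
  assumes "e > 0" "K \<ge> 0"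
  obtains e' where "e' > 0" "K * e' \<le> e"
proof (rule that[of "e / (K + 1)"])
  show "e / (K + 1) > 0" using assms by simp
  show "K * (e / (K + 1)) \<le> e" using assms by (simp add: divide_le_eq mult.commute distrib_left)
qed

text \<open>Uniform tails give no integrable bound that dominates the integrands for all nearby events at once, so
  that the potential of \<open>f\<close> cannot be differentiated under the integral sign directly; but they do make the
  derivatives for cut off sources Cauchy, uniformly on balls.\<close>

lemma potential_first_derivatives_cauchy:
  assumes "e > 0"
  shows "\<exists>n0. \<forall>m\<ge>n0. \<forall>n\<ge>n0. \<forall>z\<in>cball 0 N.
    norm (dir_deriv v (inv_dist_potential c (F m)) z - dir_deriv v (inv_dist_potential c (F n)) z) \<le> e"
proof -
  define K where "K = norm (fst v) * (1 / \<bar>c\<bar> + 1) + \<bar>snd v\<bar>"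
  have "K \<ge> 0" by (simp add: K_def)
  obtain e' where e': "e' > 0" "K * e' \<le> e" using small_multiple[OF assms \<open>K \<ge> 0\<close>] by metis
  obtain n0 where n0: "\<And>m n (z :: spacetime). n0 \<le> m \<Longrightarrow> n0 \<le> n \<Longrightarrow> z \<in> cball 0 N \<Longrightarrow> \<exists>\<rho>. \<rho> \<le> real m \<and> \<rho> \<le> real n \<and>
    tail_bound c f \<rho> e' z \<and> tail_bound c (dir_deriv (0, 1) f) \<rho> e' z
    \<and> tail_bound c (dir_deriv (0, 1) (dir_deriv (0, 1) f)) \<rho> e' z"
    using tails_small[OF e'(1), of N] by metis
  show ?thesis
    unfolding potential_first_derivative_difference
  proof (intro exI allI impI ballI)
    fix m n and z :: "spacetime" assume "n0 \<le> m" "n0 \<le> n" and "z \<in> cball 0 N"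
    from n0[OF this] obtain \<rho> where \<rho>: "\<rho> \<le> real m" "\<rho> \<le> real n"
      "tail_bound c f \<rho> e' z" "tail_bound c (dir_deriv (0, 1) f) \<rho> e' z" by blast
    have "norm (cone_integral c (\<lambda>u. 1 / norm u) (dir_deriv v (far_part m n f)) z) \<le> K * e'"
      unfolding K_def by (rule far_first_derivative_bound[OF Ck_SucD[OF Ck2_source] _ \<rho>(3,4,1,2)]) simp
    then show "norm (cone_integral c (\<lambda>u. 1 / norm u) (dir_deriv v (far_part m n f)) z) \<le> e"
      using e'(2) by linarith
  qed
qed

lemma potential_second_derivatives_cauchy:
  assumes "e > 0"
  shows "\<exists>n0. \<forall>m\<ge>n0. \<forall>n\<ge>n0. \<forall>z\<in>cball 0 N.
    norm (dir_deriv w (dir_deriv v (inv_dist_potential c (F m))) z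
      - dir_deriv w (dir_deriv v (inv_dist_potential c (F n))) z) \<le> e"
proof -
  define K where "K = norm (fst v) * norm (fst w) * (1 / \<bar>c\<bar> * (1 / \<bar>c\<bar> + 3) + (1 / \<bar>c\<bar> + 4))
      + \<bar>snd v\<bar> * (norm (fst w) * (1 / \<bar>c\<bar> + 1))
      + \<bar>snd w\<bar> * (norm (fst v) * (1 / \<bar>c\<bar> + 1) + \<bar>snd v\<bar>)"
  have "K \<ge> 0" by (simp add: K_def)
  obtain e' where e': "e' > 0" "K * e' \<le> e" using small_multiple[OF assms \<open>K \<ge> 0\<close>] by metis
  obtain n0 where n0: "\<And>m n (z :: spacetime). n0 \<le> m \<Longrightarrow> n0 \<le> n \<Longrightarrow> z \<in> cball 0 N \<Longrightarrow> \<exists>\<rho>. \<rho> \<le> real m \<and> \<rho> \<le> real n \<and>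
    tail_bound c f \<rho> e' z \<and> tail_bound c (dir_deriv (0, 1) f) \<rho> e' z
    \<and> tail_bound c (dir_deriv (0, 1) (dir_deriv (0, 1) f)) \<rho> e' z"
    using tails_small[OF e'(1), of N] by metis
  have f2: "Ck 2 f" using f by (simp add: admissible_source_def)
  show ?thesis
    unfolding potential_second_derivative_difference
  proof (intro exI allI impI ballI)
    fix m n and z :: "spacetime" assume "n0 \<le> m" "n0 \<le> n" and "z \<in> cball 0 N"
    from n0[OF this] obtain \<rho> where \<rho>: "\<rho> \<le> real m" "\<rho> \<le> real n"
      "tail_bound c f \<rho> e' z" "tail_bound c (dir_deriv (0, 1) f) \<rho> e' z"
      "tail_bound c (dir_deriv (0, 1) (dir_deriv (0, 1) f)) \<rho> e' z" by blast
    have "norm (cone_integral c (\<lambda>u. 1 / norm u) (dir_deriv w (dir_deriv v (far_part m n f))) z) \<le> K * e'"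
      unfolding K_def by (rule far_second_derivative_bound[OF f2 \<rho>(3,4,5,1,2)])
    then show "norm (cone_integral c (\<lambda>u. 1 / norm u) (dir_deriv w (dir_deriv v (far_part m n f))) z) \<le> e"
      using e'(2) by linarith
  qed
qed

lemma potential_limit: "(\<lambda>n. inv_dist_potential c (F n) z) \<longlonglongrightarrow> inv_dist_potential c f z"
  unfolding inv_dist_potential_def
  by (rule cone_integral_cutoff_limit[OF Ck_continuous[OF Ck2_source] _ locally_integrable_inverse_norm, where K=1])
    (use f in \<open>auto simp: admissible_source_def\<close>)

lemma Ck2_potential_cutoff: "Ck (Suc (Suc 0)) (inv_dist_potential c (F n))"
  unfolding inv_dist_potential_def
  by (rule Ck_cone_integral[OF locally_integrable_inverse_norm Ck2_cutoff_source spatially_bounded_cutoff])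

lemma potential_first_derivative_limit:
  "(\<lambda>n. dir_deriv v (inv_dist_potential c (F n)) z) \<longlonglongrightarrow> dir_deriv v (inv_dist_potential c f) z"
  by (rule C1_limit(2)[where g="\<lambda>n. inv_dist_potential c (F n)",
        OF Ck_SucD[OF Ck2_potential_cutoff] potential_limit potential_first_derivatives_cauchy])

lemma Ck1_potential: "Ck (Suc 0) (inv_dist_potential c f)"
  by (rule C1_limit(1)[where g="\<lambda>n. inv_dist_potential c (F n)",
        OF Ck_SucD[OF Ck2_potential_cutoff] potential_limit potential_first_derivatives_cauchy])

lemma potential_second_derivative_limit:
  "(\<lambda>n. dir_deriv w (dir_deriv v (inv_dist_potential c (F n))) z)
    \<longlonglongrightarrow> dir_deriv w (dir_deriv v (inv_dist_potential c f)) z"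
  by (rule C1_limit(2)[where g="\<lambda>n. dir_deriv v (inv_dist_potential c (F n))",
        OF Ck_dir_deriv[OF Ck2_potential_cutoff] potential_first_derivative_limit potential_second_derivatives_cauchy])

text \<open>The limit theorem is applied twice: to the potentials of the cut off sources, and to each of their
  directional derivatives.\<close>

lemma Ck2_potential: "Ck (Suc (Suc 0)) (inv_dist_potential c f)"
proof (rule Ck_SucI[OF Ck_has_derivative[OF Ck1_potential]])
  show "Ck (Suc 0) (\<lambda>x. dir_deriv v (inv_dist_potential c f) x)" for v
    by (rule C1_limit(1)[where g="\<lambda>n. dir_deriv v (inv_dist_potential c (F n))",
        OF Ck_dir_deriv[OF Ck2_potential_cutoff] potential_first_derivative_limit potential_second_derivatives_cauchy])
qed

lemma potential_wave_equation:
  "(\<Sum>b\<in>Basis. dir_deriv (b, 0) (dir_deriv (b, 0) (inv_dist_potential c f)) z)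
    = (1 / c\<^sup>2) *\<^sub>R dir_deriv (0, 1) (dir_deriv (0, 1) (inv_dist_potential c f)) z - (4 * pi) *\<^sub>R f z"
proof (rule LIMSEQ_unique)
  show "(\<lambda>n. \<Sum>b\<in>Basis. dir_deriv (b, 0) (dir_deriv (b, 0) (inv_dist_potential c (F n))) z)
      \<longlonglongrightarrow> (\<Sum>b\<in>Basis. dir_deriv (b, 0) (dir_deriv (b, 0) (inv_dist_potential c f)) z)"
    by (intro tendsto_sum potential_second_derivative_limit)
  have "(\<lambda>n. cutoff n z *\<^sub>R f z) \<longlonglongrightarrow> f z"
  proof (rule tendsto_eventually)
    have "\<forall>\<^sub>F n in sequentially. norm (fst z) \<le> real (Suc n)"
      using eventually_ge_at_top[of "nat \<lceil>norm (fst z)\<rceil>"] by eventually_elim linarith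
    then show "\<forall>\<^sub>F n in sequentially. cutoff n z *\<^sub>R f z = f z"
      by (rule eventually_mono) (simp only: cutoff_eq_1 scaleR_one)
  qed
  then show "(\<lambda>n. \<Sum>b\<in>Basis. dir_deriv (b, 0) (dir_deriv (b, 0) (inv_dist_potential c (F n))) z)
      \<longlonglongrightarrow> (1 / c\<^sup>2) *\<^sub>R dir_deriv (0, 1) (dir_deriv (0, 1) (inv_dist_potential c f)) z - (4 * pi) *\<^sub>R f z"
    unfolding potential_second_derivative cone_integral_wave_equation[OF Ck2_cutoff_source spatially_bounded_cutoff]
    unfolding potential_second_derivative[symmetric]
    by (intro tendsto_diff tendsto_scaleR tendsto_const potential_second_derivative_limit)
qed

lemma potential_time_derivative:
  "dir_deriv (0, 1) (inv_dist_potential c f) z = inv_dist_potential c (dir_deriv (0, 1) f) z"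
proof (rule LIMSEQ_unique[OF potential_first_derivative_limit])
  show "(\<lambda>n. dir_deriv (0, 1) (inv_dist_potential c (F n)) z) \<longlonglongrightarrow> inv_dist_potential c (dir_deriv (0, 1) f) z"
    unfolding inv_dist_potential_def
      dir_deriv_cone_integral[OF Ck2_cutoff_source spatially_bounded_cutoff locally_integrable_inverse_norm]
      dir_deriv_cutoff_scaleR_time[OF Ck2_source]
    by (rule cone_integral_cutoff_limit[OF Ck_continuous[OF Ck_dir_deriv[OF Ck2_source]] _
          locally_integrable_inverse_norm, where K=1])
      (use f in \<open>auto simp: admissible_source_def\<close>)
qed

lemma potential_space_derivative:
  "dir_deriv (a, 0) (inv_dist_potential c f) z
    = cone_integral c (\<lambda>u. (sgn u \<bullet> a) / (c * norm u)) (dir_deriv (0, 1) f) z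
    + cone_integral c (\<lambda>u. (sgn u \<bullet> a) / (norm u)\<^sup>2) f z"
proof (rule LIMSEQ_unique[OF potential_first_derivative_limit])
  have "(\<lambda>n. cone_integral c (\<lambda>u. (sgn u \<bullet> a) / (c * norm u)) (\<lambda>z. cutoff n z *\<^sub>R dir_deriv (0, 1) f z) z)
      \<longlonglongrightarrow> cone_integral c (\<lambda>u. (sgn u \<bullet> a) / (c * norm u)) (dir_deriv (0, 1) f) z"
    by (rule cone_integral_cutoff_limit[OF Ck_continuous[OF Ck_dir_deriv[OF Ck2_source]] _
          locally_integrable_sgn_inverse_norm sgn_inverse_norm_far])
      (use f in \<open>auto simp: admissible_source_def\<close>)
  moreover have "(\<lambda>n. cone_integral c (\<lambda>u. (sgn u \<bullet> a) / (norm u)\<^sup>2) (F n) z)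
      \<longlonglongrightarrow> cone_integral c (\<lambda>u. (sgn u \<bullet> a) / (norm u)\<^sup>2) f z"
    by (rule cone_integral_cutoff_limit[OF Ck_continuous[OF Ck2_source] _
          locally_integrable_sgn_inverse_square sgn_inverse_square_far])
      (use f in \<open>auto simp: admissible_source_def\<close>)
  ultimately show "(\<lambda>n. dir_deriv (a, 0) (inv_dist_potential c (F n)) z)
    \<longlonglongrightarrow> cone_integral c (\<lambda>u. (sgn u \<bullet> a) / (c * norm u)) (dir_deriv (0, 1) f) z
    + cone_integral c (\<lambda>u. (sgn u \<bullet> a) / (norm u)\<^sup>2) f z"
    unfolding inv_dist_potential_def
      dir_deriv_cone_integral[OF Ck2_cutoff_source spatially_bounded_cutoff locally_integrable_inverse_norm]
      cone_integral_inverse_norm_gradient[OF Ck2_cutoff_source spatially_bounded_cutoff]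
      dir_deriv_cutoff_scaleR_time[OF Ck2_source]
    by (intro tendsto_add)
qed

end


section \<open>Coordinates\<close>

lemma integrable_vec3:
  fixes h :: "'a \<Rightarrow> real^3"
  assumes "\<And>i. integrable M (\<lambda>u. h u $ i)"
  shows "integrable M h"
proof -
  have "h = (\<lambda>u. \<Sum>i\<in>UNIV. (h u $ i) *\<^sub>R axis i 1)"
    by (rule ext) (simp add: vec_eq_iff axis_def if_distrib cong: if_cong)
  moreover have "integrable M (\<lambda>u. \<Sum>i\<in>UNIV. (h u $ i) *\<^sub>R (axis i 1 :: real^3))"
    by (intro Bochner_Integration.integrable_sum integrable_scaleR_left assms)
  ultimately show ?thesis by simp
qed

lemma integral_vec3_component:
  fixes h :: "'a \<Rightarrow> real^3"
  assumes "integrable M h"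
  shows "(integral\<^sup>L M h) $ i = (LINT u|M. h u $ i)"
  by (rule integral_bounded_linear[OF bounded_linear_vec_nth assms, symmetric])

lemma sum_Basis_vec3: "(\<Sum>b\<in>Basis. f b) = (\<Sum>i\<in>UNIV. f (axis i 1 :: real^3))"
proof -
  have Basis: "(Basis :: (real^3) set) = (\<lambda>i. axis i 1) ` UNIV"
    by (auto simp: Basis_vec_def)
  have inj: "inj (\<lambda>i. axis i 1 :: real^3)"
    by (rule injI) (simp add: axis_eq_axis)
  show ?thesis unfolding Basis sum.reindex[OF inj] o_def ..
qed

text \<open>Throughout, fields are treated as maps on space-time; partial derivatives in the sense
  of the definitions are directional derivatives there.\<close>

lemma time_deriv_eq_dir_deriv:
  assumes "\<And>r t. F r t = g (r, t)" "Ck (Suc k) g"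
  shows "time_deriv F r t = dir_deriv (0, 1) g (r, t)"
proof -
  have "((\<lambda>s. (r, s)) has_vector_derivative (0, 1)) (at t)"
    by (intro has_vector_derivative_Pair has_vector_derivative_const) (auto intro!: derivative_eq_intros)
  from vector_derivative_diff_chain_within[OF this has_derivative_at_withinI[OF Ck_has_derivative[OF assms(2)]]]
  have "((\<lambda>s. F r s) has_vector_derivative dir_deriv (0, 1) g (r, t)) (at t)"
    by (simp add: o_def assms(1))
  then show ?thesis unfolding time_deriv_def by (rule vector_derivative_at)
qed

lemma partial_eq_dir_deriv:
  assumes "\<And>x. F x = g (x, t)" "Ck (Suc k) g"
  shows "partial i F r = dir_deriv (axis i 1, 0) g (r, t)"
proof -
  have "((\<lambda>h. (r + h *\<^sub>R axis i 1, t)) has_vector_derivative (axis i 1, 0)) (at 0)"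
    by (intro has_vector_derivative_Pair has_vector_derivative_const) (auto intro!: derivative_eq_intros)
  from vector_derivative_diff_chain_within[OF this has_derivative_at_withinI[OF Ck_has_derivative[OF assms(2)]]]
  have "((\<lambda>h. F (r + h *\<^sub>R axis i 1)) has_vector_derivative dir_deriv (axis i 1, 0) g (r, t)) (at 0)"
    by (simp add: o_def assms(1))
  then show ?thesis unfolding partial_def by (rule vector_derivative_at)
qed

lemma time_deriv_vec3_component:
  fixes F :: "real^3 \<Rightarrow> real \<Rightarrow> real^3"
  assumes "\<And>i r t. F r t $ i = g i (r, t)" "\<And>i. Ck (Suc k) (g i)"
  shows "time_deriv F r t $ i = dir_deriv (0, 1) (g i) (r, t)"
proof -
  have d: "((\<lambda>s. g j (r, s)) has_vector_derivative dir_deriv (0, 1) (g j) (r, t)) (at t)" for j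
  proof -
    have "((\<lambda>s. (r, s)) has_vector_derivative (0, 1)) (at t)"
      by (intro has_vector_derivative_Pair has_vector_derivative_const) (auto intro!: derivative_eq_intros)
    from vector_derivative_diff_chain_within[OF this has_derivative_at_withinI[OF Ck_has_derivative[OF assms(2)]]]
    show ?thesis by (simp add: o_def)
  qed
  have eq: "F r s = (\<Sum>j\<in>UNIV. g j (r, s) *\<^sub>R axis j 1)" for s
    by (simp add: vec_eq_iff assms(1) axis_def if_distrib cong: if_cong)
  have "((\<lambda>s. \<Sum>j\<in>UNIV. g j (r, s) *\<^sub>R (axis j 1 :: real^3)) has_vector_derivative
      (\<Sum>j\<in>UNIV. dir_deriv (0, 1) (g j) (r, t) *\<^sub>R axis j 1)) (at t)"
    by (intro has_vector_derivative_sum bounded_linear.has_vector_derivative[OF bounded_linear_scaleR_left] d)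
  then have "time_deriv F r t = (\<Sum>j\<in>UNIV. dir_deriv (0, 1) (g j) (r, t) *\<^sub>R axis j 1)"
    unfolding time_deriv_def eq by (rule vector_derivative_at)
  then show ?thesis by (simp add: axis_def if_distrib cong: if_cong)
qed

lemma laplacian_eq_dir_deriv:
  assumes "\<And>x. F x = g (x, t)" "Ck (Suc (Suc k)) g"
  shows "laplacian F r = (\<Sum>i\<in>UNIV. dir_deriv (axis i 1, 0) (dir_deriv (axis i 1, 0) g) (r, t))"
proof -
  have "partial i (partial i F) r = dir_deriv (axis i 1, 0) (dir_deriv (axis i 1, 0) g) (r, t)" for i
    by (rule partial_eq_dir_deriv[OF partial_eq_dir_deriv[OF assms] Ck_dir_deriv[OF assms(2)]])
  then show ?thesis by (simp add: laplacian_def)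
qed

lemma second_time_deriv_eq_dir_deriv:
  assumes "\<And>r t. F r t = g (r, t)" "Ck (Suc (Suc k)) g"
  shows "time_deriv (time_deriv F) r t = dir_deriv (0, 1) (dir_deriv (0, 1) g) (r, t)"
  by (rule time_deriv_eq_dir_deriv[OF time_deriv_eq_dir_deriv[OF assms] Ck_dir_deriv[OF assms(2)]])

lemma dir_deriv_scale:
  fixes g :: "'a::real_normed_vector \<Rightarrow> 'b::real_normed_vector"
  assumes "Ck (Suc k) g"
  shows "dir_deriv v (\<lambda>z. a *\<^sub>R g z) = (\<lambda>z. a *\<^sub>R dir_deriv v g z)"
  by (rule ext) (rule dir_deriv_bounded_linear[OF bounded_linear_scaleR_right assms])

lemma Ck_scale: "Ck k g \<Longrightarrow> Ck k (\<lambda>z. a *\<^sub>R g z)"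
  by (rule Ck_scaleR[OF Ck_const])

lemma Ck_component: "Ck k g \<Longrightarrow> Ck k (\<lambda>z. (g z :: real^3) $ i)"
  by (rule Ck_bounded_linear_compose[OF bounded_linear_vec_nth])

lemma dir_deriv_component:
  assumes "Ck (Suc k) g"
  shows "dir_deriv v (\<lambda>z. (g z :: real^3) $ i) = (\<lambda>z. dir_deriv v g z $ i)"
  by (rule ext) (rule dir_deriv_bounded_linear[OF bounded_linear_vec_nth assms])

lemma dir_deriv_lincomb:
  fixes g h :: "'a::real_normed_vector \<Rightarrow> real"
  assumes "Ck (Suc i) g" "Ck (Suc j) h"
  shows "dir_deriv v (\<lambda>z. a * g z + b * h z) z = a * dir_deriv v g z + b * dir_deriv v h z"
proof (rule dir_deriv_eq[where f'="\<lambda>v. a * dir_deriv v g z + b * dir_deriv v h z"])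
  show "((\<lambda>z. a * g z + b * h z) has_derivative (\<lambda>v. a * dir_deriv v g z + b * dir_deriv v h z)) (at z)"
    by (intro has_derivative_add has_derivative_mult_right Ck_has_derivative[OF assms(1)] Ck_has_derivative[OF assms(2)])
qed

lemma Ck_lincomb:
  fixes g h :: "'a::real_normed_vector \<Rightarrow> real"
  assumes "Ck k g" "Ck k h"
  shows "Ck k (\<lambda>z. a * g z + b * h z)"
  using Ck_add[OF Ck_scale[OF assms(1)] Ck_scale[OF assms(2)], of a b] by simp

section \<open>Retarded integrals as cone integrals\<close>

text \<open>The integrand \<open>h\<close> may depend on several values of the source, as in Jefimenko's equations, where \<open>F\<close> is a
  tuple of fields.\<close>

lemma retarded_integral_cone:
  fixes F :: "spacetime \<Rightarrow> 'b::euclidean_space"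
  assumes int: "integrable lborel (\<lambda>u. h u (F ((r, t) + past_cone c u)) :: 'd::euclidean_space)"
  shows "integrable lborel (\<lambda>r'. h (r' - r) (F (r', t - norm (r - r') / c)))"
    and "(LINT r'|lborel. h (r' - r) (F (r', t - norm (r - r') / c)))
      = (LINT u|lborel. h u (F ((r, t) + past_cone c u)))"
proof -
  have eq: "(\<lambda>r'. h (- r + r') (F ((r, t) + past_cone c (- r + r'))))
      = (\<lambda>r'. h (r' - r) (F (r', t - norm (r - r') / c)))"
    by (rule ext) (simp add: past_cone_def norm_minus_commute)
  show "integrable lborel (\<lambda>r'. h (r' - r) (F (r', t - norm (r - r') / c)))"
    using integrable_lborel_translate[OF int, of "- r"] unfolding eq .
  have "(\<lambda>u. h u (F ((r, t) + past_cone c u))) \<in> borel_measurable borel"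
    using borel_measurable_integrable[OF int] by simp
  from lborel_integral_translate[OF this, of "- r"]
  show "(LINT r'|lborel. h (r' - r) (F (r', t - norm (r - r') / c)))
      = (LINT u|lborel. h u (F ((r, t) + past_cone c u)))"
    unfolding eq .
qed

lemma cone_tail_eq_retarded_tail:
  fixes f :: "real^3 \<Rightarrow> real \<Rightarrow> 'b::euclidean_space"
  assumes f: "continuous_on UNIV (\<lambda>(r, t). f r t)"
  shows "cone_tail c (\<lambda>(r, t). f r t) R (r, t) = (\<integral>\<^sup>+ r' \<in> {r'. norm r' > R}.
      ennreal (norm (f r' (t - norm (r - r') / c)) / norm (r - r')) \<partial>lborel)"
proof -
  let ?g = "\<lambda>r'. ennreal (norm (f r' (t - norm (r - r') / c)) / norm (r - r')) * indicator {r'. norm r' > R} r'"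
  have "continuous_on UNIV (\<lambda>r'. (\<lambda>(r, t). f r t) (r', t - norm (r - r') / c))"
    unfolding divide_inverse by (rule continuous_on_compose2[OF f]) (auto intro!: continuous_intros)
  then have [measurable]: "(\<lambda>r'. f r' (t - norm (r - r') / c)) \<in> borel_measurable borel"
    by (intro borel_measurable_continuous_onI) simp
  have "open {r'::real^3. norm r' > R}" by (intro open_Collect_less continuous_intros)
  then have [measurable]: "{r'::real^3. norm r' > R} \<in> sets borel" by simp
  have meas: "?g \<in> borel_measurable borel" by measurable
  have "(\<integral>\<^sup>+ r'. ?g r' \<partial>lborel) = (\<integral>\<^sup>+ r'. ?g r' \<partial>distr lborel borel ((+) r))"
    by (simp only: lborel_distr_plus)
  also have "\<dots> = (\<integral>\<^sup>+ u. ?g (r + u) \<partial>lborel)"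
    by (rule nn_integral_distr) (use meas in auto)
  also have "\<dots> = cone_tail c (\<lambda>(r, t). f r t) R (r, t)"
    unfolding cone_tail_def by (simp add: past_cone_def mult.commute indicator_def)
  finally show ?thesis by simp
qed

lemma uniform_tailsI:
  fixes f :: "real^3 \<Rightarrow> real \<Rightarrow> 'b::euclidean_space"
  assumes "continuous_on UNIV (\<lambda>(r, t). f r t)" "retarded_integral_converges c f"
  shows "uniform_tails c (\<lambda>(r, t). f r t)"
  unfolding uniform_tails_def
proof (intro allI impI)
  fix N e :: real assume "e > 0"
  then obtain R where R: "\<forall>(r, t)\<in>cball 0 N. (\<integral>\<^sup>+ r' \<in> {r'. norm r' > R}.
      ennreal (norm (f r' (t - norm (r - r') / c)) / norm (r - r')) \<partial>lborel) \<le> ennreal e"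
    using assms(2) compact_cball unfolding retarded_integral_converges_def by blast
  have "cone_tail c (\<lambda>(r, t). f r t) R (r, t) \<le> ennreal e" if "(r, t) \<in> cball 0 N" for r t
    unfolding cone_tail_eq_retarded_tail[OF assms(1)] using bspec[OF R that] by simp
  then show "\<exists>\<rho>. \<forall>z\<in>cball 0 N. cone_tail c (\<lambda>(r, t). f r t) \<rho> z \<le> ennreal e"
    by (intro exI[of _ R]) auto
qed

lemma admissible_sourceI:
  fixes f :: "real^3 \<Rightarrow> real \<Rightarrow> 'b::euclidean_space"
  assumes "smooth (\<lambda>(r, t). f r t)" "retarded_potential_exists c f"
  shows "admissible_source c (\<lambda>(r, t). f r t)"
proof -
  have f: "Ck (Suc (Suc 0)) (\<lambda>(r, t). f r t)" using assms(1) by (simp add: smooth_def)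
  note ft = Ck_dir_deriv[OF f, of "(0, 1)"]
  note ftt = Ck_dir_deriv[OF ft, of "(0, 1)"]
  have 1: "(\<lambda>(r, t). time_deriv f r t) = dir_deriv (0, 1) (\<lambda>(r, t). f r t)"
    by (auto simp: fun_eq_iff time_deriv_eq_dir_deriv[OF _ f])
  have 2: "(\<lambda>(r, t). time_deriv (time_deriv f) r t) = dir_deriv (0, 1) (dir_deriv (0, 1) (\<lambda>(r, t). f r t))"
    by (auto simp: fun_eq_iff second_time_deriv_eq_dir_deriv[OF _ f])
  have "uniform_tails c (\<lambda>(r, t). f r t)"
    by (rule uniform_tailsI[OF Ck_continuous[OF f]])
      (use assms(2) in \<open>simp add: retarded_potential_exists_def\<close>)
  moreover have "uniform_tails c (\<lambda>(r, t). time_deriv f r t)"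
    by (rule uniform_tailsI[OF Ck_continuous[OF ft[folded 1]]])
      (use assms(2) in \<open>simp add: retarded_potential_exists_def\<close>)
  moreover have "uniform_tails c (\<lambda>(r, t). time_deriv (time_deriv f) r t)"
    by (rule uniform_tailsI[OF Ck_continuous[OF ftt[folded 2]]])
      (use assms(2) in \<open>simp add: retarded_potential_exists_def\<close>)
  ultimately show ?thesis
    using f unfolding admissible_source_def 1 2 by (simp add: numeral_2_eq_2)
qed

section \<open>The Lorenz gauge condition\<close>

lemma dir_deriv_cutoff_near:
  assumes "norm (fst y) \<le> real n" shows "dir_deriv v (cutoff n) y = 0"
  by (rule dir_deriv_zero_on_open[OF open_norm_fst_less[of "real (Suc n)"]])
    (use assms in \<open>auto intro!: cutoff_eq_1\<close>)

lemma cone_integral_component: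
  fixes F :: "spacetime \<Rightarrow> real^3"
  assumes "continuous_on UNIV F" "spatially_bounded F" "locally_integrable k"
  shows "cone_integral c k F z $ i = cone_integral c k (\<lambda>y. F y $ i) z"
  unfolding cone_integral_def integral_vec3_component[OF integrable_cone[OF assms]] by simp

text \<open>With the sources cut off, charge is conserved except where the cutoff varies.  The defect
  \<open>\<nabla>\<psi>\<^sub>n \<bullet> J\<close> is bounded by a multiple of \<open>\<bar>J\<bar>\<close> and lives at distance at least \<open>n\<close>.\<close>

lemma potential_lorenz_gauge:
  fixes \<rho> :: "spacetime \<Rightarrow> real" and J :: "spacetime \<Rightarrow> real^3"
  assumes \<rho>: "admissible_source c \<rho>" and J: "admissible_source c J"
    and continuity: "\<And>y. dir_deriv (0, 1) \<rho> y + (\<Sum>i\<in>UNIV. dir_deriv (axis i 1, 0) J y $ i) = 0"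
  shows "(\<Sum>i\<in>UNIV. dir_deriv (axis i 1, 0) (inv_dist_potential c J) z $ i)
    + dir_deriv (0, 1) (inv_dist_potential c \<rho>) z = 0"
proof -
  let ?k = "\<lambda>u::real^3. 1 / norm u"
  let ?\<rho> = "\<lambda>n z. cutoff n z *\<^sub>R \<rho> z" and ?J = "\<lambda>n z. cutoff n z *\<^sub>R J z"
  note k = locally_integrable_inverse_norm
  note C\<rho> = Ck2_cutoff_source[OF \<rho>] and CJ = Ck2_cutoff_source[OF J]
  note b\<rho> = spatially_bounded_cutoff[where f=\<rho>] and bJ = spatially_bounded_cutoff[where f=J]
  define G where "G n y = (\<Sum>i\<in>UNIV. dir_deriv (axis i 1, 0) (cutoff n) y * J y $ i)" for n y
  have contJ: "continuous_on UNIV J" by (rule Ck_continuous[OF Ck2_source[OF J]])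
  have contG: "continuous_on UNIV (G n)" for n
    unfolding G_def
    by (intro continuous_on_sum continuous_on_mult Ck_continuous[OF Ck_dir_deriv[OF Ck_cutoff1]]
        bounded_linear.continuous_on[OF bounded_linear_vec_nth contJ])
  have bG: "spatially_bounded (G n)" for n
  proof -
    have "dir_deriv v (cutoff n) y = 0" if "norm (fst y) > 2 * real (Suc n)" for v y
      by (rule dir_deriv_zero_on_open[OF open_norm_fst_greater[of "2 * real (Suc n)"]])
        (use that in \<open>auto intro!: cutoff_eq_0\<close>)
    then show ?thesis
      unfolding spatially_bounded_def by (intro exI[of _ "2 * real (Suc n)"]) (simp add: G_def)
  qed
  have defect: "(\<Sum>i\<in>UNIV. dir_deriv (axis i 1, 0) (?J n) y $ i) + dir_deriv (0, 1) (?\<rho> n) y = G n y" for n y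
  proof -
    have "(\<Sum>i\<in>UNIV. dir_deriv (axis i 1, 0) (?J n) y $ i)
      = cutoff n y * (\<Sum>i\<in>UNIV. dir_deriv (axis i 1, 0) J y $ i) + G n y"
      by (simp add: dir_deriv_scaleR[OF Ck_cutoff1 Ck2_source[OF J]] G_def sum.distrib sum_distrib_left)
    moreover have "dir_deriv (0, 1) (?\<rho> n) y = cutoff n y * dir_deriv (0, 1) \<rho> y"
      by (simp add: dir_deriv_scaleR[OF Ck_cutoff1 Ck2_source[OF \<rho>], simplified] dir_deriv_cutoff_time)
    ultimately have "(\<Sum>i\<in>UNIV. dir_deriv (axis i 1, 0) (?J n) y $ i) + dir_deriv (0, 1) (?\<rho> n) y
      = cutoff n y * (dir_deriv (0, 1) \<rho> y + (\<Sum>i\<in>UNIV. dir_deriv (axis i 1, 0) J y $ i)) + G n y"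
      by (simp only: distrib_left add_ac)
    then show ?thesis by (simp add: continuity)
  qed
  have eq: "(\<Sum>i\<in>UNIV. dir_deriv (axis i 1, 0) (inv_dist_potential c (?J n)) z $ i)
      + dir_deriv (0, 1) (inv_dist_potential c (?\<rho> n)) z = cone_integral c ?k (G n) z" for n
  proof -
    have intJ: "integrable lborel (\<lambda>u. ?k u *\<^sub>R (dir_deriv (axis i 1, 0) (?J n) (z + past_cone c u) $ i))" for i
      using integrable_bounded_linear[OF bounded_linear_vec_nth[of i]
          integrable_cone[OF Ck_continuous[OF Ck_dir_deriv[OF CJ, of "(axis i 1, 0)" n]] spatially_bounded_dir_deriv[OF bJ] k]]
      by simp
    have int\<rho>: "integrable lborel (\<lambda>u. ?k u *\<^sub>R dir_deriv (0, 1) (?\<rho> n) (z + past_cone c u))"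
      by (rule integrable_cone[OF Ck_continuous[OF Ck_dir_deriv[OF C\<rho>]] spatially_bounded_dir_deriv[OF b\<rho>] k])
    have "(\<Sum>i\<in>UNIV. dir_deriv (axis i 1, 0) (inv_dist_potential c (?J n)) z $ i)
        + dir_deriv (0, 1) (inv_dist_potential c (?\<rho> n)) z
      = (\<Sum>i\<in>UNIV. cone_integral c ?k (\<lambda>y. dir_deriv (axis i 1, 0) (?J n) y $ i) z)
        + cone_integral c ?k (dir_deriv (0, 1) (?\<rho> n)) z"
      unfolding inv_dist_potential_def dir_deriv_cone_integral[OF CJ bJ k] dir_deriv_cone_integral[OF C\<rho> b\<rho> k]
        cone_integral_component[OF Ck_continuous[OF Ck_dir_deriv[OF CJ]] spatially_bounded_dir_deriv[OF bJ] k] ..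
    also have "\<dots> = (LINT u|lborel. (\<Sum>i\<in>UNIV. ?k u *\<^sub>R (dir_deriv (axis i 1, 0) (?J n) (z + past_cone c u) $ i))
        + ?k u *\<^sub>R dir_deriv (0, 1) (?\<rho> n) (z + past_cone c u))"
      unfolding cone_integral_def
      by (simp only: Bochner_Integration.integral_add[OF Bochner_Integration.integrable_sum[OF intJ] int\<rho>]
          Bochner_Integration.integral_sum[OF intJ])
    also have "\<dots> = cone_integral c ?k (G n) z"
      unfolding cone_integral_def scaleR_sum_right[symmetric] scaleR_add_right[symmetric] defect ..
    finally show ?thesis .
  qed
  obtain C where C: "C > 0" "\<And>n y v. norm (dir_deriv v (cutoff n) y) \<le> C * norm v"
    using cutoff_derivative_bounded by metis
  have G_bound: "\<bar>G n y\<bar> \<le> 3 * C * norm (J y)" for n y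
  proof -
    have "\<bar>G n y\<bar> \<le> (\<Sum>i\<in>(UNIV::3 set). C * norm (J y))"
      unfolding G_def
    proof (rule order_trans[OF sum_abs sum_mono])
      fix i :: 3
      have "\<bar>dir_deriv (axis i 1, 0) (cutoff n) y\<bar> * \<bar>J y $ i\<bar> \<le> C * norm (J y)"
        using C(2)[of "(axis i 1, 0)" n y] C(1)
        by (intro mult_mono component_le_norm_cart) (auto simp: norm_Pair)
      then show "\<bar>dir_deriv (axis i 1, 0) (cutoff n) y * J y $ i\<bar> \<le> C * norm (J y)"
        by (simp add: abs_mult)
    qed
    then show ?thesis by simp
  qed
  have "(\<lambda>n. cone_integral c ?k (G n) z) \<longlonglongrightarrow> 0"
  proof (rule LIMSEQ_I)
    fix e :: real assume e: "e > 0"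
    (* 3 * C bounds the defect relative to J; the factor 2 gives the strict inequality. *)
    define e' where "e' = e / (2 * (3 * C))"
    have e': "e' > 0" using e C(1) by (simp add: e'_def)
    obtain n0 where n0: "\<And>\<rho> y. n0 \<le> \<rho> \<Longrightarrow> y \<in> cball 0 (norm z) \<Longrightarrow> tail_bound c J \<rho> e' y"
      using uniform_tails_tail_bound[OF _ e', of c J "norm z"] J unfolding admissible_source_def by metis
    have "norm (cone_integral c ?k (G n) z - 0) < e" if n: "n \<ge> nat \<lceil>n0\<rceil>" for n
    proof -
      have "n0 \<le> real n" using n by linarith
      then have tb: "tail_bound c J (real n) e' z" by (intro n0) auto
      have "norm (cone_integral c ?k (\<lambda>y. (1 / (3 * C)) *\<^sub>R G n y) z) \<le> 1 * e'"
      proof (rule far_cone_integral_bound[OF contJ _ _ _ _ k])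
        show "continuous_on UNIV (\<lambda>y. (1 / (3 * C)) *\<^sub>R G n y)"
          by (intro continuous_on_scaleR continuous_on_const contG)
        show "spatially_bounded (\<lambda>y. (1 / (3 * C)) *\<^sub>R G n y)"
          using bG[of n] unfolding spatially_bounded_def by auto
        show "norm ((1 / (3 * C)) *\<^sub>R G n y) \<le> norm (J y)" for y
          using G_bound[of n y] C(1) by (simp add: divide_le_eq mult_ac)
        show "(1 / (3 * C)) *\<^sub>R G n y = 0" if "norm (fst y) \<le> real n" for y
          using that by (simp add: G_def dir_deriv_cutoff_near)
      qed (use tb in \<open>auto simp: tail_bound_def\<close>)
      also have "cone_integral c ?k (\<lambda>y. (1 / (3 * C)) *\<^sub>R G n y) z = (1 / (3 * C)) *\<^sub>R cone_integral c ?k (G n) z"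
        unfolding cone_integral_def scaleR_left_commute[of _ "1 / (3 * C)"] integral_scaleR_right ..
      finally have "\<bar>cone_integral c ?k (G n) z\<bar> \<le> 3 * C * e'"
        using C(1) by (simp add: divide_le_eq mult_ac)
      also have "3 * C * e' < e" using e C(1) by (simp add: e'_def)
      finally show ?thesis by simp
    qed
    then show "\<exists>no. \<forall>n\<ge>no. norm (cone_integral c ?k (G n) z - 0) < e" by blast
  qed
  moreover have "(\<lambda>n. cone_integral c ?k (G n) z) \<longlonglongrightarrow>
      (\<Sum>i\<in>UNIV. dir_deriv (axis i 1, 0) (inv_dist_potential c J) z $ i) + dir_deriv (0, 1) (inv_dist_potential c \<rho>) z"
    unfolding eq[symmetric]
    by (intro tendsto_add tendsto_sum tendsto_vec_nth potential_first_derivative_limit[OF J] potential_first_derivative_limit[OF \<rho>])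
  ultimately show ?thesis using LIMSEQ_unique by blast
qed


section \<open>From potentials to Maxwell's equations\<close>

text \<open>The homogeneous equations hold because mixed partial derivatives commute.  In the other two, commuting
  derivatives produces the terms \<open>\<partial>\<^sub>t(\<nabla> \<bullet> A)\<close> and \<open>\<nabla>(\<nabla> \<bullet> A)\<close>; the differentiated Lorenz condition turns them into
  derivatives of \<open>V\<close>, and the wave equations do the rest.  Everything is computed in coordinates, on scalar
  functions on space-time.\<close>

lemma potentials_solve_maxwell:
  fixes V :: "real^3 \<Rightarrow> real \<Rightarrow> real" and A E B :: "real^3 \<Rightarrow> real \<Rightarrow> real^3"
  assumes V: "Ck (Suc (Suc 0)) (\<lambda>(r, t). V r t)" and A: "Ck (Suc (Suc 0)) (\<lambda>(r, t). A r t)"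
    and lorenz: "\<And>r t. divergence (\<lambda>x. A x t) r + \<mu> * \<epsilon> * time_deriv V r t = 0"
    and waveV: "\<And>r t. laplacian (\<lambda>x. V x t) r - \<mu> * \<epsilon> * time_deriv (time_deriv V) r t = - \<rho> r t / \<epsilon>"
    and waveA: "\<And>r t. laplacian (\<lambda>x. A x t) r - (\<mu> * \<epsilon>) *\<^sub>R time_deriv (time_deriv A) r t = - (\<mu> *\<^sub>R J r t)"
    and E: "\<And>r t. E r t = - grad (\<lambda>x. V x t) r - time_deriv A r t"
    and B: "\<And>r t. B r t = curl (\<lambda>x. A x t) r"
  shows "maxwell_equations \<epsilon> \<mu> \<rho> J E B"
proof -
  define v where "v = (\<lambda>(r, t). V r t)"
  define AA where "AA = (\<lambda>(r, t). A r t)"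
  define \<alpha> where "\<alpha> j = (\<lambda>z. AA z $ j)" for j
  define d where "d i g = dir_deriv (axis i 1, 0) g" for i and g :: "spacetime \<Rightarrow> real"
  define dt where "dt g = dir_deriv (0, 1) g" for g :: "spacetime \<Rightarrow> real"
  have v2: "Ck (Suc (Suc 0)) v" using V by (simp add: v_def)
  have A2: "Ck (Suc (Suc 0)) AA" using A by (simp add: AA_def)
  have \<alpha>2: "Ck (Suc (Suc 0)) (\<alpha> j)" for j unfolding \<alpha>_def by (rule Ck_component[OF A2])
  have v_eq: "V r t = v (r, t)" for r t by (simp add: v_def)
  have A_eq: "A r t = AA (r, t)" for r t by (simp add: AA_def)
  have \<alpha>_eq: "A r t $ j = \<alpha> j (r, t)" for r t j by (simp add: \<alpha>_def AA_def)
  have Cd: "Ck (Suc 0) (d i g)" if "Ck (Suc (Suc 0)) g" for i g unfolding d_def by (rule Ck_dir_deriv[OF that])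
  have Cdt: "Ck (Suc 0) (dt g)" if "Ck (Suc (Suc 0)) g" for g unfolding dt_def by (rule Ck_dir_deriv[OF that])
  have dd: "d i (d j g) y = d j (d i g) y" if "Ck (Suc (Suc 0)) g" for i j g y
    unfolding d_def by (rule dir_deriv_commute[OF that])
  have dtd: "dt (d j g) y = d j (dt g) y" if "Ck (Suc (Suc 0)) g" for j g y
    unfolding d_def dt_def by (rule dir_deriv_commute[OF that])
  have partial: "partial i F r = d i g (r, t)" if "\<And>x. F x = g (x, t)" "Ck (Suc k) g" for i F g r t k
    unfolding d_def by (rule partial_eq_dir_deriv[OF that])
  have lin_d: "d i (\<lambda>z. x * g z + y * h z) z = x * d i g z + y * d i h z"
    if "Ck (Suc 0) g" "Ck (Suc 0) h" for i x y z and g h :: "spacetime \<Rightarrow> real"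
    unfolding d_def by (rule dir_deriv_lincomb[OF that])
  have lin_dt: "dt (\<lambda>z. x * g z + y * h z) z = x * dt g z + y * dt h z"
    if "Ck (Suc 0) g" "Ck (Suc 0) h" for x y z and g h :: "spacetime \<Rightarrow> real"
    unfolding dt_def by (rule dir_deriv_lincomb[OF that])
  note C\<alpha>d = Cd[OF \<alpha>2] and C\<alpha>t = Cdt[OF \<alpha>2] and Cvd = Cd[OF v2] and Cvt = Cdt[OF v2]
  have lor: "d 1 (\<alpha> 1) y + d 2 (\<alpha> 2) y + d 3 (\<alpha> 3) y + \<mu> * \<epsilon> * dt v y = 0" for y
  proof -
    obtain r t where y: "y = (r, t)" by (cases y)
    have "partial i (\<lambda>x. A x t $ i) r = d i (\<alpha> i) y" for i
      unfolding y by (rule partial[OF \<alpha>_eq \<alpha>2])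
    moreover have "time_deriv V r t = dt v y"
      unfolding y dt_def by (rule time_deriv_eq_dir_deriv[OF v_eq v2])
    ultimately show ?thesis using lorenz[of t r] by (simp add: divergence_def sum_3)
  qed
  have dlor: "dir_deriv w (d 1 (\<alpha> 1)) y + dir_deriv w (d 2 (\<alpha> 2)) y + dir_deriv w (d 3 (\<alpha> 3)) y
      + \<mu> * \<epsilon> * dir_deriv w (dt v) y = 0" for w y
  proof -
    have "((\<lambda>y. d 1 (\<alpha> 1) y + d 2 (\<alpha> 2) y + d 3 (\<alpha> 3) y + \<mu> * \<epsilon> * dt v y) has_derivative
      (\<lambda>w. dir_deriv w (d 1 (\<alpha> 1)) y + dir_deriv w (d 2 (\<alpha> 2)) y + dir_deriv w (d 3 (\<alpha> 3)) y
      + \<mu> * \<epsilon> * dir_deriv w (dt v) y)) (at y)"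
      by (intro has_derivative_add has_derivative_mult_right Ck_has_derivative[OF C\<alpha>d] Ck_has_derivative[OF Cvt])
    then have "((\<lambda>y. 0) has_derivative
      (\<lambda>w. dir_deriv w (d 1 (\<alpha> 1)) y + dir_deriv w (d 2 (\<alpha> 2)) y + dir_deriv w (d 3 (\<alpha> 3)) y
      + \<mu> * \<epsilon> * dir_deriv w (dt v) y)) (at y)"
      by (simp only: lor)
    from has_derivative_unique[OF this has_derivative_const] show ?thesis by (rule fun_cong)
  qed
  have dlor_d: "d i (d 1 (\<alpha> 1)) y + d i (d 2 (\<alpha> 2)) y + d i (d 3 (\<alpha> 3)) y + \<mu> * \<epsilon> * d i (dt v) y = 0" for i y
    using dlor[of "(axis i 1, 0)" y] unfolding d_def .
  have dlor_dt: "dt (d 1 (\<alpha> 1)) y + dt (d 2 (\<alpha> 2)) y + dt (d 3 (\<alpha> 3)) y + \<mu> * \<epsilon> * dt (dt v) y = 0" for y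
    using dlor[of "(0, 1)" y] unfolding dt_def .
  have wv: "d 1 (d 1 v) (r, t) + d 2 (d 2 v) (r, t) + d 3 (d 3 v) (r, t) - \<mu> * \<epsilon> * dt (dt v) (r, t) = - \<rho> r t / \<epsilon>" for r t
    using waveV[of t r]
    unfolding laplacian_eq_dir_deriv[OF v_eq v2] second_time_deriv_eq_dir_deriv[OF v_eq v2] d_def dt_def sum_3 .
  have w\<alpha>: "d 1 (d 1 (\<alpha> j)) (r, t) + d 2 (d 2 (\<alpha> j)) (r, t) + d 3 (d 3 (\<alpha> j)) (r, t)
      - \<mu> * \<epsilon> * dt (dt (\<alpha> j)) (r, t) = - (\<mu> * J r t $ j)" for r t j
  proof -
    have comp: "dir_deriv w (dir_deriv w (\<alpha> j)) y = dir_deriv w (dir_deriv w AA) y $ j" for w y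
      unfolding \<alpha>_def dir_deriv_component[OF A2] dir_deriv_component[OF Ck_dir_deriv[OF A2]] ..
    have "(laplacian (\<lambda>x. A x t) r - (\<mu> * \<epsilon>) *\<^sub>R time_deriv (time_deriv A) r t) $ j = - (\<mu> * J r t $ j)"
      unfolding waveA by simp
    then show ?thesis
      unfolding laplacian_eq_dir_deriv[OF A_eq A2] second_time_deriv_eq_dir_deriv[OF A_eq A2] d_def dt_def sum_3
      by (simp add: comp)
  qed
  define e where "e i = (\<lambda>z. (- 1) * d i v z + (- 1) * dt (\<alpha> i) z)" for i
  have e_eq: "E r t $ i = e i (r, t)" for r t i
    unfolding E e_def
    by (simp add: grad_def partial[OF v_eq v2] time_deriv_vec3_component[OF \<alpha>_eq \<alpha>2] dt_def)
  have Ce: "Ck (Suc 0) (e i)" for i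
    unfolding e_def by (rule Ck_lincomb[OF Cvd C\<alpha>t])
  have de: "d j (e i) z = - d j (d i v) z - d j (dt (\<alpha> i)) z" for i j z
    unfolding e_def lin_d[OF Cvd C\<alpha>t] by simp
  have dte: "dt (e i) z = - dt (d i v) z - dt (dt (\<alpha> i)) z" for i z
    unfolding e_def lin_dt[OF Cvd C\<alpha>t] by simp
  (* The components of the magnetic field: m i j is the (i, j) entry of the antisymmetrized gradient of A. *)
  define m where "m i j = (\<lambda>z. 1 * d i (\<alpha> j) z + (- 1) * d j (\<alpha> i) z)" for i j
  have Cm: "Ck (Suc 0) (m i j)" for i j
    unfolding m_def by (rule Ck_lincomb[OF C\<alpha>d C\<alpha>d])
  have dm: "d k (m i j) z = d k (d i (\<alpha> j)) z - d k (d j (\<alpha> i)) z" for i j k z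
    unfolding m_def lin_d[OF C\<alpha>d C\<alpha>d] by simp
  have dtm: "dt (m i j) z = dt (d i (\<alpha> j)) z - dt (d j (\<alpha> i)) z" for i j z
    unfolding m_def lin_dt[OF C\<alpha>d C\<alpha>d] by simp
  define mm where "mm i = (if i = (1::3) then m 2 3 else if i = 2 then m 3 1 else m 1 2)" for i
  have mm: "mm 1 = m 2 3" "mm 2 = m 3 1" "mm 3 = m 1 2" by (simp_all add: mm_def)
  have Cmm: "Ck (Suc 0) (mm i)" for i unfolding mm_def using Cm by simp
  have mm_eq: "B r t $ i = mm i (r, t)" for r t i
  proof -
    have "\<forall>i. B r t $ i = mm i (r, t)"
      unfolding forall_3 B curl_def mm m_def by (simp add: partial[OF \<alpha>_eq \<alpha>2])
    then show ?thesis by blast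
  qed
  have pe: "partial j (\<lambda>x. E x t $ i) r = d j (e i) (r, t)" for i j r t
    by (rule partial[OF e_eq Ce])
  have pm: "partial j (\<lambda>x. B x t $ i) r = d j (mm i) (r, t)" for i j r t
    by (rule partial[OF mm_eq Cmm])
  have te: "time_deriv E r t $ i = dt (e i) (r, t)" for i r t
    unfolding dt_def by (rule time_deriv_vec3_component[OF e_eq Ce])
  have tm: "time_deriv B r t $ i = dt (mm i) (r, t)" for i r t
    unfolding dt_def by (rule time_deriv_vec3_component[OF mm_eq Cmm])
  show ?thesis
    unfolding maxwell_equations_def
  proof (intro allI conjI)
    fix r :: "real^3" and t :: real
    let ?z = "(r, t)"
    show "divergence (\<lambda>x. E x t) r = \<rho> r t / \<epsilon>"
      using wv[of r t] dlor_dt[of ?z]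
      unfolding divergence_def sum_3 pe de dtd[OF \<alpha>2] by linarith
    show "divergence (\<lambda>x. B x t) r = 0"
      unfolding divergence_def sum_3 pm mm dm
      using dd[OF \<alpha>2, of 1 2 3 ?z] dd[OF \<alpha>2, of 1 3 2 ?z] dd[OF \<alpha>2, of 2 3 1 ?z] by linarith
    show "curl (\<lambda>x. E x t) r = - time_deriv B r t"
      unfolding vec_eq_iff forall_3
      using dd[OF v2, of 1 2 ?z] dd[OF v2, of 1 3 ?z] dd[OF v2, of 2 3 ?z]
      by (simp add: curl_def tm pe mm de dtm dtd[OF \<alpha>2])
    show "curl (\<lambda>x. B x t) r = \<mu> *\<^sub>R J r t + (\<mu> * \<epsilon>) *\<^sub>R time_deriv E r t"
    proof -
      have te': "(\<mu> * \<epsilon>) * dt (e i) ?z = - (\<mu> * \<epsilon> * d i (dt v) ?z) - \<mu> * \<epsilon> * dt (dt (\<alpha> i)) ?z" for i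
        unfolding dte dtd[OF v2] by (simp add: algebra_simps)
      have "d 2 (mm 3) ?z - d 3 (mm 2) ?z = \<mu> * J r t $ 1 + (\<mu> * \<epsilon>) * dt (e 1) ?z"
        unfolding mm dm te'
        using w\<alpha>[of 1 r t] dlor_d[of 1 ?z] dd[OF \<alpha>2, of 1 2 2 ?z] dd[OF \<alpha>2, of 1 3 3 ?z] by linarith
      moreover have "d 3 (mm 1) ?z - d 1 (mm 3) ?z = \<mu> * J r t $ 2 + (\<mu> * \<epsilon>) * dt (e 2) ?z"
        unfolding mm dm te'
        using w\<alpha>[of 2 r t] dlor_d[of 2 ?z] dd[OF \<alpha>2, of 2 1 1 ?z] dd[OF \<alpha>2, of 2 3 3 ?z] by linarith
      moreover have "d 1 (mm 2) ?z - d 2 (mm 1) ?z = \<mu> * J r t $ 3 + (\<mu> * \<epsilon>) * dt (e 3) ?z"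
        unfolding mm dm te'
        using w\<alpha>[of 3 r t] dlor_d[of 3 ?z] dd[OF \<alpha>2, of 3 1 1 ?z] dd[OF \<alpha>2, of 3 2 2 ?z] by linarith
      ultimately show ?thesis
        unfolding vec_eq_iff forall_3 by (simp add: curl_def pm te)
    qed
  qed
qed

section \<open>Jefimenko's equations\<close>

text \<open>In terms of \<open>u = r' - r\<close> the unit vector from \<open>r'\<close> to \<open>r\<close> is \<open>- sgn u\<close>.  Each component of the integrand is then a
  combination of the kernels in the gradient formula for the potential.\<close>

lemma jefimenko_E_components:
  fixes \<rho> :: "real^3 \<Rightarrow> real \<Rightarrow> real" and J :: "real^3 \<Rightarrow> real \<Rightarrow> real^3"
  assumes \<rho>: "admissible_source c (\<lambda>(r, t). \<rho> r t)" and J: "admissible_source c (\<lambda>(r, t). J r t)"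
  shows "integrable lborel (jefimenko_E_integrand c \<rho> J r t)"
    and "(LINT r'|lborel. jefimenko_E_integrand c \<rho> J r t r') $ i
      = - dir_deriv (axis i 1, 0) (inv_dist_potential c (\<lambda>(r, t). \<rho> r t)) (r, t)
        - (1 / c\<^sup>2) * dir_deriv (0, 1) (inv_dist_potential c (\<lambda>(r, t). J r t)) (r, t) $ i"
proof -
  define \<rho>\<rho> where "\<rho>\<rho> = (\<lambda>(r, t). \<rho> r t)"
  define JJ where "JJ = (\<lambda>(r, t). J r t)"
  note \<rho>' = \<rho>[folded \<rho>\<rho>_def] and J' = J[folded JJ_def]
  note \<rho>2 = Ck2_source[OF \<rho>'] and J2 = Ck2_source[OF J']
  define F where "F y = (\<rho>\<rho> y, dir_deriv (0, 1) \<rho>\<rho> y, dir_deriv (0, 1) JJ y)" for y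
  define h where "h u = (\<lambda>(x, x', w). - ((x / (norm u)\<^sup>2) *\<^sub>R sgn u) - (x' / (c * norm u)) *\<^sub>R sgn u
      - w /\<^sub>R (c\<^sup>2 * norm u))" for u :: "real^3" and w :: "real^3"
  have h: "jefimenko_E_integrand c \<rho> J r t = (\<lambda>r'. h (r' - r) (F (r', t - norm (r - r') / c)))"
  proof
    fix r'
    have "sgn (r - r') = - sgn (r' - r)" using sgn_minus[of "r' - r"] by simp
    then show "jefimenko_E_integrand c \<rho> J r t r' = h (r' - r) (F (r', t - norm (r - r') / c))"
      by (simp add: jefimenko_E_integrand_def h_def F_def Let_def norm_minus_commute[of r' r]
          time_deriv_eq_dir_deriv[OF _ \<rho>2] time_deriv_eq_dir_deriv[OF _ J2] \<rho>\<rho>_def JJ_def)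
  qed
  let ?y = "\<lambda>u. (r, t) + past_cone c u"
  define T1 where "T1 i u = ((sgn u \<bullet> axis i 1) / (norm u)\<^sup>2) *\<^sub>R \<rho>\<rho> (?y u)" for i u
  define T2 where "T2 i u = ((sgn u \<bullet> axis i 1) / (c * norm u)) *\<^sub>R dir_deriv (0, 1) \<rho>\<rho> (?y u)" for i u
  define T3 where "T3 u = (1 / norm u) *\<^sub>R dir_deriv (0, 1) JJ (?y u)" for u
  have int1: "integrable lborel (T1 i)" for i
    unfolding T1_def
    by (rule integrable_cone_tails[OF Ck_continuous[OF \<rho>2] _ locally_integrable_sgn_inverse_square sgn_inverse_square_far])
      (use \<rho>' in \<open>auto simp: admissible_source_def\<close>)
  have int2: "integrable lborel (T2 i)" for i
    unfolding T2_def
    by (rule integrable_cone_tails[OF Ck_continuous[OF Ck_dir_deriv[OF \<rho>2]] _ locally_integrable_sgn_inverse_norm sgn_inverse_norm_far])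
      (use \<rho>' in \<open>auto simp: admissible_source_def\<close>)
  have int3: "integrable lborel T3"
    unfolding T3_def
    by (rule integrable_cone_tails[OF Ck_continuous[OF Ck_dir_deriv[OF J2]] _ locally_integrable_inverse_norm, where K=1])
      (use J' in \<open>auto simp: admissible_source_def\<close>)
  have int3': "integrable lborel (\<lambda>u. T3 u $ i)" for i
    by (rule integrable_bounded_linear[OF bounded_linear_vec_nth int3])
  have comp: "(\<lambda>u. h u (F (?y u)) $ i) = (\<lambda>u. - T1 i u - T2 i u - (1 / c\<^sup>2) * (T3 u $ i))" for i
    by (rule ext) (simp add: h_def F_def T1_def T2_def T3_def inner_axis mult_ac divide_inverse)
  have int: "integrable lborel (\<lambda>u. h u (F (?y u)))"
    by (rule integrable_vec3, unfold comp) (intro Bochner_Integration.integrable_diff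
        Bochner_Integration.integrable_minus integrable_mult_right int1 int2 int3')
  show "integrable lborel (jefimenko_E_integrand c \<rho> J r t)"
    unfolding h by (rule retarded_integral_cone(1)[where h=h and F=F, OF int])
  have "(LINT r'|lborel. jefimenko_E_integrand c \<rho> J r t r') $ i = (LINT u|lborel. h u (F (?y u)) $ i)"
    unfolding h retarded_integral_cone(2)[where h=h and F=F, OF int] by (rule integral_vec3_component[OF int])
  also have "\<dots> = - (LINT u|lborel. T1 i u) - (LINT u|lborel. T2 i u) - (1 / c\<^sup>2) * (LINT u|lborel. T3 u) $ i"
    unfolding comp integral_vec3_component[OF int3] using int1 int2 int3' by simp
  also have "\<dots> = - dir_deriv (axis i 1, 0) (inv_dist_potential c \<rho>\<rho>) (r, t)
        - (1 / c\<^sup>2) * dir_deriv (0, 1) (inv_dist_potential c JJ) (r, t) $ i"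
    unfolding potential_space_derivative[OF \<rho>'] potential_time_derivative[OF J']
    by (simp add: cone_integral_def inv_dist_potential_def T1_def T2_def T3_def)
  finally show "(LINT r'|lborel. jefimenko_E_integrand c \<rho> J r t r') $ i
      = - dir_deriv (axis i 1, 0) (inv_dist_potential c (\<lambda>(r, t). \<rho> r t)) (r, t)
        - (1 / c\<^sup>2) * dir_deriv (0, 1) (inv_dist_potential c (\<lambda>(r, t). J r t)) (r, t) $ i"
    unfolding \<rho>\<rho>_def JJ_def .
qed

lemma jefimenko_B_components:
  fixes J :: "real^3 \<Rightarrow> real \<Rightarrow> real^3" and r :: "real^3" and t :: real
  assumes J: "admissible_source c (\<lambda>(r, t). J r t)"
  defines "D \<equiv> \<lambda>i j. dir_deriv (axis i 1, 0) (inv_dist_potential c (\<lambda>(r, t). J r t)) (r, t) $ j"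
  shows "integrable lborel (jefimenko_B_integrand c J r t)"
    and "(LINT r'|lborel. jefimenko_B_integrand c J r t r')
      = vector [D 2 3 - D 3 2, D 3 1 - D 1 3, D 1 2 - D 2 1]"
proof -
  define JJ where "JJ = (\<lambda>(r, t). J r t)"
  note J' = J[folded JJ_def]
  note J2 = Ck2_source[OF J']
  define F where "F y = (JJ y, dir_deriv (0, 1) JJ y)" for y
  define h where "h u = (\<lambda>(x, x'). cross3 (x /\<^sub>R (norm u)\<^sup>2 + x' /\<^sub>R (c * norm u)) (- sgn u))" for u :: "real^3"
  have h: "jefimenko_B_integrand c J r t = (\<lambda>r'. h (r' - r) (F (r', t - norm (r - r') / c)))"
  proof
    fix r'
    have "sgn (r - r') = - sgn (r' - r)" using sgn_minus[of "r' - r"] by simp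
    then show "jefimenko_B_integrand c J r t r' = h (r' - r) (F (r', t - norm (r - r') / c))"
      by (simp add: jefimenko_B_integrand_def h_def F_def Let_def norm_minus_commute[of r' r]
          time_deriv_eq_dir_deriv[OF _ J2] JJ_def)
  qed
  let ?y = "\<lambda>u. (r, t) + past_cone c u"
  define S1 where "S1 i u = ((sgn u \<bullet> axis i 1) / (c * norm u)) *\<^sub>R dir_deriv (0, 1) JJ (?y u)" for i u
  define S2 where "S2 i u = ((sgn u \<bullet> axis i 1) / (norm u)\<^sup>2) *\<^sub>R JJ (?y u)" for i u
  have int1: "integrable lborel (S1 i)" for i
    unfolding S1_def
    by (rule integrable_cone_tails[OF Ck_continuous[OF Ck_dir_deriv[OF J2]] _ locally_integrable_sgn_inverse_norm sgn_inverse_norm_far])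
      (use J' in \<open>auto simp: admissible_source_def\<close>)
  have int2: "integrable lborel (S2 i)" for i
    unfolding S2_def
    by (rule integrable_cone_tails[OF Ck_continuous[OF J2] _ locally_integrable_sgn_inverse_square sgn_inverse_square_far])
      (use J' in \<open>auto simp: admissible_source_def\<close>)
  have intS: "integrable lborel (\<lambda>u. (S1 i u + S2 i u) $ j)" for i j
    by (intro integrable_bounded_linear[OF bounded_linear_vec_nth] Bochner_Integration.integrable_add int1 int2)
  have S: "(LINT u|lborel. (S1 i u + S2 i u) $ j) = D i j" for i j
    unfolding D_def JJ_def[symmetric] potential_space_derivative[OF J']
    unfolding integral_vec3_component[OF Bochner_Integration.integrable_add[OF int1 int2], symmetric]
    unfolding Bochner_Integration.integral_add[OF int1 int2]
    unfolding cone_integral_def S1_def S2_def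
    by (rule refl)
  have comp: "h u (F (?y u)) = vector [(S1 2 u + S2 2 u) $ 3 - (S1 3 u + S2 3 u) $ 2,
      (S1 3 u + S2 3 u) $ 1 - (S1 1 u + S2 1 u) $ 3, (S1 1 u + S2 1 u) $ 2 - (S1 2 u + S2 2 u) $ 1]" for u
    unfolding vec_eq_iff forall_3
    by (simp add: h_def F_def S1_def S2_def inner_axis cross3_def algebra_simps divide_inverse)
  have compi: "integrable lborel (\<lambda>u. h u (F (?y u)) $ i)" for i
  proof -
    have "\<forall>i. integrable lborel (\<lambda>u. h u (F (?y u)) $ i)"
      unfolding forall_3 comp vector_3 by (intro conjI Bochner_Integration.integrable_diff intS)
    then show ?thesis by blast
  qed
  have int: "integrable lborel (\<lambda>u. h u (F (?y u)))" by (rule integrable_vec3[OF compi])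
  show "integrable lborel (jefimenko_B_integrand c J r t)"
    unfolding h by (rule retarded_integral_cone(1)[where h=h and F=F, OF int])
  show "(LINT r'|lborel. jefimenko_B_integrand c J r t r')
      = vector [D 2 3 - D 3 2, D 3 1 - D 1 3, D 1 2 - D 2 1]"
    unfolding h retarded_integral_cone(2)[where h=h and F=F, OF int] vec_eq_iff integral_vec3_component[OF int]
    unfolding forall_3 comp vector_3
    unfolding Bochner_Integration.integral_diff[OF intS intS] S by simp
qed

theorem lemma1p2:
  fixes \<epsilon>\<^sub>0 \<mu>\<^sub>0 c :: real
    and \<rho> V' :: "real^3 \<Rightarrow> real \<Rightarrow> real"
    and J A' E' B' :: "real^3 \<Rightarrow> real \<Rightarrow> real^3"
  assumes "\<epsilon>\<^sub>0 > 0" and "\<mu>\<^sub>0 > 0" and "c = 1 / sqrt (\<mu>\<^sub>0 * \<epsilon>\<^sub>0)"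
    and "smooth (\<lambda>(r, t). \<rho> r t)" and "smooth (\<lambda>(r, t). J r t)"
    and "retarded_potential_exists c \<rho>" and "retarded_potential_exists c J"
    and V': "\<And>r t. V' r t = 1 / (4 * pi * \<epsilon>\<^sub>0) *
          (LINT r'|lborel. \<rho> r' (t - norm (r - r') / c) / norm (r - r'))"
    and A': "\<And>r t. A' r t = (\<mu>\<^sub>0 / (4 * pi)) *\<^sub>R
          (LINT r'|lborel. J r' (t - norm (r - r') / c) /\<^sub>R norm (r - r'))"
    and continuity: "\<And>r t. time_deriv \<rho> r t + divergence (\<lambda>x. J x t) r = 0"
    and vanishing: "\<And>t. ((\<lambda>r. J r t) \<longlongrightarrow> 0) at_infinity"
    and E': "\<And>r t. E' r t = - grad (\<lambda>x. V' x t) r - time_deriv A' r t"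
    and B': "\<And>r t. B' r t = curl (\<lambda>x. A' x t) r"
  shows
    "(\<comment> \<open>the potentials are given by convergent integrals and are twice continuously differentiable\<close>
      (\<forall>r t. integrable lborel (\<lambda>r'. \<rho> r' (t - norm (r - r') / c) / norm (r - r')) \<and>
             integrable lborel (\<lambda>r'. J r' (t - norm (r - r') / c) /\<^sub>R norm (r - r'))) \<and>
      Ck 2 (\<lambda>(r, t). V' r t) \<and> Ck 2 (\<lambda>(r, t). A' r t)) \<and>
     \<comment> \<open>Lorenz gauge condition\<close>
     (\<forall>r t. divergence (\<lambda>x. A' x t) r + \<mu>\<^sub>0 * \<epsilon>\<^sub>0 * time_deriv V' r t = 0) \<and>
     \<comment> \<open>inhomogeneous wave equations\<close>
     (\<forall>r t. laplacian (\<lambda>x. V' x t) r - \<mu>\<^sub>0 * \<epsilon>\<^sub>0 * time_deriv (time_deriv V') r t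
              = - \<rho> r t / \<epsilon>\<^sub>0) \<and>
     (\<forall>r t. laplacian (\<lambda>x. A' x t) r - (\<mu>\<^sub>0 * \<epsilon>\<^sub>0) *\<^sub>R time_deriv (time_deriv A') r t
              = - (\<mu>\<^sub>0 *\<^sub>R J r t)) \<and>
     \<comment> \<open>Jefimenko's equations\<close>
     (\<forall>r t. integrable lborel (jefimenko_E_integrand c \<rho> J r t) \<and>
            E' r t = (1 / (4 * pi * \<epsilon>\<^sub>0)) *\<^sub>R (LINT r'|lborel. jefimenko_E_integrand c \<rho> J r t r')) \<and>
     (\<forall>r t. integrable lborel (jefimenko_B_integrand c J r t) \<and>
            B' r t = (\<mu>\<^sub>0 / (4 * pi)) *\<^sub>R (LINT r'|lborel. jefimenko_B_integrand c J r t r')) \<and>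
     maxwell_equations \<epsilon>\<^sub>0 \<mu>\<^sub>0 \<rho> J E' B'"
proof -
  have c: "c > 0" using assms(1-3) by simp
  have c2: "1 / c\<^sup>2 = \<mu>\<^sub>0 * \<epsilon>\<^sub>0"
    using assms(1-2) by (simp add: assms(3) power_divide)
  define \<rho>\<rho> where "\<rho>\<rho> = (\<lambda>(r, t). \<rho> r t)"
  define JJ where "JJ = (\<lambda>(r, t). J r t)"
  have \<rho>: "admissible_source c \<rho>\<rho>" and J: "admissible_source c JJ"
    unfolding \<rho>\<rho>_def JJ_def by (intro admissible_sourceI assms(4-7))+
  note \<rho>2 = Ck2_source[OF \<rho>] and J2 = Ck2_source[OF J]
  define P where "P = inv_dist_potential c \<rho>\<rho>"
  define Q where "Q = inv_dist_potential c JJ"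
  have P2: "Ck (Suc (Suc 0)) P" unfolding P_def by (rule Ck2_potential[OF \<rho>])
  have Q2: "Ck (Suc (Suc 0)) Q" unfolding Q_def by (rule Ck2_potential[OF J])
  define a where "a = 1 / (4 * pi * \<epsilon>\<^sub>0)"
  define b where "b = \<mu>\<^sub>0 / (4 * pi)"
  have ab: "a * (\<mu>\<^sub>0 * \<epsilon>\<^sub>0) = b" "a * (4 * pi) = 1 / \<epsilon>\<^sub>0" "b * (4 * pi) = \<mu>\<^sub>0"
    using assms(1-2) by (simp_all add: a_def b_def field_simps)
  have int\<rho>: "integrable lborel (\<lambda>u. (1 / norm u) *\<^sub>R \<rho>\<rho> ((r, t) + past_cone c u))" for r t
    by (rule integrable_cone_tails[OF Ck_continuous[OF \<rho>2] _ locally_integrable_inverse_norm, where K=1])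
      (use \<rho> in \<open>auto simp: admissible_source_def\<close>)
  have intJ: "integrable lborel (\<lambda>u. (1 / norm u) *\<^sub>R JJ ((r, t) + past_cone c u))" for r t
    by (rule integrable_cone_tails[OF Ck_continuous[OF J2] _ locally_integrable_inverse_norm, where K=1])
      (use J in \<open>auto simp: admissible_source_def\<close>)
  have i\<rho>: "(\<lambda>r'. (1 / norm (r' - r)) *\<^sub>R \<rho>\<rho> (r', t - norm (r - r') / c))
      = (\<lambda>r'. \<rho> r' (t - norm (r - r') / c) / norm (r - r'))" for r t
    by (rule ext) (simp add: \<rho>\<rho>_def norm_minus_commute)
  have iJ: "(\<lambda>r'. (1 / norm (r' - r)) *\<^sub>R JJ (r', t - norm (r - r') / c))
      = (\<lambda>r'. J r' (t - norm (r - r') / c) /\<^sub>R norm (r - r'))" for r t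
    by (rule ext) (simp add: JJ_def norm_minus_commute divide_inverse)
  have int_V: "integrable lborel (\<lambda>r'. \<rho> r' (t - norm (r - r') / c) / norm (r - r'))"
    and V_eq: "V' r t = a *\<^sub>R P (r, t)" for r t
    using retarded_integral_cone[where h="\<lambda>u x. (1 / norm u) *\<^sub>R x" and F=\<rho>\<rho>, OF int\<rho>, of r t]
    unfolding i\<rho> by (simp_all add: V' a_def P_def inv_dist_potential_def cone_integral_def)
  have int_A: "integrable lborel (\<lambda>r'. J r' (t - norm (r - r') / c) /\<^sub>R norm (r - r'))"
    and A_eq: "A' r t = b *\<^sub>R Q (r, t)" for r t
    using retarded_integral_cone[where h="\<lambda>u x. (1 / norm u) *\<^sub>R x" and F=JJ, OF intJ, of r t]
    unfolding iJ by (simp_all add: A' b_def Q_def inv_dist_potential_def cone_integral_def)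
  have V_fun: "(\<lambda>(r, t). V' r t) = (\<lambda>z. a *\<^sub>R P z)" and A_fun: "(\<lambda>(r, t). A' r t) = (\<lambda>z. b *\<^sub>R Q z)"
    by (auto simp: V_eq A_eq)
  note CV = Ck_scale[OF P2, of a] and CA = Ck_scale[OF Q2, of b]
  have A_comp: "A' r t $ i = (b *\<^sub>R Q (r, t)) $ i" for r t i by (simp add: A_eq)
  have partial_A: "partial j (\<lambda>x. A' x t $ i) r = b * dir_deriv (axis j 1, 0) Q (r, t) $ i" for i j r t
    unfolding partial_eq_dir_deriv[OF A_comp Ck_component[OF CA]] dir_deriv_component[OF CA] dir_deriv_scale[OF Q2]
    by simp
  have time_V: "time_deriv V' r t = a * dir_deriv (0, 1) P (r, t)" for r t
    unfolding time_deriv_eq_dir_deriv[OF V_eq CV] dir_deriv_scale[OF P2] by simp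
  have time_A: "time_deriv A' r t = b *\<^sub>R dir_deriv (0, 1) Q (r, t)" for r t
    unfolding time_deriv_eq_dir_deriv[OF A_eq CA] dir_deriv_scale[OF Q2] ..
  have conserved: "dir_deriv (0, 1) \<rho>\<rho> y + (\<Sum>i\<in>UNIV. dir_deriv (axis i 1, 0) JJ y $ i) = 0" for y
  proof -
    obtain r t where y: "y = (r, t)" by (cases y)
    have "partial i (\<lambda>x. J x t $ i) r = dir_deriv (axis i 1, 0) JJ y $ i" for i
    proof -
      have "J x t $ i = JJ (x, t) $ i" for x by (simp add: JJ_def)
      from partial_eq_dir_deriv[OF this Ck_component[OF J2]] show ?thesis
        unfolding y dir_deriv_component[OF J2] .
    qed
    moreover have "time_deriv \<rho> r t = dir_deriv (0, 1) \<rho>\<rho> y"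
      unfolding y by (rule time_deriv_eq_dir_deriv[OF _ \<rho>2]) (simp add: \<rho>\<rho>_def)
    ultimately show ?thesis using continuity[of r t] by (simp add: divergence_def)
  qed
  have lorenz: "divergence (\<lambda>x. A' x t) r + \<mu>\<^sub>0 * \<epsilon>\<^sub>0 * time_deriv V' r t = 0" for r t
  proof -
    have "divergence (\<lambda>x. A' x t) r + \<mu>\<^sub>0 * \<epsilon>\<^sub>0 * time_deriv V' r t
      = b * ((\<Sum>i\<in>UNIV. dir_deriv (axis i 1, 0) Q (r, t) $ i) + dir_deriv (0, 1) P (r, t))"
      unfolding divergence_def partial_A time_V ab(1)[symmetric] by (simp add: sum_distrib_left algebra_simps)
    then show ?thesis
      using potential_lorenz_gauge[OF \<rho> J conserved, of "(r, t)"] by (simp add: P_def Q_def)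
  qed
  have wave: "(\<Sum>i\<in>UNIV. dir_deriv (axis i 1, 0) (dir_deriv (axis i 1, 0) (inv_dist_potential c f)) z)
      = (\<mu>\<^sub>0 * \<epsilon>\<^sub>0) *\<^sub>R dir_deriv (0, 1) (dir_deriv (0, 1) (inv_dist_potential c f)) z - (4 * pi) *\<^sub>R f z"
    if "admissible_source c f" for z and f :: "spacetime \<Rightarrow> 'z::euclidean_space"
    using potential_wave_equation[OF that, of z] unfolding sum_Basis_vec3 c2 .
  have waveV: "laplacian (\<lambda>x. V' x t) r - \<mu>\<^sub>0 * \<epsilon>\<^sub>0 * time_deriv (time_deriv V') r t = - \<rho> r t / \<epsilon>\<^sub>0" for r t
  proof -
    have "laplacian (\<lambda>x. V' x t) r - \<mu>\<^sub>0 * \<epsilon>\<^sub>0 * time_deriv (time_deriv V') r t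
      = a * ((\<Sum>i\<in>UNIV. dir_deriv (axis i 1, 0) (dir_deriv (axis i 1, 0) P) (r, t))
        - \<mu>\<^sub>0 * \<epsilon>\<^sub>0 * dir_deriv (0, 1) (dir_deriv (0, 1) P) (r, t))"
      unfolding laplacian_eq_dir_deriv[OF V_eq CV] second_time_deriv_eq_dir_deriv[OF V_eq CV]
        dir_deriv_scale[OF P2] dir_deriv_scale[OF Ck_dir_deriv[OF P2]]
      by (simp add: sum_distrib_left algebra_simps)
    also have "\<dots> = - (a * (4 * pi)) * \<rho> r t"
      unfolding P_def wave[OF \<rho>] by (simp add: \<rho>\<rho>_def)
    finally show ?thesis unfolding ab(2) by simp
  qed
  have waveA: "laplacian (\<lambda>x. A' x t) r - (\<mu>\<^sub>0 * \<epsilon>\<^sub>0) *\<^sub>R time_deriv (time_deriv A') r t = - (\<mu>\<^sub>0 *\<^sub>R J r t)" for r t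
  proof -
    have "laplacian (\<lambda>x. A' x t) r - (\<mu>\<^sub>0 * \<epsilon>\<^sub>0) *\<^sub>R time_deriv (time_deriv A') r t
      = b *\<^sub>R ((\<Sum>i\<in>UNIV. dir_deriv (axis i 1, 0) (dir_deriv (axis i 1, 0) Q) (r, t))
        - (\<mu>\<^sub>0 * \<epsilon>\<^sub>0) *\<^sub>R dir_deriv (0, 1) (dir_deriv (0, 1) Q) (r, t))"
      unfolding laplacian_eq_dir_deriv[OF A_eq CA] second_time_deriv_eq_dir_deriv[OF A_eq CA]
        dir_deriv_scale[OF Q2] dir_deriv_scale[OF Ck_dir_deriv[OF Q2]]
      by (simp add: scaleR_sum_right scaleR_diff_right mult_ac)
    also have "\<dots> = - ((b * (4 * pi)) *\<^sub>R J r t)"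
      unfolding Q_def wave[OF J] by (simp add: JJ_def)
    finally show ?thesis unfolding ab(3) .
  qed
  have jefimenko_E: "E' r t = a *\<^sub>R (LINT r'|lborel. jefimenko_E_integrand c \<rho> J r t r')" for r t
  proof -
    have "E' r t $ i = (a *\<^sub>R (LINT r'|lborel. jefimenko_E_integrand c \<rho> J r t r')) $ i" for i
    proof -
      have "partial i (\<lambda>x. V' x t) r = a * dir_deriv (axis i 1, 0) P (r, t)"
        unfolding partial_eq_dir_deriv[OF V_eq CV] dir_deriv_scale[OF P2] by simp
      then have "E' r t $ i = - (a * dir_deriv (axis i 1, 0) P (r, t)) - b * dir_deriv (0, 1) Q (r, t) $ i"
        by (simp add: E' grad_def time_A)
      also have "\<dots> = a * (- dir_deriv (axis i 1, 0) P (r, t) - (1 / c\<^sup>2) * dir_deriv (0, 1) Q (r, t) $ i)"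
        unfolding c2 ab(1)[symmetric] by (simp add: algebra_simps)
      finally show ?thesis
        using jefimenko_E_components(2)[OF \<rho>[unfolded \<rho>\<rho>_def] J[unfolded JJ_def], of r t i]
        by (simp add: P_def Q_def \<rho>\<rho>_def JJ_def)
    qed
    then show ?thesis by (simp add: vec_eq_iff)
  qed
  have jefimenko_B: "B' r t = b *\<^sub>R (LINT r'|lborel. jefimenko_B_integrand c J r t r')" for r t
    unfolding jefimenko_B_components(2)[OF J[unfolded JJ_def]] B' curl_def partial_A vec_eq_iff forall_3
    by (simp add: Q_def JJ_def right_diff_distrib)
  have "maxwell_equations \<epsilon>\<^sub>0 \<mu>\<^sub>0 \<rho> J E' B'"
    by (rule potentials_solve_maxwell[OF _ _ lorenz waveV waveA E' B']) (simp_all only: V_fun A_fun CV CA)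
  moreover have "Ck 2 (\<lambda>(r, t). V' r t)" "Ck 2 (\<lambda>(r, t). A' r t)"
    unfolding V_fun A_fun numeral_2_eq_2 by (rule CV, rule CA)
  ultimately show ?thesis
    using int_V int_A lorenz waveV waveA jefimenko_E jefimenko_B
      jefimenko_E_components(1)[OF \<rho>[unfolded \<rho>\<rho>_def] J[unfolded JJ_def]]
      jefimenko_B_components(1)[OF J[unfolded JJ_def]]
    unfolding a_def b_def by blast
qed

end
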